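(* Let $\mathcal K$ be a bicategory in which idempotent 2-cells split. Then the pseudofunctor $F:\mathsf{Bf}(\mathcal K)\to\mathsf{Wdl}(\mathcal K)$, from the bicategory of bilinear factorization structures in $\mathcal K$ to the bicategory of weak distributive laws in $\mathcal K$, which - sends a 0-cell $(\alpha:A\to R\leftarrow B:\beta,\ \iota:R\to B\otimes A)$ to the weak distributive law $\Psi:=\iota\,\mu_R(\alpha\otimes\beta):A\otimes B\to B\otimes A$, - sends a 1-cell $(\xi,\zeta,\varrho)$ to $(\xi,\zeta)$, and - acts as the identity map on 2-cells, is a biequivalence.
   Context: Coherence isomorphisms of $\mathcal K$ are suppressed. Horizontal composition is denoted by $\otimes$ (for composable 1-cells, $M\otimes N$ means "first $N$, then $M$") and vertical composition of 2-cells by juxtaposition. A 1-cell name also denotes its identity 2-cell. A (unital) monad $(A,\mu_A,\eta_A)$ on an object $k$ is a 1-cell $A:k\to k$ with an associative multiplication $\mu_A:A\otimes A\to A$ and unit $\eta_A:k\to A$ (where $k$ also denotes the identity 1-cell). Idempotent 2-cells split in $\mathcal K$ if every 2-cell $e:M\to M$ with $e^2=e$ can be written $e=ip$ for 2-cells $p:M\to N$, $i:N\to M$ with $pi=N$ (the identity 2-cell of $N$). **Monad morphisms and transformations (in the sense of Street).** For a monad $A$ on $k$ and a monad $A'$ on $k'$, a monad morphism from $A$ to $A'$ consists of a 1-cell $V:k\to k'$ and a 2-cell $\xi:A'\otimes V\to V\otimes A$ such that $\xi(\mu_{A'}\otimes V)=(V\otimes\mu_A)(\xi\otimes A)(A'\otimes\xi)$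 and $\xi(\eta_{A'}\otimes V)=V\otimes\eta_A$. A monad transformation $(V,\xi)\to(W,\tilde\xi)$ between such monad morphisms is a 2-cell $\omega:V\to W$ with $\tilde\xi(A'\otimes\omega)=(\omega\otimes A)\xi$. The composite of $(V,\xi)$ from $A$ to $A'$ with $(V',\xi')$ from $A'$ to $A''$ is $V'\otimes V$ with 2-cell $(V'\otimes\xi)(\xi'\otimes V)$. **Weak distributive law.** For monads $A$, $B$ on the same object, a 2-cell $\Psi:A\otimes B\to B\otimes A$ is a weak distributive law of $A$ over $B$ if - $\Psi(\mu_A\otimes B)=(B\otimes\mu_A)(\Psi\otimes A)(A\otimes\Psi)$, - $\Psi(A\otimes\mu_B)=(\mu_B\otimes A)(B\otimes\Psi)(\Psi\otimes B)$, - $(\mu_B\otimes A)(B\otimes\Psi)(B\otimes A\otimes\eta_B)=(B\otimes\mu_A)(\Psi\otimes A)(\eta_A\otimes B\otimes A)$. The associated idempotent 2-cell is $\overline\Psi:=(\mu_B\otimes\mu_A)(B\otimes\Psi\otimes A)(B\otimes\eta_A\otimes\eta_B\otimes A):B\otimes A\to B\otimes A$; it is also equal to both sides of the third identity. **The bicategory $\mathsf{Wdl}(\mathcal K)$.** The 0-cells are weak distributive laws $\Psi:A\otimes B\to B\otimes A$ in $\mathcal K$. The 1-cells from $\Psi:A\otimes B\to B\otimes A$ to $\Psi':A'\otimes B'\to B'\otimes A'$ are pairs of monad morphisms $\xi:A'\otimes V\to V\otimes A$ and $\zeta:B'\otimes V\to V\otimes B$ with a common 1-cell $V$ such that $$(V\otimes\overline\Psi)(\zeta\otimes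 A)(B'\otimes\xi)(\Psi'\otimes V)=(V\otimes\Psi)(\xi\otimes B)(A'\otimes\zeta).$$ The 2-cells are the 2-cells $\omega$ of $\mathcal K$ between the underlying 1-cells that are monad transformations both with respect to the $\xi$'s and with respect to the $\zeta$'s. Horizontal and vertical compositions are induced by those in $\mathcal K$. **Bilinear factorization structure.** Let $A$, $B$, $R$ be unital monads on the same object of $\mathcal K$, and let $\alpha:A\to R$ and $\beta:B\to R$ be 2-cells that are morphisms of unital monads: $\alpha\mu_A=\mu_R(\alpha\otimes\alpha)$, $\alpha\eta_A=\eta_R$, $\beta\mu_B=\mu_R(\beta\otimes\beta)$, $\beta\eta_B=\eta_R$. Regard $R$ as a $B$-$A$ bimodule via the left $B$-action $\mu_R(\beta\otimes R)$ and the right $A$-action $\mu_R(R\otimes\alpha)$, and $B\otimes A$ as a $B$-$A$ bimodule via $\mu_B\otimes A$ and $B\otimes\mu_A$. Then $\pi:=\mu_R(\beta\otimes\alpha):B\otimes A\to R$ is a morphism of $B$-$A$ bimodules. If $\iota:R\to B\otimes A$ is a morphism of $B$-$A$ bimodules with $\pi\iota=R$ (the identity 2-cell of $R$), then $(\alpha:A\to R\leftarrow B:\beta,\ \iota:R\to B\otimes A)$ is called a bilinear factorization structure on $R$. **The bicategory $\mathsf{Bf}(\mathcal K)$.** The 0-cells are the bilinear factorization structures in $\mathcal K$. The 1-cells from $(\alpha:A\to R\leftarrow B:\beta,\ \iota:R\to B\otimes A)$ to $(\alpha':A'\to R'\leftarrow B':\beta',\ \iota':R'\to B'\otimes A')$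 are triples of monad morphisms $\xi:A'\otimes V\to V\otimes A$, $\zeta:B'\otimes V\to V\otimes B$ and $\varrho:R'\otimes V\to V\otimes R$ with a common 1-cell $V$ such that $$\varrho(\alpha'\otimes V)=(V\otimes\alpha)\xi\qquad\text{and}\qquad \varrho(\beta'\otimes V)=(V\otimes\beta)\zeta .$$ The 2-cells are the 2-cells $\omega$ of $\mathcal K$ between the underlying 1-cells that are monad transformations with respect to the $\xi$'s, the $\zeta$'s and the $\varrho$'s. Horizontal and vertical compositions are induced by those in $\mathcal K$. For any bilinear factorization structure, $\iota\,\mu_R(\alpha\otimes\beta)$ is a weak distributive law of $A$ over $B$, and for any 1-cell $(\xi,\zeta,\varrho)$ of $\mathsf{Bf}(\mathcal K)$ the pair $(\xi,\zeta)$ is a 1-cell of $\mathsf{Wdl}(\mathcal K)$, so the pseudofunctor $F$ is well defined. *)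

theory Defs
  imports Main
begin

section \<open>Bicategories\<close>

text \<open>Composition is written in application order, for 1-cells (\<open>M \<otimes> N\<close> is "first \<open>N\<close>, then \<open>M\<close>")
  as well as for the vertical composition \<open>g \<cdot> f\<close> of 2-cells. All operations are only
  meaningful on composable cells; the axioms say nothing about other arguments.\<close>

record ('o, 'm, 'c) bicat =
  Ob :: "'o set"
  Mor :: "'m set"
  Src :: "'m \<Rightarrow> 'o"
  Trg :: "'m \<Rightarrow> 'o"
  Cell :: "'c set"
  Dom :: "'c \<Rightarrow> 'm"
  Cod :: "'c \<Rightarrow> 'm"
  id1 :: "'o \<Rightarrow> 'm"
  id2 :: "'m \<Rightarrow> 'c"
  comp1 :: "'m \<Rightarrow> 'm \<Rightarrow> 'm"  (infixl "\<otimes>\<index>" 75)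
  hcomp :: "'c \<Rightarrow> 'c \<Rightarrow> 'c"  (infixl "\<star>\<index>" 70)
  vcomp :: "'c \<Rightarrow> 'c \<Rightarrow> 'c"  (infixr "\<cdot>\<index>" 60)
  asc :: "'m \<Rightarrow> 'm \<Rightarrow> 'm \<Rightarrow> 'c"  ("\<a>\<index>")
  lun :: "'m \<Rightarrow> 'c"  ("\<l>\<index>")
  run :: "'m \<Rightarrow> 'c"  ("\<r>\<index>")

abbreviation lwhisk  (infixr "\<lhd>\<index>" 70)
  where "M \<lhd>\<^bsub>K\<^esub> f \<equiv> id2 K M \<star>\<^bsub>K\<^esub> f"

abbreviation rwhisk  (infixl "\<rhd>\<index>" 70)
  where "f \<rhd>\<^bsub>K\<^esub> M \<equiv> f \<star>\<^bsub>K\<^esub> id2 K M"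

definition hom1 :: "('o, 'm, 'c) bicat \<Rightarrow> 'o \<Rightarrow> 'o \<Rightarrow> 'm set"
  where "hom1 K a b = {M \<in> Mor K. Src K M = a \<and> Trg K M = b}"

definition hom2 :: "('o, 'm, 'c) bicat \<Rightarrow> 'm \<Rightarrow> 'm \<Rightarrow> 'c set"
  where "hom2 K M N = {f \<in> Cell K. Dom K f = M \<and> Cod K f = N}"

definition inverse2 :: "('o, 'm, 'c) bicat \<Rightarrow> 'c \<Rightarrow> 'c \<Rightarrow> bool"
  where "inverse2 K f g \<longleftrightarrow>
    g \<in> hom2 K (Cod K f) (Dom K f) \<and>
    g \<cdot> f = id2 K (Dom K f) \<and> f \<cdot> g = id2 K (Cod K f)"
  for K (structure)

definition iso2 :: "('o, 'm, 'c) bicat \<Rightarrow> 'm \<Rightarrow> 'm \<Rightarrow> 'c set"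
  where "iso2 K M N = {f \<in> hom2 K M N. \<exists>g. inverse2 K f g}"

definition inv2 :: "('o, 'm, 'c) bicat \<Rightarrow> 'c \<Rightarrow> 'c"
  where "inv2 K f = (THE g. inverse2 K f g)"

abbreviation asc_inv  ("\<a>\<^sup>-\<index>")
  where "\<a>\<^sup>-\<^bsub>K\<^esub> M N P \<equiv> inv2 K (asc K M N P)"

abbreviation lun_inv  ("\<l>\<^sup>-\<index>")
  where "\<l>\<^sup>-\<^bsub>K\<^esub> M \<equiv> inv2 K (lun K M)"

abbreviation run_inv  ("\<r>\<^sup>-\<index>")
  where "\<r>\<^sup>-\<^bsub>K\<^esub> M \<equiv> inv2 K (run K M)"

locale bicategory =
  fixes K :: "('o, 'm, 'c) bicat"  (structure)
  assumes Src_Ob: "M \<in> Mor K \<Longrightarrow> Src K M \<in> Ob K"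
    and Trg_Ob: "M \<in> Mor K \<Longrightarrow> Trg K M \<in> Ob K"
    and Dom_Mor: "f \<in> Cell K \<Longrightarrow> Dom K f \<in> Mor K"
    and Cod_Mor: "f \<in> Cell K \<Longrightarrow> Cod K f \<in> Mor K"
    and Src_Dom_Cod: "f \<in> Cell K \<Longrightarrow> Src K (Dom K f) = Src K (Cod K f)"
    and Trg_Dom_Cod: "f \<in> Cell K \<Longrightarrow> Trg K (Dom K f) = Trg K (Cod K f)"
    and id1_hom: "a \<in> Ob K \<Longrightarrow> id1 K a \<in> hom1 K a a"
    and comp1_hom: "\<lbrakk>M \<in> hom1 K b c; N \<in> hom1 K a b\<rbrakk> \<Longrightarrow> M \<otimes> N \<in> hom1 K a c"
    and id2_hom: "M \<in> Mor K \<Longrightarrow> id2 K M \<in> hom2 K M M"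
    and vcomp_hom: "\<lbrakk>g \<in> hom2 K N P; f \<in> hom2 K M N\<rbrakk> \<Longrightarrow> g \<cdot> f \<in> hom2 K M P"
    and vcomp_assoc: "\<lbrakk>h \<in> hom2 K P Q; g \<in> hom2 K N P; f \<in> hom2 K M N\<rbrakk>
      \<Longrightarrow> (h \<cdot> g) \<cdot> f = h \<cdot> (g \<cdot> f)"
    and vcomp_id_left: "f \<in> hom2 K M N \<Longrightarrow> id2 K N \<cdot> f = f"
    and vcomp_id_right: "f \<in> hom2 K M N \<Longrightarrow> f \<cdot> id2 K M = f"
    and hcomp_hom: "\<lbrakk>f \<in> hom2 K M M'; g \<in> hom2 K N N'; Src K M = Trg K N\<rbrakk>
      \<Longrightarrow> f \<star> g \<in> hom2 K (M \<otimes> N) (M' \<otimes> N')"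
    and hcomp_id: "\<lbrakk>M \<in> Mor K; N \<in> Mor K; Src K M = Trg K N\<rbrakk>
      \<Longrightarrow> id2 K M \<star> id2 K N = id2 K (M \<otimes> N)"
    and interchange: "\<lbrakk>f \<in> hom2 K M M'; f' \<in> hom2 K M' M'';
        g \<in> hom2 K N N'; g' \<in> hom2 K N' N''; Src K M = Trg K N\<rbrakk>
      \<Longrightarrow> (f' \<cdot> f) \<star> (g' \<cdot> g) = (f' \<star> g') \<cdot> (f \<star> g)"
    and asc_iso: "\<lbrakk>M \<in> Mor K; N \<in> Mor K; P \<in> Mor K; Src K M = Trg K N; Src K N = Trg K P\<rbrakk>
      \<Longrightarrow> \<a> M N P \<in> iso2 K ((M \<otimes> N) \<otimes> P) (M \<otimes> (N \<otimes> P))"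
    and asc_natural: "\<lbrakk>f \<in> hom2 K M M'; g \<in> hom2 K N N'; h \<in> hom2 K P P';
        Src K M = Trg K N; Src K N = Trg K P\<rbrakk>
      \<Longrightarrow> \<a> M' N' P' \<cdot> ((f \<star> g) \<star> h) = (f \<star> (g \<star> h)) \<cdot> \<a> M N P"
    and lun_iso: "M \<in> Mor K \<Longrightarrow> \<l> M \<in> iso2 K (id1 K (Trg K M) \<otimes> M) M"
    and lun_natural: "f \<in> hom2 K M N
      \<Longrightarrow> \<l> N \<cdot> (id1 K (Trg K M) \<lhd> f) = f \<cdot> \<l> M"
    and run_iso: "M \<in> Mor K \<Longrightarrow> \<r> M \<in> iso2 K (M \<otimes> id1 K (Src K M)) M"
    and run_natural: "f \<in> hom2 K M N
      \<Longrightarrow> \<r> N \<cdot> (f \<rhd> id1 K (Src K M)) = f \<cdot> \<r> M"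
    and pentagon: "\<lbrakk>M \<in> Mor K; N \<in> Mor K; P \<in> Mor K; Q \<in> Mor K;
        Src K M = Trg K N; Src K N = Trg K P; Src K P = Trg K Q\<rbrakk>
      \<Longrightarrow> \<a> M N (P \<otimes> Q) \<cdot> \<a> (M \<otimes> N) P Q
        = (M \<lhd> \<a> N P Q) \<cdot> \<a> M (N \<otimes> P) Q \<cdot> (\<a> M N P \<rhd> Q)"
    and triangle: "\<lbrakk>M \<in> Mor K; N \<in> Mor K; Src K M = Trg K N\<rbrakk>
      \<Longrightarrow> (M \<lhd> \<l> N) \<cdot> \<a> M (id1 K (Src K M)) N = \<r> M \<rhd> N"

definition idempotents_split :: "('o, 'm, 'c) bicat \<Rightarrow> bool"
  where "idempotents_split K \<longleftrightarrow>
    (\<forall>M\<in>Mor K. \<forall>e\<in>hom2 K M M. e \<cdot> e = e \<longrightarrow>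
      (\<exists>N\<in>Mor K. \<exists>p\<in>hom2 K M N. \<exists>i\<in>hom2 K N M. e = i \<cdot> p \<and> p \<cdot> i = id2 K N))"
  for K (structure)


section \<open>Pseudofunctors and biequivalences\<close>

record ('o, 'm, 'c, 'p, 'n, 'd) pseudofun =
  P0 :: "'o \<Rightarrow> 'p"
  P1 :: "'m \<Rightarrow> 'n"
  P2 :: "'c \<Rightarrow> 'd"
  Pcomp :: "'m \<Rightarrow> 'm \<Rightarrow> 'd"
  Punit :: "'o \<Rightarrow> 'd"

locale pseudofunctor = C: bicategory C + D: bicategory D
  for C :: "('o, 'm, 'c) bicat" and D :: "('p, 'n, 'd) bicat" +
  fixes F :: "('o, 'm, 'c, 'p, 'n, 'd) pseudofun"
  assumes P0_Ob: "a \<in> Ob C \<Longrightarrow> P0 F a \<in> Ob D"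
    and P1_hom: "M \<in> hom1 C a b \<Longrightarrow> P1 F M \<in> hom1 D (P0 F a) (P0 F b)"
    and P2_hom: "f \<in> hom2 C M N \<Longrightarrow> P2 F f \<in> hom2 D (P1 F M) (P1 F N)"
    and P2_id: "M \<in> Mor C \<Longrightarrow> P2 F (id2 C M) = id2 D (P1 F M)"
    and P2_vcomp: "\<lbrakk>g \<in> hom2 C N P; f \<in> hom2 C M N\<rbrakk>
      \<Longrightarrow> P2 F (g \<cdot>\<^bsub>C\<^esub> f) = P2 F g \<cdot>\<^bsub>D\<^esub> P2 F f"
    and Pcomp_iso: "\<lbrakk>M \<in> Mor C; N \<in> Mor C; Src C M = Trg C N\<rbrakk>
      \<Longrightarrow> Pcomp F M N \<in> iso2 D (P1 F M \<otimes>\<^bsub>D\<^esub> P1 F N) (P1 F (M \<otimes>\<^bsub>C\<^esub> N))"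
    and Pcomp_natural: "\<lbrakk>f \<in> hom2 C M M'; g \<in> hom2 C N N'; Src C M = Trg C N\<rbrakk>
      \<Longrightarrow> Pcomp F M' N' \<cdot>\<^bsub>D\<^esub> (P2 F f \<star>\<^bsub>D\<^esub> P2 F g) = P2 F (f \<star>\<^bsub>C\<^esub> g) \<cdot>\<^bsub>D\<^esub> Pcomp F M N"
    and Punit_iso: "a \<in> Ob C \<Longrightarrow> Punit F a \<in> iso2 D (id1 D (P0 F a)) (P1 F (id1 C a))"
    and Pcomp_assoc: "\<lbrakk>M \<in> Mor C; N \<in> Mor C; P \<in> Mor C; Src C M = Trg C N; Src C N = Trg C P\<rbrakk>
      \<Longrightarrow> P2 F (\<a>\<^bsub>C\<^esub> M N P) \<cdot>\<^bsub>D\<^esub> Pcomp F (M \<otimes>\<^bsub>C\<^esub> N) P \<cdot>\<^bsub>D\<^esub> (Pcomp F M N \<rhd>\<^bsub>D\<^esub> P1 F P)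
        = Pcomp F M (N \<otimes>\<^bsub>C\<^esub> P) \<cdot>\<^bsub>D\<^esub> (P1 F M \<lhd>\<^bsub>D\<^esub> Pcomp F N P)
          \<cdot>\<^bsub>D\<^esub> \<a>\<^bsub>D\<^esub> (P1 F M) (P1 F N) (P1 F P)"
    and Punit_left: "M \<in> Mor C
      \<Longrightarrow> P2 F (\<l>\<^bsub>C\<^esub> M) \<cdot>\<^bsub>D\<^esub> Pcomp F (id1 C (Trg C M)) M
          \<cdot>\<^bsub>D\<^esub> (Punit F (Trg C M) \<rhd>\<^bsub>D\<^esub> P1 F M) = \<l>\<^bsub>D\<^esub> (P1 F M)"
    and Punit_right: "M \<in> Mor C
      \<Longrightarrow> P2 F (\<r>\<^bsub>C\<^esub> M) \<cdot>\<^bsub>D\<^esub> Pcomp F M (id1 C (Src C M))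
          \<cdot>\<^bsub>D\<^esub> (P1 F M \<lhd>\<^bsub>D\<^esub> Punit F (Src C M)) = \<r>\<^bsub>D\<^esub> (P1 F M)"

definition equivalent_objects :: "('o, 'm, 'c) bicat \<Rightarrow> 'o \<Rightarrow> 'o \<Rightarrow> bool"
  where "equivalent_objects K a b \<longleftrightarrow>
    (\<exists>M\<in>hom1 K a b. \<exists>N\<in>hom1 K b a.
      iso2 K (id1 K a) (N \<otimes> M) \<noteq> {} \<and> iso2 K (M \<otimes> N) (id1 K b) \<noteq> {})"
  for K (structure)

text \<open>\<open>(G1, G2)\<close> is a functor from the hom-category \<open>C(a, b)\<close> to the hom-category \<open>D(c, d)\<close>.\<close>

definition hom_functor ::
  "('o, 'm, 'c) bicat \<Rightarrow> 'o \<Rightarrow> 'o \<Rightarrow> ('p, 'n, 'd) bicat \<Rightarrow> 'p \<Rightarrow> 'p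
    \<Rightarrow> ('m \<Rightarrow> 'n) \<Rightarrow> ('c \<Rightarrow> 'd) \<Rightarrow> bool"
  where "hom_functor C a b D c d G1 G2 \<longleftrightarrow>
    (\<forall>M\<in>hom1 C a b. G1 M \<in> hom1 D c d \<and> G2 (id2 C M) = id2 D (G1 M)) \<and>
    (\<forall>M\<in>hom1 C a b. \<forall>N\<in>hom1 C a b. \<forall>f\<in>hom2 C M N. G2 f \<in> hom2 D (G1 M) (G1 N)) \<and>
    (\<forall>M\<in>hom1 C a b. \<forall>N\<in>hom1 C a b. \<forall>P\<in>hom1 C a b. \<forall>f\<in>hom2 C M N. \<forall>g\<in>hom2 C N P.
      G2 (g \<cdot>\<^bsub>C\<^esub> f) = G2 g \<cdot>\<^bsub>D\<^esub> G2 f)"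

definition hom_equivalence ::
  "('o, 'm, 'c) bicat \<Rightarrow> 'o \<Rightarrow> 'o \<Rightarrow> ('p, 'n, 'd) bicat \<Rightarrow> 'p \<Rightarrow> 'p
    \<Rightarrow> ('m \<Rightarrow> 'n) \<Rightarrow> ('c \<Rightarrow> 'd) \<Rightarrow> bool"
  where "hom_equivalence C a b D c d F1 F2 \<longleftrightarrow>
    hom_functor C a b D c d F1 F2 \<and>
    (\<exists>G1 G2 u e. hom_functor D c d C a b G1 G2 \<and>
      (\<forall>M\<in>hom1 C a b. u M \<in> iso2 C M (G1 (F1 M))) \<and>
      (\<forall>M\<in>hom1 C a b. \<forall>N\<in>hom1 C a b. \<forall>f\<in>hom2 C M N.
        u N \<cdot>\<^bsub>C\<^esub> f = G2 (F2 f) \<cdot>\<^bsub>C\<^esub> u M) \<and>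
      (\<forall>M\<in>hom1 D c d. e M \<in> iso2 D (F1 (G1 M)) M) \<and>
      (\<forall>M\<in>hom1 D c d. \<forall>N\<in>hom1 D c d. \<forall>f\<in>hom2 D M N.
        e N \<cdot>\<^bsub>D\<^esub> F2 (G2 f) = f \<cdot>\<^bsub>D\<^esub> e M))"

text \<open>A biequivalence is a pseudofunctor that is biessentially surjective on 0-cells and an
  equivalence of categories on every hom-category (Street, Fibrations in bicategories, 1980;
  Lack, A Quillen model structure for bicategories, 2004).\<close>

definition biequivalence ::
  "('o, 'm, 'c) bicat \<Rightarrow> ('p, 'n, 'd) bicat \<Rightarrow> ('o, 'm, 'c, 'p, 'n, 'd) pseudofun \<Rightarrow> bool"
  where "biequivalence C D F \<longleftrightarrow>
    pseudofunctor C D F \<and>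
    (\<forall>b\<in>Ob D. \<exists>a\<in>Ob C. equivalent_objects D (P0 F a) b) \<and>
    (\<forall>a\<in>Ob C. \<forall>b\<in>Ob C. hom_equivalence C a b D (P0 F a) (P0 F b) (P1 F) (P2 F))"


section \<open>Monads\<close>

text \<open>The object on which a monad lives is recovered as the source of its underlying 1-cell.\<close>

datatype ('m, 'c) monad = Monad (mnd: 'm) (\<mu>: 'c) (\<eta>: 'c)

definition mobj :: "('o, 'm, 'c) bicat \<Rightarrow> ('m, 'c) monad \<Rightarrow> 'o"
  where "mobj K A = Src K (mnd A)"

definition is_monad :: "('o, 'm, 'c) bicat \<Rightarrow> ('m, 'c) monad \<Rightarrow> bool"
  where "is_monad K A \<longleftrightarrow> (let a = mnd A; k = mobj K A in
    a \<in> hom1 K k k \<and>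
    \<mu> A \<in> hom2 K (a \<otimes> a) a \<and>
    \<eta> A \<in> hom2 K (id1 K k) a \<and>
    \<mu> A \<cdot> (\<mu> A \<rhd> a) = \<mu> A \<cdot> (a \<lhd> \<mu> A) \<cdot> \<a> a a a \<and>
    \<mu> A \<cdot> (\<eta> A \<rhd> a) = \<l> a \<and>
    \<mu> A \<cdot> (a \<lhd> \<eta> A) = \<r> a)"
  for K (structure)

text \<open>Street's monad morphisms \<open>(V, \<xi>)\<close> from \<open>A\<close> to \<open>A'\<close>; note the direction \<open>A' \<otimes> V \<Rightarrow> V \<otimes> A\<close>.\<close>

definition monad_morphism ::
  "('o, 'm, 'c) bicat \<Rightarrow> ('m, 'c) monad \<Rightarrow> ('m, 'c) monad \<Rightarrow> 'm \<Rightarrow> 'c \<Rightarrow> bool"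
  where "monad_morphism K A A' V \<xi> \<longleftrightarrow> (let a = mnd A; a' = mnd A' in
    is_monad K A \<and> is_monad K A' \<and>
    V \<in> hom1 K (mobj K A) (mobj K A') \<and>
    \<xi> \<in> hom2 K (a' \<otimes> V) (V \<otimes> a) \<and>
    \<xi> \<cdot> (\<mu> A' \<rhd> V)
      = (V \<lhd> \<mu> A) \<cdot> \<a> V a a \<cdot> (\<xi> \<rhd> a) \<cdot> \<a>\<^sup>- a' V a \<cdot> (a' \<lhd> \<xi>) \<cdot> \<a> a' a' V \<and>
    \<xi> \<cdot> (\<eta> A' \<rhd> V) = (V \<lhd> \<eta> A) \<cdot> \<r>\<^sup>- V \<cdot> \<l> V)"
  for K (structure)

definition monad_transformation ::
  "('o, 'm, 'c) bicat \<Rightarrow> ('m, 'c) monad \<Rightarrow> ('m, 'c) monad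
    \<Rightarrow> 'm \<Rightarrow> 'c \<Rightarrow> 'm \<Rightarrow> 'c \<Rightarrow> 'c \<Rightarrow> bool"
  where "monad_transformation K A A' V \<xi> W \<xi>' \<omega> \<longleftrightarrow>
    \<omega> \<in> hom2 K V W \<and> \<xi>' \<cdot> (mnd A' \<lhd> \<omega>) = (\<omega> \<rhd> mnd A) \<cdot> \<xi>"
  for K (structure)

text \<open>The 2-cells of the identity monad morphism on \<open>A\<close>, and of the composite of
  \<open>(V, \<xi>)\<close> from \<open>A\<close> to \<open>A'\<close> with \<open>(V', \<xi>')\<close> from \<open>A'\<close> to \<open>A''\<close>.\<close>

definition mm_id :: "('o, 'm, 'c) bicat \<Rightarrow> ('m, 'c) monad \<Rightarrow> 'c"
  where "mm_id K A = \<l>\<^sup>- (mnd A) \<cdot> \<r> (mnd A)"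
  for K (structure)

definition mm_comp ::
  "('o, 'm, 'c) bicat \<Rightarrow> ('m, 'c) monad \<Rightarrow> ('m, 'c) monad \<Rightarrow> ('m, 'c) monad
    \<Rightarrow> 'm \<Rightarrow> 'c \<Rightarrow> 'm \<Rightarrow> 'c \<Rightarrow> 'c"
  where "mm_comp K A A' A'' V' \<xi>' V \<xi> =
    \<a>\<^sup>- V' V (mnd A) \<cdot> (V' \<lhd> \<xi>) \<cdot> \<a> V' (mnd A') V \<cdot> (\<xi>' \<rhd> V) \<cdot> \<a>\<^sup>- (mnd A'') V' V"
  for K (structure)

text \<open>2-cells of the bicategories built over \<open>K\<close> below: a 2-cell of \<open>K\<close> together with its
  source and target 1-cells.\<close>

datatype ('x, 'c) over2 = Over2 (dom2: 'x) (cod2: 'x) (cell2: 'c)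


section \<open>The bicategory of weak distributive laws\<close>

definition weak_distributive_law ::
  "('o, 'm, 'c) bicat \<Rightarrow> ('m, 'c) monad \<Rightarrow> ('m, 'c) monad \<Rightarrow> 'c \<Rightarrow> bool"
  where "weak_distributive_law K A B \<Psi> \<longleftrightarrow> (let a = mnd A; b = mnd B in
    is_monad K A \<and> is_monad K B \<and> mobj K A = mobj K B \<and>
    \<Psi> \<in> hom2 K (a \<otimes> b) (b \<otimes> a) \<and>
    \<Psi> \<cdot> (\<mu> A \<rhd> b)
      = (b \<lhd> \<mu> A) \<cdot> \<a> b a a \<cdot> (\<Psi> \<rhd> a) \<cdot> \<a>\<^sup>- a b a \<cdot> (a \<lhd> \<Psi>) \<cdot> \<a> a a b \<and>
    \<Psi> \<cdot> (a \<lhd> \<mu> B)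
      = (\<mu> B \<rhd> a) \<cdot> \<a>\<^sup>- b b a \<cdot> (b \<lhd> \<Psi>) \<cdot> \<a> b a b \<cdot> (\<Psi> \<rhd> b) \<cdot> \<a>\<^sup>- a b b \<and>
    (\<mu> B \<rhd> a) \<cdot> \<a>\<^sup>- b b a \<cdot> (b \<lhd> \<Psi>) \<cdot> (b \<lhd> (a \<lhd> \<eta> B)) \<cdot> (b \<lhd> \<r>\<^sup>- a)
      = (b \<lhd> \<mu> A) \<cdot> \<a> b a a \<cdot> (\<Psi> \<rhd> a) \<cdot> ((\<eta> A \<rhd> b) \<rhd> a) \<cdot> (\<l>\<^sup>- b \<rhd> a))"
  for K (structure)

definition Psi_bar ::
  "('o, 'm, 'c) bicat \<Rightarrow> ('m, 'c) monad \<Rightarrow> ('m, 'c) monad \<Rightarrow> 'c \<Rightarrow> 'c"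
  where "Psi_bar K A B \<Psi> = (let a = mnd A; b = mnd B in
    (\<mu> B \<star> \<mu> A) \<cdot> \<a> (b \<otimes> b) a a \<cdot> (\<a>\<^sup>- b b a \<rhd> a)
      \<cdot> ((b \<lhd> \<Psi>) \<rhd> a)
      \<cdot> (\<a> b a b \<rhd> a) \<cdot> \<a>\<^sup>- (b \<otimes> a) b a
      \<cdot> ((b \<lhd> \<eta> A) \<star> (\<eta> B \<rhd> a)) \<cdot> (\<r>\<^sup>- b \<star> \<l>\<^sup>- a))"
  for K (structure)

datatype ('m, 'c) wdl = WDL (wA: "('m, 'c) monad") (wB: "('m, 'c) monad") (w\<Psi>: 'c)

datatype ('m, 'c) wdl1 =
  WDL1 (w_src: "('m, 'c) wdl") (w_trg: "('m, 'c) wdl") (w_V: 'm) (w_\<xi>: 'c) (w_\<zeta>: 'c)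

definition is_wdl1 :: "('o, 'm, 'c) bicat \<Rightarrow> ('m, 'c) wdl1 \<Rightarrow> bool"
  where "is_wdl1 K f \<longleftrightarrow>
    (case (w_src f, w_trg f) of (WDL A B \<Psi>, WDL A' B' \<Psi>') \<Rightarrow>
      let a = mnd A; b = mnd B; a' = mnd A'; b' = mnd B'; V = w_V f; \<xi> = w_\<xi> f; \<zeta> = w_\<zeta> f in
      weak_distributive_law K A B \<Psi> \<and> weak_distributive_law K A' B' \<Psi>' \<and>
      monad_morphism K A A' V \<xi> \<and> monad_morphism K B B' V \<zeta> \<and>
      (V \<lhd> Psi_bar K A B \<Psi>) \<cdot> \<a> V b a \<cdot> (\<zeta> \<rhd> a) \<cdot> \<a>\<^sup>- b' V a
          \<cdot> (b' \<lhd> \<xi>) \<cdot> \<a> b' a' V \<cdot> (\<Psi>' \<rhd> V)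
        = (V \<lhd> \<Psi>) \<cdot> \<a> V a b \<cdot> (\<xi> \<rhd> b) \<cdot> \<a>\<^sup>- a' V b \<cdot> (a' \<lhd> \<zeta>) \<cdot> \<a> a' b' V)"
  for K (structure)

definition is_wdl2 :: "('o, 'm, 'c) bicat \<Rightarrow> (('m, 'c) wdl1, 'c) over2 \<Rightarrow> bool"
  where "is_wdl2 K t \<longleftrightarrow>
    (let f = dom2 t; g = cod2 t; X = w_src f; X' = w_trg f in
      is_wdl1 K f \<and> is_wdl1 K g \<and> w_src g = X \<and> w_trg g = X' \<and>
      monad_transformation K (wA X) (wA X') (w_V f) (w_\<xi> f) (w_V g) (w_\<xi> g) (cell2 t) \<and>
      monad_transformation K (wB X) (wB X') (w_V f) (w_\<zeta> f) (w_V g) (w_\<zeta> g) (cell2 t))"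

definition wdl_id1 :: "('o, 'm, 'c) bicat \<Rightarrow> ('m, 'c) wdl \<Rightarrow> ('m, 'c) wdl1"
  where "wdl_id1 K X =
    WDL1 X X (id1 K (mobj K (wA X))) (mm_id K (wA X)) (mm_id K (wB X))"

definition wdl_comp1 ::
  "('o, 'm, 'c) bicat \<Rightarrow> ('m, 'c) wdl1 \<Rightarrow> ('m, 'c) wdl1 \<Rightarrow> ('m, 'c) wdl1"
  where "wdl_comp1 K g f = (let X = w_src f; X' = w_trg f; X'' = w_trg g in
    WDL1 X X'' (w_V g \<otimes> w_V f)
      (mm_comp K (wA X) (wA X') (wA X'') (w_V g) (w_\<xi> g) (w_V f) (w_\<xi> f))
      (mm_comp K (wB X) (wB X') (wB X'') (w_V g) (w_\<zeta> g) (w_V f) (w_\<zeta> f)))"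
  for K (structure)

definition Wdl ::
  "('o, 'm, 'c) bicat \<Rightarrow> (('m, 'c) wdl, ('m, 'c) wdl1, (('m, 'c) wdl1, 'c) over2) bicat"
  where "Wdl K = \<lparr>
    Ob = {X. weak_distributive_law K (wA X) (wB X) (w\<Psi> X)},
    Mor = {f. is_wdl1 K f},
    Src = w_src,
    Trg = w_trg,
    Cell = {t. is_wdl2 K t},
    Dom = dom2,
    Cod = cod2,
    id1 = wdl_id1 K,
    id2 = (\<lambda>f. Over2 f f (id2 K (w_V f))),
    comp1 = wdl_comp1 K,
    hcomp = (\<lambda>s t. Over2 (wdl_comp1 K (dom2 s) (dom2 t)) (wdl_comp1 K (cod2 s) (cod2 t))
                     (cell2 s \<star> cell2 t)),
    vcomp = (\<lambda>s t. Over2 (dom2 t) (cod2 s) (cell2 s \<cdot> cell2 t)),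
    asc = (\<lambda>h g f. Over2 (wdl_comp1 K (wdl_comp1 K h g) f) (wdl_comp1 K h (wdl_comp1 K g f))
                     (\<a> (w_V h) (w_V g) (w_V f))),
    lun = (\<lambda>f. Over2 (wdl_comp1 K (wdl_id1 K (w_trg f)) f) f (\<l> (w_V f))),
    run = (\<lambda>f. Over2 (wdl_comp1 K f (wdl_id1 K (w_src f))) f (\<r> (w_V f)))\<rparr>"
  for K (structure)


section \<open>The bicategory of bilinear factorization structures\<close>

text \<open>Morphisms of unital monads on a fixed object.\<close>

definition monad_map :: "('o, 'm, 'c) bicat \<Rightarrow> ('m, 'c) monad \<Rightarrow> ('m, 'c) monad \<Rightarrow> 'c \<Rightarrow> bool"
  where "monad_map K A R \<alpha> \<longleftrightarrow>
    \<alpha> \<in> hom2 K (mnd A) (mnd R) \<and>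
    \<alpha> \<cdot> \<mu> A = \<mu> R \<cdot> (\<alpha> \<star> \<alpha>) \<and>
    \<alpha> \<cdot> \<eta> A = \<eta> R"
  for K (structure)

text \<open>\<open>f\<close> is a morphism of \<open>B\<close>-\<open>A\<close> bimodules from \<open>M\<close>, with left action \<open>lm\<close> and right action \<open>rm\<close>,
  to \<open>N\<close>, with left action \<open>ln\<close> and right action \<open>rn\<close>.\<close>

definition bimodule_morphism ::
  "('o, 'm, 'c) bicat \<Rightarrow> ('m, 'c) monad \<Rightarrow> ('m, 'c) monad
    \<Rightarrow> 'm \<Rightarrow> 'c \<Rightarrow> 'c \<Rightarrow> 'm \<Rightarrow> 'c \<Rightarrow> 'c \<Rightarrow> 'c \<Rightarrow> bool"
  where "bimodule_morphism K B A M lm rm N ln rn f \<longleftrightarrow>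
    f \<in> hom2 K M N \<and>
    f \<cdot> lm = ln \<cdot> (mnd B \<lhd> f) \<and>
    f \<cdot> rm = rn \<cdot> (f \<rhd> mnd A)"
  for K (structure)

datatype ('m, 'c) bfs =
  BFS (bA: "('m, 'c) monad") (bB: "('m, 'c) monad") (bR: "('m, 'c) monad")
    (b\<alpha>: 'c) (b\<beta>: 'c) (b\<iota>: 'c)

definition is_bfs :: "('o, 'm, 'c) bicat \<Rightarrow> ('m, 'c) bfs \<Rightarrow> bool"
  where "is_bfs K X \<longleftrightarrow> (case X of BFS A B R \<alpha> \<beta> \<iota> \<Rightarrow>
    let a = mnd A; b = mnd B; r = mnd R in
    is_monad K A \<and> is_monad K B \<and> is_monad K R \<and>
    mobj K A = mobj K R \<and> mobj K B = mobj K R \<and>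
    monad_map K A R \<alpha> \<and> monad_map K B R \<beta> \<and>
    bimodule_morphism K B A
      r (\<mu> R \<cdot> (\<beta> \<rhd> r)) (\<mu> R \<cdot> (r \<lhd> \<alpha>))
      (b \<otimes> a) ((\<mu> B \<rhd> a) \<cdot> \<a>\<^sup>- b b a) ((b \<lhd> \<mu> A) \<cdot> \<a> b a a)
      \<iota> \<and>
    (\<mu> R \<cdot> (\<beta> \<star> \<alpha>)) \<cdot> \<iota> = id2 K r)"
  for K (structure)

datatype ('m, 'c) bfs1 =
  BFS1 (b_src: "('m, 'c) bfs") (b_trg: "('m, 'c) bfs") (b_V: 'm) (b_\<xi>: 'c) (b_\<zeta>: 'c) (b_\<rho>: 'c)

definition is_bfs1 :: "('o, 'm, 'c) bicat \<Rightarrow> ('m, 'c) bfs1 \<Rightarrow> bool"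
  where "is_bfs1 K f \<longleftrightarrow> (let X = b_src f; X' = b_trg f; V = b_V f in
    is_bfs K X \<and> is_bfs K X' \<and>
    monad_morphism K (bA X) (bA X') V (b_\<xi> f) \<and>
    monad_morphism K (bB X) (bB X') V (b_\<zeta> f) \<and>
    monad_morphism K (bR X) (bR X') V (b_\<rho> f) \<and>
    b_\<rho> f \<cdot> (b\<alpha> X' \<rhd> V) = (V \<lhd> b\<alpha> X) \<cdot> b_\<xi> f \<and>
    b_\<rho> f \<cdot> (b\<beta> X' \<rhd> V) = (V \<lhd> b\<beta> X) \<cdot> b_\<zeta> f)"
  for K (structure)

definition is_bfs2 :: "('o, 'm, 'c) bicat \<Rightarrow> (('m, 'c) bfs1, 'c) over2 \<Rightarrow> bool"
  where "is_bfs2 K t \<longleftrightarrow>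
    (let f = dom2 t; g = cod2 t; X = b_src f; X' = b_trg f in
      is_bfs1 K f \<and> is_bfs1 K g \<and> b_src g = X \<and> b_trg g = X' \<and>
      monad_transformation K (bA X) (bA X') (b_V f) (b_\<xi> f) (b_V g) (b_\<xi> g) (cell2 t) \<and>
      monad_transformation K (bB X) (bB X') (b_V f) (b_\<zeta> f) (b_V g) (b_\<zeta> g) (cell2 t) \<and>
      monad_transformation K (bR X) (bR X') (b_V f) (b_\<rho> f) (b_V g) (b_\<rho> g) (cell2 t))"

definition bfs_id1 :: "('o, 'm, 'c) bicat \<Rightarrow> ('m, 'c) bfs \<Rightarrow> ('m, 'c) bfs1"
  where "bfs_id1 K X =
    BFS1 X X (id1 K (mobj K (bR X))) (mm_id K (bA X)) (mm_id K (bB X)) (mm_id K (bR X))"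

definition bfs_comp1 ::
  "('o, 'm, 'c) bicat \<Rightarrow> ('m, 'c) bfs1 \<Rightarrow> ('m, 'c) bfs1 \<Rightarrow> ('m, 'c) bfs1"
  where "bfs_comp1 K g f = (let X = b_src f; X' = b_trg f; X'' = b_trg g in
    BFS1 X X'' (b_V g \<otimes> b_V f)
      (mm_comp K (bA X) (bA X') (bA X'') (b_V g) (b_\<xi> g) (b_V f) (b_\<xi> f))
      (mm_comp K (bB X) (bB X') (bB X'') (b_V g) (b_\<zeta> g) (b_V f) (b_\<zeta> f))
      (mm_comp K (bR X) (bR X') (bR X'') (b_V g) (b_\<rho> g) (b_V f) (b_\<rho> f)))"
  for K (structure)

definition Bf ::
  "('o, 'm, 'c) bicat \<Rightarrow> (('m, 'c) bfs, ('m, 'c) bfs1, (('m, 'c) bfs1, 'c) over2) bicat"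
  where "Bf K = \<lparr>
    Ob = {X. is_bfs K X},
    Mor = {f. is_bfs1 K f},
    Src = b_src,
    Trg = b_trg,
    Cell = {t. is_bfs2 K t},
    Dom = dom2,
    Cod = cod2,
    id1 = bfs_id1 K,
    id2 = (\<lambda>f. Over2 f f (id2 K (b_V f))),
    comp1 = bfs_comp1 K,
    hcomp = (\<lambda>s t. Over2 (bfs_comp1 K (dom2 s) (dom2 t)) (bfs_comp1 K (cod2 s) (cod2 t))
                     (cell2 s \<star> cell2 t)),
    vcomp = (\<lambda>s t. Over2 (dom2 t) (cod2 s) (cell2 s \<cdot> cell2 t)),
    asc = (\<lambda>h g f. Over2 (bfs_comp1 K (bfs_comp1 K h g) f) (bfs_comp1 K h (bfs_comp1 K g f))
                     (\<a> (b_V h) (b_V g) (b_V f))),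
    lun = (\<lambda>f. Over2 (bfs_comp1 K (bfs_id1 K (b_trg f)) f) f (\<l> (b_V f))),
    run = (\<lambda>f. Over2 (bfs_comp1 K f (bfs_id1 K (b_src f))) f (\<r> (b_V f)))\<rparr>"
  for K (structure)


section \<open>The comparison pseudofunctor\<close>

definition F0 :: "('o, 'm, 'c) bicat \<Rightarrow> ('m, 'c) bfs \<Rightarrow> ('m, 'c) wdl"
  where "F0 K X = WDL (bA X) (bB X) (b\<iota> X \<cdot> \<mu> (bR X) \<cdot> (b\<alpha> X \<star> b\<beta> X))"
  for K (structure)

definition F1 :: "('o, 'm, 'c) bicat \<Rightarrow> ('m, 'c) bfs1 \<Rightarrow> ('m, 'c) wdl1"
  where "F1 K f = WDL1 (F0 K (b_src f)) (F0 K (b_trg f)) (b_V f) (b_\<xi> f) (b_\<zeta> f)"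

definition F2 :: "('o, 'm, 'c) bicat \<Rightarrow> (('m, 'c) bfs1, 'c) over2 \<Rightarrow> (('m, 'c) wdl1, 'c) over2"
  where "F2 K t = Over2 (F1 K (dom2 t)) (F1 K (cod2 t)) (cell2 t)"

text \<open>Since \<open>F\<close> strictly preserves composites and identities of 1-cells, its comparison 2-cells are
  identities.\<close>

definition Bf_to_Wdl ::
  "('o, 'm, 'c) bicat \<Rightarrow>
    (('m, 'c) bfs, ('m, 'c) bfs1, (('m, 'c) bfs1, 'c) over2,
     ('m, 'c) wdl, ('m, 'c) wdl1, (('m, 'c) wdl1, 'c) over2) pseudofun"
  where "Bf_to_Wdl K = \<lparr>
    P0 = F0 K,
    P1 = F1 K,
    P2 = F2 K,
    Pcomp = (\<lambda>g f. id2 (Wdl K) (F1 K (comp1 (Bf K) g f))),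
    Punit = (\<lambda>X. id2 (Wdl K) (F1 K (id1 (Bf K) X)))\<rparr>"

end

theory Submission
  imports Defs
begin

text \<open>
  In a bilinear factorization structure, \<open>\<pi> = \<mu>\<^sub>R (\<beta> \<otimes> \<alpha>) : B \<otimes> A \<rightarrow> R\<close> and \<open>\<iota>\<close> exhibit \<open>R\<close> as a retract of \<open>B \<otimes> A\<close>,
  and \<open>\<iota> \<pi>\<close> is the idempotent \<open>\<Psi>bar\<close> attached to the weak distributive law \<open>\<Psi> = \<iota> \<mu>\<^sub>R (\<alpha> \<otimes> \<beta>)\<close>
  (\<open>pb_pi\<close>). So \<open>\<Psi>\<close> remembers \<open>R\<close> up to the choice of a splitting of \<open>\<Psi>bar\<close>.

  On 0-cells the comparison is surjective. Given \<open>\<Psi>\<close>, split \<open>\<Psi>bar = \<iota> p\<close> through some \<open>R\<close> and transport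
  the multiplication \<open>m = (\<mu>\<^sub>B \<otimes> \<mu>\<^sub>A)(B \<otimes> \<Psi> \<otimes> A)\<close> along the retraction. The multiplication \<open>m\<close> is associative
  but need not have a unit; it absorbs \<open>\<Psi>bar\<close> in its output and in both arguments
  (\<open>bar_m\<close>, \<open>m_bar_left\<close>, \<open>m_bar_right\<close>), hence it descends to \<open>R\<close>, where \<open>p (\<eta>\<^sub>B \<otimes> \<eta>\<^sub>A)\<close> is a unit because
  \<open>m (\<eta>\<^sub>B \<otimes> \<eta>\<^sub>A \<otimes> B \<otimes> A) = \<Psi>bar\<close>. The law \<open>\<iota> \<mu>\<^sub>R (\<alpha> \<otimes> \<beta>)\<close> of this structure is \<open>\<Psi>\<close> on the nose
  (\<open>splitting_factorization\<close>), so identity 1-cells witness biessential surjectivity.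

  On hom-categories the comparison is an isomorphism. If \<open>(\<xi>, \<zeta>, \<rho>)\<close> is a 1-cell, then \<open>\<rho>\<close> is multiplicative and
  compatible with \<open>\<alpha>\<close> and \<open>\<beta>\<close>, so \<open>\<rho> (\<pi>' \<otimes> V) = (V \<otimes> \<pi>) \<theta>\<close> with \<open>\<theta> = (\<zeta> \<otimes> A)(B' \<otimes> \<xi>)\<close>, and precomposition with
  \<open>\<iota>'\<close> gives \<open>\<rho> = (V \<otimes> \<pi>) \<theta> (\<iota>' \<otimes> V)\<close>; thus \<open>\<rho>\<close> is determined by \<open>\<xi>\<close> and \<open>\<zeta>\<close> (\<open>F1_lift_unique\<close>). Conversely
  this formula defines a suitable \<open>\<rho>\<close> for every 1-cell \<open>(\<xi>, \<zeta>)\<close> of weak distributive laws (\<open>F1_lift\<close>). The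
  identity that makes this work is \<open>(V \<otimes> \<Psi>bar) \<theta> (\<Psi>'bar \<otimes> V) = (V \<otimes> \<Psi>bar) \<theta>\<close> (\<open>absorb\<close>), which also shows
  that 1-cells of weak distributive laws compose. On 2-cells the formula for \<open>\<rho>\<close> makes compatibility with \<open>\<rho>\<close> a
  consequence of compatibility with \<open>\<xi>\<close> and \<open>\<zeta>\<close> (\<open>F2_lift\<close>).

  All these equations live in a bicategory, where the coherence cells have to be written out. They are removed
  once and for all as follows. A 1-cell \<open>M\<close> acts by \<open>X \<mapsto> M \<otimes> X\<close> on the 1-cells with a suitable target, and a
  2-cell \<open>f\<close> becomes the natural family \<open>f \<otimes> X\<close>. A bracketed composite of 1-cells, applied to \<open>X\<close>,
  is isomorphic to the iterated application \<open>M\<^sub>1 \<otimes> (\<dots> \<otimes> (M\<^sub>n \<otimes> X))\<close>, in which brackets and units have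
  disappeared, and coherence says that associators and unitors become identities under these isomorphisms. So a
  2-cell is represented by a diagram, a list of boxes each placed between two lists of 1-cells. Taking
  for \<open>X\<close> an identity 1-cell shows that 2-cells with equal diagrams are equal (\<open>rep_eq_iff\<close>). Every
  calculation is then a chain of diagrams, each obtained from the previous one by the interchange law and
  one rewriting rule.
\<close>

section \<open>Calculus of 2-cells\<close>

context bicategory
begin

text \<open>The axioms are restated in terms of \<open>Dom\<close> and \<open>Cod\<close>, so that the simplifier decides composability by computing
  boundaries instead of guessing intermediate 1-cells.\<close>

lemma comp1_simps [simp]:
  assumes "M \<in> Mor K" "N \<in> Mor K" "Src K M = Trg K N"
  shows "M \<otimes> N \<in> Mor K" "Src K (M \<otimes> N) = Src K N" "Trg K (M \<otimes> N) = Trg K M"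
  using comp1_hom[of M "Src K M" "Trg K M" N "Src K N"] assms by (auto simp: hom1_def)

lemma id1_simps [simp]:
  assumes "k \<in> Ob K"
  shows "id1 K k \<in> Mor K" "Src K (id1 K k) = k" "Trg K (id1 K k) = k"
  using id1_hom[OF assms] by (auto simp: hom1_def)

lemma in_hom2: "f \<in> hom2 K M N \<longleftrightarrow> f \<in> Cell K \<and> Dom K f = M \<and> Cod K f = N"
  by (auto simp: hom2_def)

lemma cell_simps [simp]:
  assumes "f \<in> Cell K"
  shows "Dom K f \<in> Mor K" "Cod K f \<in> Mor K"
    "Src K (Cod K f) = Src K (Dom K f)" "Trg K (Cod K f) = Trg K (Dom K f)"
  using assms Dom_Mor Cod_Mor Src_Dom_Cod Trg_Dom_Cod by auto

declare Src_Ob [simp] Trg_Ob [simp]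

lemma id2_simps [simp]:
  assumes "M \<in> Mor K"
  shows "id2 K M \<in> Cell K" "Dom K (id2 K M) = M" "Cod K (id2 K M) = M"
  using id2_hom[OF assms] by (auto simp: hom2_def)

lemma vcomp_simps [simp]:
  assumes "f \<in> Cell K" "g \<in> Cell K" "Dom K g = Cod K f"
  shows "g \<cdot> f \<in> Cell K" "Dom K (g \<cdot> f) = Dom K f" "Cod K (g \<cdot> f) = Cod K g"
  using vcomp_hom[of g "Cod K f" "Cod K g" f "Dom K f"] assms by (auto simp: hom2_def)

lemma hcomp_simps [simp]:
  assumes "f \<in> Cell K" "g \<in> Cell K" "Src K (Dom K f) = Trg K (Dom K g)"
  shows "f \<star> g \<in> Cell K" "Dom K (f \<star> g) = Dom K f \<otimes> Dom K g" "Cod K (f \<star> g) = Cod K f \<otimes> Cod K g"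
  using hcomp_hom[of f "Dom K f" "Cod K f" g "Dom K g" "Cod K g"] assms by (auto simp: hom2_def)

lemma vassoc [simp]:
  assumes "f \<in> Cell K" "g \<in> Cell K" "h \<in> Cell K" "Dom K g = Cod K f" "Dom K h = Cod K g"
  shows "(h \<cdot> g) \<cdot> f = h \<cdot> (g \<cdot> f)"
  using vcomp_assoc[of h "Cod K g" "Cod K h" g "Cod K f" f "Dom K f"] assms by (auto simp: hom2_def)

lemma vid_left [simp]: "f \<in> Cell K \<Longrightarrow> Cod K f = N \<Longrightarrow> id2 K N \<cdot> f = f"
  using vcomp_id_left[of f "Dom K f" "Cod K f"] by (auto simp: hom2_def)

lemma vid_right [simp]: "f \<in> Cell K \<Longrightarrow> Dom K f = M \<Longrightarrow> f \<cdot> id2 K M = f"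
  using vcomp_id_right[of f "Dom K f" "Cod K f"] by (auto simp: hom2_def)

lemma hid [simp]: "\<lbrakk>M \<in> Mor K; N \<in> Mor K; Src K M = Trg K N\<rbrakk> \<Longrightarrow> id2 K M \<star> id2 K N = id2 K (M \<otimes> N)"
  by (rule hcomp_id)

lemma exchange:
  assumes "f \<in> Cell K" "f' \<in> Cell K" "g \<in> Cell K" "g' \<in> Cell K"
    "Dom K f' = Cod K f" "Dom K g' = Cod K g" "Src K (Dom K f) = Trg K (Dom K g)"
  shows "(f' \<star> g') \<cdot> (f \<star> g) = (f' \<cdot> f) \<star> (g' \<cdot> g)"
  using interchange[of f "Dom K f" "Cod K f" f' "Cod K f'" g "Dom K g" "Cod K g" g' "Cod K g'"] assms
  by (auto simp: hom2_def)

lemma lwhisk_vcomp: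
  assumes "M \<in> Mor K" "f \<in> Cell K" "g \<in> Cell K" "Dom K g = Cod K f" "Src K M = Trg K (Dom K f)"
  shows "M \<lhd> (g \<cdot> f) = (M \<lhd> g) \<cdot> (M \<lhd> f)"
  using exchange[of "id2 K M" "id2 K M" f g] assms by simp

lemma rwhisk_vcomp:
  assumes "M \<in> Mor K" "f \<in> Cell K" "g \<in> Cell K" "Dom K g = Cod K f" "Src K (Dom K f) = Trg K M"
  shows "(g \<cdot> f) \<rhd> M = (g \<rhd> M) \<cdot> (f \<rhd> M)"
  using exchange[of f g "id2 K M" "id2 K M"] assms by simp

lemma hcomp_split:
  assumes "f \<in> Cell K" "g \<in> Cell K" "Src K (Dom K f) = Trg K (Dom K g)"
  shows "(f \<rhd> Cod K g) \<cdot> (Dom K f \<lhd> g) = f \<star> g"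
  using exchange[of "id2 K (Dom K f)" f g "id2 K (Cod K g)"] assms by simp

lemma hcomp_split':
  assumes "f \<in> Cell K" "g \<in> Cell K" "Src K (Dom K f) = Trg K (Dom K g)"
  shows "(Cod K f \<lhd> g) \<cdot> (f \<rhd> Dom K g) = f \<star> g"
  using exchange[of f "id2 K (Cod K f)" "id2 K (Dom K g)" g] assms by simp

definition iso :: "'c \<Rightarrow> bool"
  where "iso f \<longleftrightarrow> f \<in> Cell K \<and> (\<exists>g. inverse2 K f g)"

lemma inverse2_unique:
  assumes "f \<in> Cell K" "inverse2 K f g" "inverse2 K f h"
  shows "g = h"
proof -
  have g: "g \<in> Cell K" "Dom K g = Cod K f" "Cod K g = Dom K f" "g \<cdot> f = id2 K (Dom K f)"
    and h: "h \<in> Cell K" "Dom K h = Cod K f" "Cod K h = Dom K f" "f \<cdot> h = id2 K (Cod K f)"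
    using assms by (auto simp: inverse2_def hom2_def)
  have "g = g \<cdot> (f \<cdot> h)" using g h assms(1) by simp
  also have "\<dots> = (g \<cdot> f) \<cdot> h" using g(1-3) h(1-3) assms(1) by simp
  also have "\<dots> = h" using g h by simp
  finally show ?thesis .
qed

lemma inverse2_inv2: "iso f \<Longrightarrow> inverse2 K f (inv2 K f)"
  unfolding iso_def inv2_def by (rule theI') (auto intro: inverse2_unique)

lemma inv2_eq: "f \<in> Cell K \<Longrightarrow> inverse2 K f g \<Longrightarrow> inv2 K f = g"
  using inverse2_inv2[of f] inverse2_unique[of f] by (auto simp: iso_def)

lemma iso_simps [simp]:
  assumes "iso f"
  shows "f \<in> Cell K" "inv2 K f \<in> Cell K" "Dom K (inv2 K f) = Cod K f" "Cod K (inv2 K f) = Dom K f"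
    "inv2 K f \<cdot> f = id2 K (Dom K f)" "f \<cdot> inv2 K f = id2 K (Cod K f)"
  using inverse2_inv2[OF assms] assms by (auto simp: inverse2_def hom2_def iso_def)

lemma iso_cancel [simp]:
  assumes "iso f" "x \<in> Cell K"
  shows "Cod K x = Dom K f \<Longrightarrow> inv2 K f \<cdot> f \<cdot> x = x" "Cod K x = Cod K f \<Longrightarrow> f \<cdot> inv2 K f \<cdot> x = x"
  using assms by (simp_all del: vassoc flip: vassoc)

lemma iso2_iff: "f \<in> iso2 K M N \<longleftrightarrow> iso f \<and> Dom K f = M \<and> Cod K f = N"
  by (auto simp: iso2_def iso_def hom2_def)

lemma isoI:
  assumes "f \<in> Cell K" "g \<in> Cell K" "Dom K g = Cod K f" "Cod K g = Dom K f"
    "g \<cdot> f = id2 K (Dom K f)" "f \<cdot> g = id2 K (Cod K f)"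
  shows "iso f" and "inv2 K f = g"
proof -
  have "inverse2 K f g" using assms by (auto simp: inverse2_def hom2_def)
  thus "iso f" "inv2 K f = g" using assms inv2_eq by (auto simp: iso_def)
qed

lemma iso_inv [simp]: "iso f \<Longrightarrow> iso (inv2 K f)"
  by (rule isoI[of _ f]) auto

lemma iso_id [simp]: "M \<in> Mor K \<Longrightarrow> iso (id2 K M)"
  by (rule isoI[of _ "id2 K M"]) auto

lemma iso_vcomp [simp]:
  assumes "iso f" "iso g" "Dom K g = Cod K f"
  shows "iso (g \<cdot> f)"
  by (rule isoI[of _ "inv2 K f \<cdot> inv2 K g"]) (use assms in auto)

lemma iso_hcomp [simp]:
  assumes "iso f" "iso g" "Src K (Dom K f) = Trg K (Dom K g)"
  shows "iso (f \<star> g)"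
  by (rule isoI[of _ "inv2 K f \<star> inv2 K g"]) (use assms in \<open>auto simp: exchange\<close>)

lemma iso_epi:
  assumes "iso h" "f \<in> Cell K" "g \<in> Cell K" "Dom K f = Cod K h" "Dom K g = Cod K h" "f \<cdot> h = g \<cdot> h"
  shows "f = g"
proof -
  have "(f \<cdot> h) \<cdot> inv2 K h = (g \<cdot> h) \<cdot> inv2 K h" using assms by simp
  thus ?thesis using assms(1-5) by simp
qed

lemma iso_mono:
  assumes "iso h" "f \<in> Cell K" "g \<in> Cell K" "Cod K f = Dom K h" "Cod K g = Dom K h" "h \<cdot> f = h \<cdot> g"
  shows "f = g"
proof -
  have "inv2 K h \<cdot> h \<cdot> f = inv2 K h \<cdot> h \<cdot> g" using assms by simp
  thus ?thesis using assms(1-5) by simp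
qed

lemma asc_simps [simp]:
  assumes "M \<in> Mor K" "N \<in> Mor K" "P \<in> Mor K" "Src K M = Trg K N" "Src K N = Trg K P"
  shows "iso (\<a> M N P)" "Dom K (\<a> M N P) = (M \<otimes> N) \<otimes> P" "Cod K (\<a> M N P) = M \<otimes> (N \<otimes> P)"
  using asc_iso[OF assms] by (auto simp: iso2_iff)

lemma lun_simps [simp]:
  assumes "M \<in> Mor K"
  shows "iso (\<l> M)" "Dom K (\<l> M) = id1 K (Trg K M) \<otimes> M" "Cod K (\<l> M) = M"
  using lun_iso[OF assms] by (auto simp: iso2_iff)

lemma run_simps [simp]:
  assumes "M \<in> Mor K"
  shows "iso (\<r> M)" "Dom K (\<r> M) = M \<otimes> id1 K (Src K M)" "Cod K (\<r> M) = M"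
  using run_iso[OF assms] by (auto simp: iso2_iff)

lemma lun_nat: "f \<in> Cell K \<Longrightarrow> \<l> (Cod K f) \<cdot> (id1 K (Trg K (Dom K f)) \<lhd> f) = f \<cdot> \<l> (Dom K f)"
  using lun_natural[of f "Dom K f" "Cod K f"] by (auto simp: hom2_def)

lemma run_nat: "f \<in> Cell K \<Longrightarrow> \<r> (Cod K f) \<cdot> (f \<rhd> id1 K (Src K (Dom K f))) = f \<cdot> \<r> (Dom K f)"
  using run_natural[of f "Dom K f" "Cod K f"] by (auto simp: hom2_def)

lemma asc_nat:
  assumes "f \<in> Cell K" "g \<in> Cell K" "h \<in> Cell K"
    "Src K (Dom K f) = Trg K (Dom K g)" "Src K (Dom K g) = Trg K (Dom K h)"
  shows "\<a> (Cod K f) (Cod K g) (Cod K h) \<cdot> ((f \<star> g) \<star> h) = (f \<star> (g \<star> h)) \<cdot> \<a> (Dom K f) (Dom K g) (Dom K h)"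
  using asc_natural[of f "Dom K f" "Cod K f" g "Dom K g" "Cod K g" h "Dom K h" "Cod K h"] assms
  by (auto simp: hom2_def)

text \<open>Whiskering with an identity 1-cell is conjugation with the unitor.\<close>

lemma lwhisk_id_faithful:
  assumes "f \<in> Cell K" "g \<in> Cell K" "Dom K f = Dom K g" "Cod K f = Cod K g"
    "id1 K (Trg K (Dom K f)) \<lhd> f = id1 K (Trg K (Dom K f)) \<lhd> g"
  shows "f = g"
  by (rule iso_epi[of "\<l> (Dom K f)"]) (use assms lun_nat[of f] lun_nat[of g] in auto)

lemma rwhisk_id_faithful:
  assumes "f \<in> Cell K" "g \<in> Cell K" "Dom K f = Dom K g" "Cod K f = Cod K g"
    "f \<rhd> id1 K (Src K (Dom K f)) = g \<rhd> id1 K (Src K (Dom K f))"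
  shows "f = g"
  by (rule iso_epi[of "\<r> (Dom K f)"]) (use assms run_nat[of f] run_nat[of g] in auto)

text \<open>Kelly's coherence law: the triangle axiom with the unit in the leftmost position. Whiskered
  with a further unit, it follows from the pentagon and the given triangle.\<close>

text \<open>Kelly's coherence law. Since whiskering with a unit is faithful, it is enough to compare both sides after one
  more whiskering with the unit, where the pentagon and two instances of the triangle axiom apply.\<close>

lemma lun_comp1:
  assumes M: "M \<in> Mor K" and N: "N \<in> Mor K" and MN: "Src K M = Trg K N"
  shows "\<l> (M \<otimes> N) \<cdot> \<a> (id1 K (Trg K M)) M N = \<l> M \<rhd> N"
proof -
  define I where "I = id1 K (Trg K M)"
  have I [simp]: "I \<in> Mor K" "Src K I = Trg K M" "Trg K I = Trg K M"
    using M by (auto simp: I_def)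
  note [simp] = M N MN
  have dl: "Dom K (\<l> M) = I \<otimes> M" "Dom K (\<l> (M \<otimes> N)) = I \<otimes> (M \<otimes> N)" "Dom K (\<l> I) = I \<otimes> I" "Dom K (\<r> I) = I \<otimes> I"
    by (auto simp: I_def)
  note [simp] = dl
  define Y where "Y = \<a> I (I \<otimes> M) N \<cdot> (\<a> I I M \<rhd> N)"
  have Y: "iso Y" "Cod K Y = I \<otimes> ((I \<otimes> M) \<otimes> N)" by (auto simp: Y_def)
  have "(I \<lhd> (\<l> (M \<otimes> N) \<cdot> \<a> I M N)) \<cdot> Y
      = (I \<lhd> \<l> (M \<otimes> N)) \<cdot> (I \<lhd> \<a> I M N) \<cdot> Y"
    using Y by (simp add: lwhisk_vcomp)
  also have "(I \<lhd> \<a> I M N) \<cdot> Y = \<a> I I (M \<otimes> N) \<cdot> \<a> (I \<otimes> I) M N"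
    unfolding Y_def using pentagon[of I I M N] by simp
  also have "(I \<lhd> \<l> (M \<otimes> N)) \<cdot> \<a> I I (M \<otimes> N) \<cdot> \<a> (I \<otimes> I) M N
      = ((I \<lhd> \<l> (M \<otimes> N)) \<cdot> \<a> I I (M \<otimes> N)) \<cdot> \<a> (I \<otimes> I) M N"
    by simp
  also have "\<dots> = (\<r> I \<rhd> (M \<otimes> N)) \<cdot> \<a> (I \<otimes> I) M N"
    using triangle[of I "M \<otimes> N"] by (simp flip: I_def)
  also have "\<dots> = \<a> I M N \<cdot> ((\<r> I \<rhd> M) \<rhd> N)"
    using asc_nat[of "\<r> I" "id2 K M" "id2 K N"] by simp
  also have "\<r> I \<rhd> M = (I \<lhd> \<l> M) \<cdot> \<a> I I M"
    using triangle[of I M] by (simp flip: I_def)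
  also have "\<a> I M N \<cdot> (((I \<lhd> \<l> M) \<cdot> \<a> I I M) \<rhd> N)
      = (\<a> I M N \<cdot> ((I \<lhd> \<l> M) \<rhd> N)) \<cdot> (\<a> I I M \<rhd> N)"
    by (simp add: rwhisk_vcomp)
  also have "\<dots> = (I \<lhd> (\<l> M \<rhd> N)) \<cdot> Y"
    using asc_nat[of "id2 K I" "\<l> M" "id2 K N"] by (simp add: Y_def)
  finally have "I \<lhd> (\<l> (M \<otimes> N) \<cdot> \<a> I M N) = I \<lhd> (\<l> M \<rhd> N)"
    by (rule iso_epi[OF Y(1), rotated -1]) (use Y in auto)
  thus ?thesis
    using lwhisk_id_faithful[of "\<l> (M \<otimes> N) \<cdot> \<a> I M N" "\<l> M \<rhd> N"] by (simp flip: I_def)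
qed

end

section \<open>String diagrams over a bicategory\<close>

text \<open>A box has a list of input and a list of output 1-cells. A list \<open>[M\<^sub>1, \<dots>, M\<^sub>n]\<close> stands for the functor
  \<open>X \<mapsto> M\<^sub>1 \<otimes> (\<dots> \<otimes> (M\<^sub>n \<otimes> X))\<close>, and the box carries the components at \<open>X\<close> of a transformation between two such
  functors, for all \<open>X\<close> with target \<open>gsrc\<close>. The object is recorded because the lists may be empty.\<close>

datatype ('o, 'm, 'c) gen =
  Gen (gdom: "'m list") (gcod: "'m list") (gsrc: 'o) (gfam: "'m \<Rightarrow> 'c")

text \<open>A layer \<open>(L, g, R)\<close> is the box \<open>g\<close> with \<open>L\<close> to its left and \<open>R\<close> to its right. As in a written composite, the head
  of the list is applied last.\<close>

type_synonym ('o, 'm, 'c) diagram = "('m list \<times> ('o, 'm, 'c) gen \<times> 'm list) list"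

fun tgt :: "'m list \<Rightarrow> ('o, 'm, 'c) diagram \<Rightarrow> 'm list"
  where "tgt P [] = P"
  | "tgt P ((L, g, R) # w) = L @ gcod g @ R"

definition whisk :: "'m list \<Rightarrow> ('o, 'm, 'c) diagram \<Rightarrow> 'm list \<Rightarrow> ('o, 'm, 'c) diagram"
  where "whisk L w R = map (\<lambda>(L', g, R'). (L @ L', g, R' @ R)) w"

lemma whisk_simps [simp]:
  "whisk L [] R = []"
  "whisk L ((L', g, R') # w) R = (L @ L', g, R' @ R) # whisk L w R"
  "whisk L (w @ w') R = whisk L w R @ whisk L w' R"
  by (auto simp: whisk_def)

lemma whisk_whisk [simp]: "whisk L (whisk L' w R') R = whisk (L @ L') w (R' @ R)"
  by (induction w) auto

lemma whisk_Nil [simp]: "whisk [] w [] = w"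
  by (induction w) auto

lemma tgt_append [simp]: "tgt P (w @ w') = tgt (tgt P w') w"
  by (cases w) auto

lemma tgt_whisk [simp]: "tgt (L @ P @ R) (whisk L w R) = L @ tgt P w @ R"
  by (cases w) auto

text \<open>The interchange law applied to the layers \<open>i\<close> and \<open>i + 1\<close>. In a well-typed diagram the lengths of the lists
  tell whether one box lies beside the other; a box without inputs at the common boundary counts as lying to
  the left.\<close>

fun slide :: "nat \<Rightarrow> ('o, 'm, 'c) diagram \<Rightarrow> ('o, 'm, 'c) diagram"
  where "slide (Suc i) (l # w) = l # slide i w"
  | "slide 0 ((L1, g1, R1) # (L2, g2, R2) # w) =
      (if length L1 + length (gdom g1) \<le> length L2
       then (L1 @ gcod g1 @ drop (length L1 + length (gdom g1)) L2, g2, R2)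
         # (L1, g1, drop (length L1 + length (gdom g1)) L2 @ gdom g2 @ R2) # w
       else if length L2 + length (gcod g2) \<le> length L1
       then (L2, g2, drop (length L2 + length (gcod g2)) L1 @ gcod g1 @ R1)
         # (L2 @ gdom g2 @ drop (length L2 + length (gcod g2)) L1, g1, R1) # w
       else (L1, g1, R1) # (L2, g2, R2) # w)"
  | "slide i w = w"

fun slides :: "nat list \<Rightarrow> ('o, 'm, 'c) diagram \<Rightarrow> ('o, 'm, 'c) diagram"
  where "slides [] w = w"
  | "slides (i # js) w = slides js (slide i w)"

context bicategory
begin

primrec ev :: "'m list \<Rightarrow> 'm \<Rightarrow> 'm"
  where "ev [] X = X"
  | "ev (M # P) X = M \<otimes> ev P X"

primrec lw :: "'m list \<Rightarrow> 'c \<Rightarrow> 'c"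
  where "lw [] f = f"
  | "lw (M # P) f = M \<lhd> lw P f"

text \<open>A path of 1-cells is read from right to left; the empty path at \<open>k\<close> also ends at \<open>k\<close>.\<close>

primrec ptrg :: "'o \<Rightarrow> 'm list \<Rightarrow> 'o"
  where "ptrg k [] = k"
  | "ptrg k (M # P) = Trg K M"

primrec okp :: "'o \<Rightarrow> 'm list \<Rightarrow> bool"
  where "okp k [] \<longleftrightarrow> k \<in> Ob K"
  | "okp k (M # P) \<longleftrightarrow> M \<in> Mor K \<and> Src K M = ptrg k P \<and> okp k P"

lemma ptrg_append [simp]: "ptrg k (P @ Q) = ptrg (ptrg k Q) P"
  by (cases P) auto

lemma ptrg_Ob [simp]: "okp k P \<Longrightarrow> ptrg k P \<in> Ob K"
  by (cases P) auto

lemma okp_append [simp]: "okp k (P @ Q) \<longleftrightarrow> okp k Q \<and> okp (ptrg k Q) P"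
  by (induction P) auto

lemma ev_append [simp]: "ev (P @ Q) X = ev P (ev Q X)"
  by (induction P) auto

lemma lw_append [simp]: "lw (P @ Q) f = lw P (lw Q f)"
  by (induction P) auto

lemma ev_simps [simp]:
  assumes "X \<in> Mor K" "okp (Trg K X) P"
  shows "ev P X \<in> Mor K" "Src K (ev P X) = Src K X" "Trg K (ev P X) = ptrg (Trg K X) P"
  using assms by (induction P) auto

lemma lw_simps [simp]:
  assumes "f \<in> Cell K" "okp (Trg K (Dom K f)) P"
  shows "lw P f \<in> Cell K" "Dom K (lw P f) = ev P (Dom K f)" "Cod K (lw P f) = ev P (Cod K f)"
  using assms by (induction P) auto

lemma lw_id [simp]: "X \<in> Mor K \<Longrightarrow> okp (Trg K X) P \<Longrightarrow> lw P (id2 K X) = id2 K (ev P X)"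
  by (induction P) auto

lemma lw_vcomp:
  assumes "f \<in> Cell K" "g \<in> Cell K" "Dom K g = Cod K f" "okp (Trg K (Dom K f)) P"
  shows "lw P (g \<cdot> f) = lw P g \<cdot> lw P f"
  using assms by (induction P) (auto simp: lwhisk_vcomp)

definition okg :: "('o, 'm, 'c) gen \<Rightarrow> bool"
  where "okg g \<longleftrightarrow> okp (gsrc g) (gdom g) \<and> okp (gsrc g) (gcod g) \<and>
    ptrg (gsrc g) (gdom g) = ptrg (gsrc g) (gcod g) \<and>
    (\<forall>X\<in>Mor K. Trg K X = gsrc g \<longrightarrow> gfam g X \<in> hom2 K (ev (gdom g) X) (ev (gcod g) X)) \<and>
    (\<forall>f\<in>Cell K. Trg K (Dom K f) = gsrc g \<longrightarrow>
      gfam g (Cod K f) \<cdot> lw (gdom g) f = lw (gcod g) f \<cdot> gfam g (Dom K f))"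

lemma okg_simps [simp]:
  assumes "okg g"
  shows "okp (gsrc g) (gdom g)" "okp (gsrc g) (gcod g)" "ptrg (gsrc g) (gdom g) = ptrg (gsrc g) (gcod g)"
    "X \<in> Mor K \<Longrightarrow> Trg K X = gsrc g \<Longrightarrow> gfam g X \<in> Cell K"
    "X \<in> Mor K \<Longrightarrow> Trg K X = gsrc g \<Longrightarrow> Dom K (gfam g X) = ev (gdom g) X"
    "X \<in> Mor K \<Longrightarrow> Trg K X = gsrc g \<Longrightarrow> Cod K (gfam g X) = ev (gcod g) X"
  using assms by (auto simp: okg_def hom2_def)

lemma okg_natural:
  assumes "okg g" "f \<in> Cell K" "Trg K (Dom K f) = gsrc g"
  shows "gfam g (Cod K f) \<cdot> lw (gdom g) f = lw (gcod g) f \<cdot> gfam g (Dom K f)"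
  using assms unfolding okg_def by blast

fun wt :: "'o \<Rightarrow> 'm list \<Rightarrow> ('o, 'm, 'c) diagram \<Rightarrow> bool"
  where "wt k P [] \<longleftrightarrow> okp k P"
  | "wt k P ((L, g, R) # w) \<longleftrightarrow> wt k P w \<and> okg g \<and> tgt P w = L @ gdom g @ R \<and> ptrg k R = gsrc g"

text \<open>Placing 1-cells to the right of a box is a mere change of the argument \<open>X\<close>, and placing 1-cells to its left is
  the functorial action \<open>lw\<close>. Both are strict, so diagrams need no coherence cells.\<close>

fun sem :: "'m list \<Rightarrow> ('o, 'm, 'c) diagram \<Rightarrow> 'm \<Rightarrow> 'c"
  where "sem P [] X = id2 K (ev P X)"
  | "sem P ((L, g, R) # w) X = lw L (gfam g (ev R X)) \<cdot> sem P w X"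

lemma wt_path: "wt k P w \<Longrightarrow> okp k P \<and> okp k (tgt P w) \<and> ptrg k (tgt P w) = ptrg k P"
  by (induction k P w rule: wt.induct) auto

lemma wt_tgt [simp]: "wt k P w \<Longrightarrow> okp k (tgt P w)" "wt k P w \<Longrightarrow> ptrg k (tgt P w) = ptrg k P"
  and wt_dom: "wt k P w \<Longrightarrow> okp k P"
  by (simp_all add: wt_path)

lemma wt_layer:
  assumes "wt k P ((L, g, R) # w)"
  shows "okg g" "okp k R" "ptrg k R = gsrc g" "okp (ptrg (gsrc g) (gcod g)) L" "tgt P w = L @ gdom g @ R"
    "wt k P w"
  using assms wt_tgt(1)[of k P w] by auto

lemma wt_append [simp]: "wt k P (w @ w') \<longleftrightarrow> wt k P w' \<and> wt k (tgt P w') w"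
proof (induction w)
  case Nil
  thus ?case by (auto simp: wt_tgt)
next
  case (Cons l w)
  thus ?case by (cases l) auto
qed

lemma wt_whisk:
  assumes "wt (ptrg k R) P w" "okp k (L @ P @ R)"
  shows "wt k (L @ P @ R) (whisk L w R)"
  using assms
proof (induction w)
  case (Cons l w)
  thus ?case by (cases l) auto
qed auto

lemma sem_typed:
  assumes "wt (Trg K X) P w" "X \<in> Mor K"
  shows "sem P w X \<in> Cell K \<and> Dom K (sem P w X) = ev P X \<and> Cod K (sem P w X) = ev (tgt P w) X"
  using assms
proof (induction w)
  case Nil
  thus ?case by simp
next
  case (Cons l w)
  obtain L g R where l: "l = (L, g, R)" by (cases l)
  note t = wt_layer[OF Cons.prems(1)[unfolded l]]
  have w: "sem P w X \<in> Cell K" "Dom K (sem P w X) = ev P X" "Cod K (sem P w X) = ev L (ev (gdom g) (ev R X))"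
    using Cons.IH t(5,6) Cons.prems(2) by auto
  have "gfam g (ev R X) \<in> Cell K" "Dom K (gfam g (ev R X)) = ev (gdom g) (ev R X)"
     "Cod K (gfam g (ev R X)) = ev (gcod g) (ev R X)" "Trg K (Dom K (gfam g (ev R X))) = ptrg (gsrc g) (gcod g)"
    using t Cons.prems(2) by auto
  thus ?case using w t(4) Cons.prems(2) by (simp add: l)
qed

lemma sem_simps [simp]:
  assumes "wt (Trg K X) P w" "X \<in> Mor K"
  shows "sem P w X \<in> Cell K" "Dom K (sem P w X) = ev P X" "Cod K (sem P w X) = ev (tgt P w) X"
  using sem_typed[OF assms] by auto

lemma layer_typed:
  assumes "wt (Trg K X) P ((L, g, R) # w)" "X \<in> Mor K"
  shows "gfam g (ev R X) \<in> Cell K" "Dom K (gfam g (ev R X)) = ev (gdom g) (ev R X)"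
     "Cod K (gfam g (ev R X)) = ev (gcod g) (ev R X)"
     "Trg K (ev (gdom g) (ev R X)) = ptrg (gsrc g) (gcod g)"
  using wt_layer[OF assms(1)] assms(2) by auto

lemma sem_append:
  assumes "wt (Trg K X) P (w @ w')" "X \<in> Mor K"
  shows "sem P (w @ w') X = sem (tgt P w') w X \<cdot> sem P w' X"
  using assms
proof (induction w)
  case Nil
  thus ?case by simp
next
  case (Cons l w)
  obtain L g R where l: "l = (L, g, R)" by (cases l)
  have p: "wt (Trg K X) P ((L, g, R) # (w @ w'))" using Cons.prems(1) l by simp
  note t = wt_layer[OF p] layer_typed[OF p Cons.prems(2)]
  have "lw L (gfam g (ev R X)) \<in> Cell K" "Dom K (lw L (gfam g (ev R X))) = ev (L @ gdom g @ R) X"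
    using t by simp_all
  moreover have "sem (tgt P w') w X \<in> Cell K" "Dom K (sem (tgt P w') w X) = ev (tgt P w') X"
    "Cod K (sem (tgt P w') w X) = ev (L @ gdom g @ R) X"
    "sem P w' X \<in> Cell K" "Cod K (sem P w' X) = ev (tgt P w') X"
    using t(5,6) Cons.prems(2) by (simp_all del: ev_append)
  ultimately show ?case using Cons.IH t(6) Cons.prems(2) by (simp add: l del: ev_append)
qed

lemma sem_whisk:
  assumes "wt (ptrg (Trg K X) R) P w" "okp (Trg K X) (L @ P @ R)" "X \<in> Mor K"
  shows "sem (L @ P @ R) (whisk L w R) X = lw L (sem P w (ev R X))"
  using assms(1)
proof (induction w)
  case Nil
  thus ?case using assms(2,3) by simp
next
  case (Cons l w)
  obtain L' g R' where l: "l = (L', g, R')" by (cases l)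
  have X: "ev R X \<in> Mor K" "Trg K (ev R X) = ptrg (Trg K X) R" using assms by auto
  have p: "wt (Trg K (ev R X)) P ((L', g, R') # w)" using Cons.prems(1) X l by simp
  note t = wt_layer[OF p] layer_typed[OF p X(1)]
  have L: "okp (ptrg (ptrg (Trg K X) R) P) L" using assms by simp
  have P: "ptrg (ptrg (Trg K X) R) P = ptrg (gsrc g) (L' @ gcod g)"
    using wt_tgt(2)[OF t(6)] t(3) unfolding t(5) X(2) ptrg_append by (simp add: t(1))
  have "lw L (lw L' (gfam g (ev R' (ev R X))) \<cdot> sem P w (ev R X))
     = lw L (lw L' (gfam g (ev R' (ev R X)))) \<cdot> lw L (sem P w (ev R X))"
    by (rule lw_vcomp) (use t X L P wt_dom[OF t(6)] in simp_all)
  thus ?case using Cons.IH t(6) X by (simp add: l)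
qed

text \<open>The input list \<open>P\<close> and the object \<open>k\<close> at its right end are parameters, because the empty diagram does not
  determine them.\<close>

definition eqd :: "'o \<Rightarrow> 'm list \<Rightarrow> ('o, 'm, 'c) diagram \<Rightarrow> ('o, 'm, 'c) diagram \<Rightarrow> bool"
    ("(\<langle>_, _\<rangle>/ _ \<approx> _)" [0, 0, 50, 50] 50)
  where "\<langle>k, P\<rangle> w \<approx> w' \<longleftrightarrow> wt k P w \<and> wt k P w' \<and> tgt P w = tgt P w' \<and>
    (\<forall>X\<in>Mor K. Trg K X = k \<longrightarrow> sem P w X = sem P w' X)"

lemma eqd_refl: "wt k P w \<Longrightarrow> \<langle>k, P\<rangle> w \<approx> w"
  by (auto simp: eqd_def)

lemma eqd_sym [sym]: "\<langle>k, P\<rangle> w \<approx> w' \<Longrightarrow> \<langle>k, P\<rangle> w' \<approx> w"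
  by (auto simp: eqd_def)

lemma eqd_trans [trans]: "\<langle>k, P\<rangle> w \<approx> w' \<Longrightarrow> \<langle>k, P\<rangle> w' \<approx> w'' \<Longrightarrow> \<langle>k, P\<rangle> w \<approx> w''"
  by (auto simp: eqd_def)

lemma eqd_append:
  assumes "\<langle>k, P\<rangle> w \<approx> w'" "\<langle>k, tgt P w\<rangle> v \<approx> v'"
  shows "\<langle>k, P\<rangle> v @ w \<approx> v' @ w'"
proof -
  have "sem P (v @ w) X = sem P (v' @ w') X" if "X \<in> Mor K" "Trg K X = k" for X
    using assms that sem_append[of X P v w] sem_append[of X P v' w'] by (simp add: eqd_def)
  thus ?thesis using assms by (simp add: eqd_def)
qed

lemma eqd_whisk:
  assumes "\<langle>ptrg k R, P\<rangle> w \<approx> w'" "okp k (L @ P @ R)"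
  shows "\<langle>k, L @ P @ R\<rangle> whisk L w R \<approx> whisk L w' R"
proof -
  have "sem (L @ P @ R) (whisk L w R) X = sem (L @ P @ R) (whisk L w' R) X" if X: "X \<in> Mor K" "Trg K X = k" for X
  proof -
    have "ev R X \<in> Mor K" "Trg K (ev R X) = ptrg k R" using assms(2) X by auto
    hence "sem P w (ev R X) = sem P w' (ev R X)" using assms(1) by (simp add: eqd_def)
    thus ?thesis using sem_whisk[of X R P w L] sem_whisk[of X R P w' L] assms X by (simp add: eqd_def)
  qed
  thus ?thesis using assms by (simp add: eqd_def wt_whisk)
qed

text \<open>Two boxes beside each other commute because the left one is natural and the right one is a 2-cell.\<close>

lemma exchange_left:
  assumes "wt k P ((L, g, M @ gcod h @ R) # (L @ gdom g @ M, h, R) # w)"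
  shows "\<langle>k, P\<rangle> (L, g, M @ gcod h @ R) # (L @ gdom g @ M, h, R) # w
    \<approx> (L @ gcod g @ M, h, R) # (L, g, M @ gdom h @ R) # w"
proof -
  note l = wt_layer[OF assms]
  note l' = wt_layer[OF l(6)]
  have "lw L (gfam g (ev (M @ gcod h @ R) X)) \<cdot> lw (L @ gdom g @ M) (gfam h (ev R X)) \<cdot> sem P w X
    = lw (L @ gcod g @ M) (gfam h (ev R X)) \<cdot> lw L (gfam g (ev (M @ gdom h @ R) X)) \<cdot> sem P w X"
    if X: "X \<in> Mor K" "Trg K X = k" for X
  proof -
    define f where "f = lw M (gfam h (ev R X))"
    have eR: "ev R X \<in> Mor K" "Trg K (ev R X) = gsrc h" using X l' by auto
    have f: "f \<in> Cell K" "Dom K f = ev (M @ gdom h @ R) X" "Cod K f = ev (M @ gcod h @ R) X"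
      using eR l' l(2) by (auto simp: f_def)
    have tf: "Trg K (Dom K f) = gsrc g" using f(2) X l l' eR by simp
    have g: "gfam g (Dom K f) \<in> Cell K" "Dom K (gfam g (Dom K f)) = ev (gdom g) (Dom K f)"
      "Cod K (gfam g (Dom K f)) = ev (gcod g) (Dom K f)"
      "gfam g (Cod K f) \<in> Cell K" "Dom K (gfam g (Cod K f)) = ev (gdom g) (Cod K f)"
      "Cod K (gfam g (Cod K f)) = ev (gcod g) (Cod K f)"
      using f(1) tf l(1) by simp_all
    have w: "sem P w X \<in> Cell K" "Cod K (sem P w X) = ev L (ev (gdom g) (Dom K f))"
      using l'(5,6) X f(2) by auto
    have "lw L (gfam g (Cod K f)) \<cdot> lw L (lw (gdom g) f) = lw L (gfam g (Cod K f) \<cdot> lw (gdom g) f)"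
      by (rule lw_vcomp[symmetric]) (use f(1) tf g l in simp_all)
    also have "\<dots> = lw L (lw (gcod g) f \<cdot> gfam g (Dom K f))"
      using okg_natural[OF l(1) f(1) tf] by simp
    also have "\<dots> = lw L (lw (gcod g) f) \<cdot> lw L (gfam g (Dom K f))"
      by (rule lw_vcomp) (use f(1) tf g l in simp_all)
    finally have "(lw L (gfam g (Cod K f)) \<cdot> lw L (lw (gdom g) f)) \<cdot> sem P w X
      = (lw L (lw (gcod g) f) \<cdot> lw L (gfam g (Dom K f))) \<cdot> sem P w X" by simp
    hence "lw L (gfam g (Cod K f)) \<cdot> lw L (lw (gdom g) f) \<cdot> sem P w X
      = lw L (lw (gcod g) f) \<cdot> lw L (gfam g (Dom K f)) \<cdot> sem P w X"
      using w f(1) tf g l by simp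
    thus ?thesis unfolding f(2,3) by (simp add: f_def)
  qed
  moreover have "wt k P ((L @ gcod g @ M, h, R) # (L, g, M @ gdom h @ R) # w)"
    using l l' by auto
  ultimately show ?thesis using assms by (auto simp: eqd_def)
qed

lemma eqd_Cons: "wt k P (l # w) \<Longrightarrow> \<langle>k, P\<rangle> w \<approx> w' \<Longrightarrow> \<langle>k, P\<rangle> l # w \<approx> l # w'"
  by (cases l) (auto simp: eqd_def)

lemma eqd_slide: "wt k P w \<Longrightarrow> \<langle>k, P\<rangle> w \<approx> slide i w"
proof (induction i w rule: slide.induct)
  case (1 i l w)
  thus ?case using eqd_Cons[of k P l w] by (cases l) auto
next
  case (2 L1 g1 R1 L2 g2 R2 w)
  have t: "L2 @ gcod g2 @ R2 = L1 @ gdom g1 @ R1" using 2 by simp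
  show ?case
  proof (cases "length L1 + length (gdom g1) \<le> length L2")
    case True
    define M where "M = drop (length L1 + length (gdom g1)) L2"
    have "take (length L1 + length (gdom g1)) (L2 @ gcod g2 @ R2) = L1 @ gdom g1"
      using t by simp
    hence "take (length L1 + length (gdom g1)) L2 = L1 @ gdom g1" using True by simp
    hence L: "L2 = L1 @ gdom g1 @ M"
      unfolding M_def by (metis append_assoc append_take_drop_id)
    hence R: "R1 = M @ gcod g2 @ R2" using t by simp
    show ?thesis using exchange_left[OF 2[unfolded L R]] True by (simp flip: M_def L R)
  next
    case F: False
    show ?thesis
    proof (cases "length L2 + length (gcod g2) \<le> length L1")
      case True
      define M where "M = drop (length L2 + length (gcod g2)) L1"
      have "take (length L2 + length (gcod g2)) (L1 @ gdom g1 @ R1) = L2 @ gcod g2"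
        using t[symmetric] by simp
      hence "take (length L2 + length (gcod g2)) L1 = L2 @ gcod g2" using True by simp
      hence L: "L1 = L2 @ gcod g2 @ M"
        unfolding M_def by (metis append_assoc append_take_drop_id)
      hence R: "R2 = M @ gdom g1 @ R1" using t by simp
      have w: "wt k P ((L2, g2, M @ gcod g1 @ R1) # (L2 @ gdom g2 @ M, g1, R1) # w)"
        using 2 L R by auto
      show ?thesis using 2 eqd_sym[OF exchange_left[OF w]] F L R by (auto simp flip: M_def)
    next
      case False
      show ?thesis using 2 F False by (simp add: eqd_refl)
    qed
  qed
qed (auto intro: eqd_refl)

lemma eqd_slides: "wt k P w \<Longrightarrow> \<langle>k, P\<rangle> w \<approx> slides js w"
proof (induction js arbitrary: w)
  case (Cons i js)
  have "\<langle>k, P\<rangle> w \<approx> slide i w" using Cons.prems by (rule eqd_slide)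
  moreover from this have "wt k P (slide i w)" by (simp add: eqd_def)
  ultimately show ?case using Cons.IH eqd_trans by auto
qed (simp add: eqd_refl)

text \<open>A rule may be applied to consecutive layers after some interchanges.\<close>

lemma rewrite:
  assumes "\<langle>k', P'\<rangle> u \<approx> v"
    and "wt k P w" "slides js w = x @ whisk L u R @ y" "w' = x @ whisk L v R @ y"
    and "ptrg k R = k'" "tgt P y = L @ P' @ R"
  shows "\<langle>k, P\<rangle> w \<approx> w'"
proof -
  have 1: "\<langle>k, P\<rangle> w \<approx> x @ whisk L u R @ y"
    using eqd_slides[OF assms(2), of js] assms(3) by simp
  hence t: "wt k P (x @ whisk L u R @ y)" by (simp add: eqd_def)
  hence y: "wt k P y" by simp
  have p: "okp k (L @ P' @ R)" using wt_tgt(1)[OF y] unfolding assms(6) .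
  have uv: "\<langle>k, L @ P' @ R\<rangle> whisk L u R \<approx> whisk L v R"
    by (rule eqd_whisk) (use assms(1,5) p in auto)
  have 2: "\<langle>k, P\<rangle> whisk L u R @ y \<approx> whisk L v R @ y"
    by (rule eqd_append) (use uv y assms(6) in \<open>simp_all add: eqd_refl\<close>)
  have "\<langle>k, P\<rangle> x @ whisk L u R @ y \<approx> x @ whisk L v R @ y"
    by (rule eqd_append) (use 2 t in \<open>simp_all add: eqd_refl\<close>)
  with 1 show ?thesis unfolding assms(4) by (rule eqd_trans)
qed

end

section \<open>Coherence: from 2-cells to diagrams\<close>

text \<open>A bracketed composite of 1-cells and units; \<open>lv\<close> forgets brackets and units.\<close>

datatype ('o, 'm) tree = Leaf 'm | Unit 'o | Node "('o, 'm) tree" "('o, 'm) tree"  (infixr "\<odot>" 75)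

primrec lv :: "('o, 'm) tree \<Rightarrow> 'm list"
  where "lv (Leaf M) = [M]"
  | "lv (Unit k) = []"
  | "lv (s \<odot> t) = lv s @ lv t"

context bicategory
begin

primrec tm :: "('o, 'm) tree \<Rightarrow> 'm"
  where "tm (Leaf M) = M"
  | "tm (Unit k) = id1 K k"
  | "tm (s \<odot> t) = tm s \<otimes> tm t"

primrec tsrc :: "('o, 'm) tree \<Rightarrow> 'o"
  where "tsrc (Leaf M) = Src K M"
  | "tsrc (Unit k) = k"
  | "tsrc (s \<odot> t) = tsrc t"

primrec ttrg :: "('o, 'm) tree \<Rightarrow> 'o"
  where "ttrg (Leaf M) = Trg K M"
  | "ttrg (Unit k) = k"
  | "ttrg (s \<odot> t) = ttrg s"

primrec tok :: "('o, 'm) tree \<Rightarrow> bool"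
  where "tok (Leaf M) \<longleftrightarrow> M \<in> Mor K"
  | "tok (Unit k) \<longleftrightarrow> k \<in> Ob K"
  | "tok (s \<odot> t) \<longleftrightarrow> tok s \<and> tok t \<and> tsrc s = ttrg t"

lemma tok_simps [simp]:
  "tok s \<Longrightarrow> tm s \<in> Mor K" "tok s \<Longrightarrow> Src K (tm s) = tsrc s" "tok s \<Longrightarrow> Trg K (tm s) = ttrg s"
  "tok s \<Longrightarrow> ptrg (tsrc s) (lv s) = ttrg s" "tok s \<Longrightarrow> okp (tsrc s) (lv s)"
  "tok s \<Longrightarrow> tsrc s \<in> Ob K" "tok s \<Longrightarrow> ttrg s \<in> Ob K"
proof -
  have "tok s \<Longrightarrow> tm s \<in> Mor K \<and> Src K (tm s) = tsrc s \<and> Trg K (tm s) = ttrg s \<and>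
      ptrg (tsrc s) (lv s) = ttrg s \<and> okp (tsrc s) (lv s) \<and> tsrc s \<in> Ob K \<and> ttrg s \<in> Ob K"
    by (induction s) auto
  thus "tok s \<Longrightarrow> tm s \<in> Mor K" "tok s \<Longrightarrow> Src K (tm s) = tsrc s" "tok s \<Longrightarrow> Trg K (tm s) = ttrg s"
    "tok s \<Longrightarrow> ptrg (tsrc s) (lv s) = ttrg s" "tok s \<Longrightarrow> okp (tsrc s) (lv s)"
    "tok s \<Longrightarrow> tsrc s \<in> Ob K" "tok s \<Longrightarrow> ttrg s \<in> Ob K" by blast+
qed

text \<open>The coherence isomorphism from a bracketed composite, applied to \<open>X\<close>, to the iterated application of its factors.\<close>

primrec can :: "('o, 'm) tree \<Rightarrow> 'm \<Rightarrow> 'c"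
  where "can (Leaf M) X = id2 K (M \<otimes> X)"
  | "can (Unit k) X = \<l> X"
  | "can (s \<odot> t) X = can s (ev (lv t) X) \<cdot> (tm s \<lhd> can t X) \<cdot> \<a> (tm s) (tm t) X"

lemma can_simps [simp]:
  assumes "tok s" "X \<in> Mor K" "Trg K X = tsrc s"
  shows "iso (can s X)" "Dom K (can s X) = tm s \<otimes> X" "Cod K (can s X) = ev (lv s) X"
proof -
  have "iso (can s X) \<and> Dom K (can s X) = tm s \<otimes> X \<and> Cod K (can s X) = ev (lv s) X"
    using assms
  proof (induction s arbitrary: X)
    case (Node s t)
    have t: "iso (can t X)" "Dom K (can t X) = tm t \<otimes> X" "Cod K (can t X) = ev (lv t) X"
      using Node by auto
    have s: "iso (can s (ev (lv t) X))" "Dom K (can s (ev (lv t) X)) = tm s \<otimes> ev (lv t) X"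
      "Cod K (can s (ev (lv t) X)) = ev (lv s) (ev (lv t) X)"
      using Node by auto
    show ?case using s t Node.prems by simp
  qed auto
  thus "iso (can s X)" "Dom K (can s X) = tm s \<otimes> X" "Cod K (can s X) = ev (lv s) X" by auto
qed

lemma can_natural:
  assumes "tok s" "f \<in> Cell K" "Trg K (Dom K f) = tsrc s"
  shows "can s (Cod K f) \<cdot> (tm s \<lhd> f) = lw (lv s) f \<cdot> can s (Dom K f)"
  using assms
proof (induction s arbitrary: f)
  case (Leaf M)
  thus ?case by simp
next
  case (Unit k)
  thus ?case using lun_nat[of f] by simp
next
  case (Node s t)
  note [simp] = Node.prems(2,3)
  have [simp]: "tok s" "tok t" "tsrc s = ttrg t" "Trg K (Dom K f) = tsrc t" using Node.prems by auto
  have [simp]: "okp (ttrg t) (lv s)" using tok_simps(5)[of s] by simp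
  have c: "lw (lv t) f \<in> Cell K" "Dom K (lw (lv t) f) = ev (lv t) (Dom K f)" "Cod K (lw (lv t) f) = ev (lv t) (Cod K f)"
    by simp_all
  have "can (s \<odot> t) (Cod K f) \<cdot> (tm (s \<odot> t) \<lhd> f)
    = can s (ev (lv t) (Cod K f)) \<cdot> (tm s \<lhd> can t (Cod K f)) \<cdot> \<a> (tm s) (tm t) (Cod K f) \<cdot> ((tm s \<otimes> tm t) \<lhd> f)"
    by simp
  also have "\<a> (tm s) (tm t) (Cod K f) \<cdot> ((tm s \<otimes> tm t) \<lhd> f) = (tm s \<lhd> (tm t \<lhd> f)) \<cdot> \<a> (tm s) (tm t) (Dom K f)"
    using asc_nat[of "id2 K (tm s)" "id2 K (tm t)" f] by simp
  also have "(tm s \<lhd> can t (Cod K f)) \<cdot> (tm s \<lhd> (tm t \<lhd> f)) \<cdot> \<a> (tm s) (tm t) (Dom K f)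
    = (tm s \<lhd> (can t (Cod K f) \<cdot> (tm t \<lhd> f))) \<cdot> \<a> (tm s) (tm t) (Dom K f)"
    by (simp add: lwhisk_vcomp)
  also have "can t (Cod K f) \<cdot> (tm t \<lhd> f) = lw (lv t) f \<cdot> can t (Dom K f)"
    by (rule Node.IH(2)) simp_all
  also have "can s (ev (lv t) (Cod K f)) \<cdot> (tm s \<lhd> (lw (lv t) f \<cdot> can t (Dom K f))) \<cdot> \<a> (tm s) (tm t) (Dom K f)
    = (can s (Cod K (lw (lv t) f)) \<cdot> (tm s \<lhd> lw (lv t) f)) \<cdot> (tm s \<lhd> can t (Dom K f)) \<cdot> \<a> (tm s) (tm t) (Dom K f)"
    using c by (simp add: lwhisk_vcomp)
  also have "can s (Cod K (lw (lv t) f)) \<cdot> (tm s \<lhd> lw (lv t) f) = lw (lv s) (lw (lv t) f) \<cdot> can s (Dom K (lw (lv t) f))"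
    by (rule Node.IH(1)) (use c in simp_all)
  finally show ?case using c by simp
qed

text \<open>A 2-cell \<open>f\<close> between bracketed composites becomes a box by conjugating \<open>f \<otimes> X\<close> with the coherence isomorphisms.\<close>

definition cellgen :: "('o, 'm) tree \<Rightarrow> ('o, 'm) tree \<Rightarrow> 'c \<Rightarrow> ('o, 'm, 'c) gen"
  where "cellgen s t f = Gen (lv s) (lv t) (tsrc s) (\<lambda>X. can t X \<cdot> (f \<rhd> X) \<cdot> inv2 K (can s X))"

lemma cellgen_simps [simp]:
  "gdom (cellgen s t f) = lv s" "gcod (cellgen s t f) = lv t" "gsrc (cellgen s t f) = tsrc s"
  by (simp_all add: cellgen_def)

lemma okg_cellgen [simp]:
  assumes "tok s" "tok t" "tsrc s = tsrc t" "ttrg s = ttrg t" "f \<in> hom2 K (tm s) (tm t)"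
  shows "okg (cellgen s t f)"
proof -
  note [simp] = assms(1,2,4) assms(3)[symmetric]
  have [simp]: "f \<in> Cell K" "Dom K f = tm s" "Cod K f = tm t" using assms(5) by (auto simp: in_hom2)
  have p [simp]: "okp (tsrc s) (lv s)" "okp (tsrc s) (lv t)" "ptrg (tsrc s) (lv s) = ttrg t" "ptrg (tsrc s) (lv t) = ttrg t"
    using tok_simps(4,5)[of t] tok_simps(4,5)[of s] by simp_all
  have nat: "(can t (Cod K h) \<cdot> (f \<rhd> Cod K h) \<cdot> inv2 K (can s (Cod K h))) \<cdot> lw (lv s) h
    = lw (lv t) h \<cdot> can t (Dom K h) \<cdot> (f \<rhd> Dom K h) \<cdot> inv2 K (can s (Dom K h))"
    if h: "h \<in> Cell K" "Trg K (Dom K h) = tsrc s" for h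
  proof -
    note [simp] = h
    have "inv2 K (can s (Cod K h)) \<cdot> (lw (lv s) h \<cdot> can s (Dom K h)) \<cdot> inv2 K (can s (Dom K h))
       = inv2 K (can s (Cod K h)) \<cdot> (can s (Cod K h) \<cdot> (tm s \<lhd> h)) \<cdot> inv2 K (can s (Dom K h))"
      by (simp only: can_natural[OF assms(1) h])
    hence 1: "inv2 K (can s (Cod K h)) \<cdot> lw (lv s) h = (tm s \<lhd> h) \<cdot> inv2 K (can s (Dom K h))"
      by simp
    have "(can t (Cod K h) \<cdot> (f \<rhd> Cod K h) \<cdot> inv2 K (can s (Cod K h))) \<cdot> lw (lv s) h
      = can t (Cod K h) \<cdot> ((f \<rhd> Cod K h) \<cdot> (tm s \<lhd> h)) \<cdot> inv2 K (can s (Dom K h))"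
      by (simp add: 1)
    also have "(f \<rhd> Cod K h) \<cdot> (tm s \<lhd> h) = (tm t \<lhd> h) \<cdot> (f \<rhd> Dom K h)"
      using hcomp_split[of f h] hcomp_split'[of f h] by simp
    also have "can t (Cod K h) \<cdot> ((tm t \<lhd> h) \<cdot> (f \<rhd> Dom K h)) \<cdot> inv2 K (can s (Dom K h))
      = (can t (Cod K h) \<cdot> (tm t \<lhd> h)) \<cdot> (f \<rhd> Dom K h) \<cdot> inv2 K (can s (Dom K h))"
      by simp
    also have "can t (Cod K h) \<cdot> (tm t \<lhd> h) = lw (lv t) h \<cdot> can t (Dom K h)"
      by (rule can_natural) simp_all
    finally show ?thesis by simp
  qed
  show ?thesis unfolding okg_def
    by (auto simp: cellgen_def in_hom2 nat simp del: vassoc)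
qed

text \<open>The condition is a commuting square rather than a conjugation, so that composites of representations need no
  inverses of coherence isomorphisms.\<close>

definition rep :: "('o, 'm) tree \<Rightarrow> ('o, 'm) tree \<Rightarrow> 'c \<Rightarrow> ('o, 'm, 'c) diagram \<Rightarrow> bool"
  where "rep s t f w \<longleftrightarrow> tok s \<and> tok t \<and> tsrc s = tsrc t \<and> ttrg s = ttrg t \<and>
    f \<in> hom2 K (tm s) (tm t) \<and> wt (tsrc s) (lv s) w \<and> tgt (lv s) w = lv t \<and>
    (\<forall>X\<in>Mor K. Trg K X = tsrc s \<longrightarrow> sem (lv s) w X \<cdot> can s X = can t X \<cdot> (f \<rhd> X))"

lemma repD:
  assumes "rep s t f w"
  shows "tok s" "tok t" "tsrc t = tsrc s" "ttrg t = ttrg s" "f \<in> Cell K" "Dom K f = tm s" "Cod K f = tm t"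
    "wt (tsrc s) (lv s) w" "tgt (lv s) w = lv t"
    "X \<in> Mor K \<Longrightarrow> Trg K X = tsrc s \<Longrightarrow> sem (lv s) w X \<cdot> can s X = can t X \<cdot> (f \<rhd> X)"
  using assms by (auto simp: rep_def in_hom2)

text \<open>Coherence in the form in which it is used: an equation of 2-cells amounts to an equation of representing
  diagrams. In one direction the coherence isomorphisms are cancelled; in the other one, \<open>X\<close> is an identity 1-cell,
  along which whiskering is faithful.\<close>

lemma rep_eq_iff:
  assumes "rep s t f w" "rep s t f' w'"
  shows "f = f' \<longleftrightarrow> \<langle>tsrc s, lv s\<rangle> w \<approx> w'"
proof
  note f = repD[OF assms(1)] and f' = repD[OF assms(2)]
  note [simp] = f(1-8) f'(5-8)
  { assume "f = f'"
    have "sem (lv s) w X = sem (lv s) w' X" if "X \<in> Mor K" "Trg K X = tsrc s" for X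
      by (rule iso_epi[of "can s X"]) (use that f(10) f'(10) \<open>f = f'\<close> in auto)
    thus "\<langle>tsrc s, lv s\<rangle> w \<approx> w'" by (auto simp: eqd_def f(9) f'(9)) }
  { assume e: "\<langle>tsrc s, lv s\<rangle> w \<approx> w'"
    define I where "I = id1 K (tsrc s)"
    have I: "I \<in> Mor K" "Trg K I = tsrc s" by (auto simp: I_def)
    have "can t I \<cdot> (f \<rhd> I) = can t I \<cdot> (f' \<rhd> I)"
      using e I f(10)[OF I] f'(10)[OF I] by (simp add: eqd_def)
    hence "f \<rhd> I = f' \<rhd> I"
      by (rule iso_mono[rotated -1]) (use I in auto)
    thus "f = f'" using rwhisk_id_faithful[of f f'] by (simp add: I_def) }
qed

lemma rep_word: "rep s t f w \<Longrightarrow> w = w' \<Longrightarrow> rep s t f w'"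
  by simp

lemma rep_cellgen:
  assumes "tok s" "tok t" "tsrc s = tsrc t" "ttrg s = ttrg t" "f \<in> hom2 K (tm s) (tm t)"
  shows "rep s t f [([], cellgen s t f, [])]"
proof -
  note [simp] = assms(1,2,4) assms(3)[symmetric]
  have [simp]: "f \<in> Cell K" "Dom K f = tm s" "Cod K f = tm t" using assms(5) by (auto simp: in_hom2)
  have p [simp]: "okp (tsrc s) (lv s)" "okp (tsrc s) (lv t)" "ptrg (tsrc s) (lv s) = ttrg t" "ptrg (tsrc s) (lv t) = ttrg t"
    using tok_simps(4,5)[of t] tok_simps(4,5)[of s] by simp_all
  show ?thesis
    using assms okg_cellgen[OF assms] unfolding rep_def by (auto simp: cellgen_def)
qed

lemma rep_id: "tok s \<Longrightarrow> M = tm s \<Longrightarrow> rep s s (id2 K M) []"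
  by (auto simp: rep_def in_hom2)

lemma rep_vcomp:
  assumes "rep s u f w" "rep u t g w'"
  shows "rep s t (g \<cdot> f) (w' @ w)"
proof -
  note f = repD[OF assms(1)] and g = repD[OF assms(2)]
  note [simp] = f(1-9) g(2-9)
  have wg [simp]: "wt (tsrc s) (lv u) w'" "okp (tsrc s) (lv t)" "okp (tsrc s) (lv u)" "ptrg (tsrc s) (lv u) = ttrg s"
    "ptrg (tsrc s) (lv t) = ttrg s"
    using g(8) tok_simps(4,5)[of t] tok_simps(4,5)[of u] by simp_all
  have "sem (lv s) (w' @ w) X \<cdot> can s X = can t X \<cdot> ((g \<cdot> f) \<rhd> X)"
    if X [simp]: "X \<in> Mor K" "Trg K X = tsrc s" for X
  proof -
    have "sem (lv s) (w' @ w) X \<cdot> can s X = sem (lv u) w' X \<cdot> sem (lv s) w X \<cdot> can s X"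
      by (simp add: sem_append)
    also have "\<dots> = (sem (lv u) w' X \<cdot> can u X) \<cdot> (f \<rhd> X)"
      by (simp add: f(10))
    also have "\<dots> = can t X \<cdot> ((g \<cdot> f) \<rhd> X)"
      by (simp add: g(10) rwhisk_vcomp)
    finally show ?thesis .
  qed
  thus ?thesis by (auto simp: rep_def in_hom2)
qed

text \<open>In \<open>f \<star> g\<close> the box of \<open>f\<close> sees \<open>g\<close> only through its argument, and naturality of \<open>can\<close> moves \<open>g\<close> past the coherence
  isomorphism of the source of \<open>f\<close>.\<close>

lemma rep_hcomp:
  assumes "rep s s' f w" "rep t t' g v" "tsrc s = ttrg t"
  shows "rep (s \<odot> t) (s' \<odot> t') (f \<star> g) (whisk [] w (lv t') @ whisk (lv s) v [])"
proof -
  note f = repD[OF assms(1)] and g = repD[OF assms(2)]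
  note [simp] = f(1-9) g(1-9) assms(3)
  have p [simp]: "okp (ttrg t) (lv s)" "okp (ttrg t) (lv s')" "okp (tsrc t) (lv t)" "okp (tsrc t) (lv t')"
    "ptrg (tsrc t) (lv t) = ttrg t" "ptrg (tsrc t) (lv t') = ttrg t"
    "ptrg (ttrg t) (lv s) = ttrg s" "ptrg (ttrg t) (lv s') = ttrg s" "wt (ttrg t) (lv s) w"
    using tok_simps(4,5)[of t] tok_simps(4,5)[of t'] tok_simps(4,5)[of s] tok_simps(4,5)[of s'] f(8) by simp_all
  have wv: "wt (tsrc t) (lv s @ lv t) (whisk (lv s) v [])"
    using wt_whisk[of "tsrc t" "[]" "lv t" v "lv s"] by simp
  have tv: "tgt (lv s @ lv t) (whisk (lv s) v []) = lv s @ lv t'"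
    using tgt_whisk[of "lv s" "lv t" "[]" v] by simp
  have ww: "wt (tsrc t) (lv s @ lv t') (whisk [] w (lv t'))"
    using wt_whisk[of "tsrc t" "lv t'" "lv s" w "[]"] by simp
  have tw: "tgt (lv s @ lv t') (whisk [] w (lv t')) = lv s' @ lv t'"
    using tgt_whisk[of "[]" "lv s" "lv t'" w] by simp
  have "sem (lv s @ lv t) (whisk [] w (lv t') @ whisk (lv s) v []) X \<cdot> can (s \<odot> t) X
      = can (s' \<odot> t') X \<cdot> ((f \<star> g) \<rhd> X)"
    if X [simp]: "X \<in> Mor K" "Trg K X = tsrc t" for X
  proof -
    define Y where "Y = ev (lv t) X"
    define Y' where "Y' = ev (lv t') X"
    define \<phi> where "\<phi> = sem (lv t) v X"
    define \<psi> where "\<psi> = sem (lv s) w Y'"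
    have Y [simp]: "Y \<in> Mor K" "Trg K Y = ttrg t" "Y' \<in> Mor K" "Trg K Y' = ttrg t"
      by (auto simp: Y_def Y'_def)
    have \<phi> [simp]: "\<phi> \<in> Cell K" "Dom K \<phi> = Y" "Cod K \<phi> = Y'" by (auto simp: \<phi>_def Y_def Y'_def)
    have \<psi> [simp]: "\<psi> \<in> Cell K" "Dom K \<psi> = ev (lv s) Y'" "Cod K \<psi> = ev (lv s') Y'" by (auto simp: \<psi>_def)
    have [simp]: "iso (can t X)" "Dom K (can t X) = tm t \<otimes> X" "Cod K (can t X) = Y"
      "iso (can t' X)" "Dom K (can t' X) = tm t' \<otimes> X" "Cod K (can t' X) = Y'"
      by (simp_all add: Y_def Y'_def)
    have sem: "sem (lv s @ lv t) (whisk [] w (lv t') @ whisk (lv s) v []) X = \<psi> \<cdot> lw (lv s) \<phi>"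
      using wv ww tv sem_append[of X "lv s @ lv t" "whisk [] w (lv t')" "whisk (lv s) v []"]
        sem_whisk[of X "[]" "lv t" v "lv s"] sem_whisk[of X "lv t'" "lv s" w "[]"]
      by (simp add: \<phi>_def \<psi>_def Y'_def)
    have "\<psi> \<cdot> lw (lv s) \<phi> \<cdot> can s Y \<cdot> (tm s \<lhd> can t X) \<cdot> \<a> (tm s) (tm t) X
      = \<psi> \<cdot> (lw (lv s) \<phi> \<cdot> can s (Dom K \<phi>)) \<cdot> (tm s \<lhd> can t X) \<cdot> \<a> (tm s) (tm t) X" by simp
    also have "lw (lv s) \<phi> \<cdot> can s (Dom K \<phi>) = can s Y' \<cdot> (tm s \<lhd> \<phi>)"
      using can_natural[of s \<phi>] by simp
    also have "\<psi> \<cdot> (can s Y' \<cdot> (tm s \<lhd> \<phi>)) \<cdot> (tm s \<lhd> can t X) \<cdot> \<a> (tm s) (tm t) X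
      = (\<psi> \<cdot> can s Y') \<cdot> (tm s \<lhd> (\<phi> \<cdot> can t X)) \<cdot> \<a> (tm s) (tm t) X"
      by (simp add: lwhisk_vcomp)
    also have "\<psi> \<cdot> can s Y' = can s' Y' \<cdot> (f \<rhd> Y')"
      unfolding \<psi>_def by (rule f(10)) simp_all
    also have "\<phi> \<cdot> can t X = can t' X \<cdot> (g \<rhd> X)"
      unfolding \<phi>_def by (rule g(10)) simp_all
    also have "(can s' Y' \<cdot> (f \<rhd> Y')) \<cdot> (tm s \<lhd> (can t' X \<cdot> (g \<rhd> X))) \<cdot> \<a> (tm s) (tm t) X
      = can s' Y' \<cdot> ((f \<rhd> Y') \<cdot> (tm s \<lhd> can t' X)) \<cdot> (tm s \<lhd> (g \<rhd> X)) \<cdot> \<a> (tm s) (tm t) X"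
      by (simp add: lwhisk_vcomp)
    also have "(f \<rhd> Y') \<cdot> (tm s \<lhd> can t' X) = (tm s' \<lhd> can t' X) \<cdot> (f \<rhd> (tm t' \<otimes> X))"
      using hcomp_split[of f "can t' X"] hcomp_split'[of f "can t' X"] by simp
    also have "can s' Y' \<cdot> ((tm s' \<lhd> can t' X) \<cdot> (f \<rhd> (tm t' \<otimes> X))) \<cdot> (tm s \<lhd> (g \<rhd> X)) \<cdot> \<a> (tm s) (tm t) X
      = can s' Y' \<cdot> (tm s' \<lhd> can t' X) \<cdot> ((f \<rhd> (tm t' \<otimes> X)) \<cdot> (tm s \<lhd> (g \<rhd> X))) \<cdot> \<a> (tm s) (tm t) X"
      by simp
    also have "(f \<rhd> (tm t' \<otimes> X)) \<cdot> (tm s \<lhd> (g \<rhd> X)) = f \<star> (g \<rhd> X)"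
      using hcomp_split[of f "g \<rhd> X"] by simp
    also have "(f \<star> (g \<rhd> X)) \<cdot> \<a> (tm s) (tm t) X = \<a> (tm s') (tm t') X \<cdot> ((f \<star> g) \<rhd> X)"
      using asc_nat[of f g "id2 K X"] by simp
    finally show ?thesis unfolding sem by (simp flip: Y_def Y'_def)
  qed
  thus ?thesis using wv ww tv tw by (auto simp: rep_def in_hom2)
qed

text \<open>This is the pentagon axiom.\<close>

lemma rep_asc:
  assumes "tok s" "tok t" "tok u" "tsrc s = ttrg t" "tsrc t = ttrg u" "M = tm s" "N = tm t" "P = tm u"
  shows "rep ((s \<odot> t) \<odot> u) (s \<odot> t \<odot> u) (\<a> M N P) []"
proof -
  note [simp] = assms
  have p [simp]: "okp (tsrc u) (lv u)" "okp (ttrg u) (lv t)" "okp (ttrg t) (lv s)"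
    "ptrg (ttrg u) (lv t) = ttrg t"
    using tok_simps(4,5)[of t] tok_simps(5)[of s] by simp_all
  have "can ((s \<odot> t) \<odot> u) X = can (s \<odot> t \<odot> u) X \<cdot> (\<a> (tm s) (tm t) (tm u) \<rhd> X)"
    if X [simp]: "X \<in> Mor K" "Trg K X = tsrc u" for X
  proof -
    define Y where "Y = ev (lv u) X"
    define Z where "Z = ev (lv t) Y"
    have [simp]: "Y \<in> Mor K" "Trg K Y = ttrg u" "Z \<in> Mor K" "Trg K Z = ttrg t" by (auto simp: Y_def Z_def)
    have [simp]: "Dom K (can u X) = tm u \<otimes> X" "Cod K (can u X) = Y" "Dom K (can t Y) = tm t \<otimes> Y" "Cod K (can t Y) = Z"
      by (simp_all add: Y_def Z_def)
    have "can ((s \<odot> t) \<odot> u) X = can s Z \<cdot> (tm s \<lhd> can t Y) \<cdot> (\<a> (tm s) (tm t) Y \<cdot> ((tm s \<otimes> tm t) \<lhd> can u X))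
        \<cdot> \<a> (tm s \<otimes> tm t) (tm u) X"
      by (simp flip: Y_def Z_def)
    also have "\<a> (tm s) (tm t) Y \<cdot> ((tm s \<otimes> tm t) \<lhd> can u X)
        = (tm s \<lhd> (tm t \<lhd> can u X)) \<cdot> \<a> (tm s) (tm t) (tm u \<otimes> X)"
      using asc_nat[of "id2 K (tm s)" "id2 K (tm t)" "can u X"] by simp
    also have "can s Z \<cdot> (tm s \<lhd> can t Y) \<cdot> ((tm s \<lhd> (tm t \<lhd> can u X)) \<cdot> \<a> (tm s) (tm t) (tm u \<otimes> X))
        \<cdot> \<a> (tm s \<otimes> tm t) (tm u) X
      = can s Z \<cdot> (tm s \<lhd> can t Y) \<cdot> (tm s \<lhd> (tm t \<lhd> can u X)) \<cdot> (\<a> (tm s) (tm t) (tm u \<otimes> X)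
        \<cdot> \<a> (tm s \<otimes> tm t) (tm u) X)" by simp
    also have "\<a> (tm s) (tm t) (tm u \<otimes> X) \<cdot> \<a> (tm s \<otimes> tm t) (tm u) X
      = (tm s \<lhd> \<a> (tm t) (tm u) X) \<cdot> \<a> (tm s) (tm t \<otimes> tm u) X \<cdot> (\<a> (tm s) (tm t) (tm u) \<rhd> X)"
      by (rule pentagon) simp_all
    finally show ?thesis by (simp add: lwhisk_vcomp flip: Y_def Z_def)
  qed
  thus ?thesis by (auto simp: rep_def in_hom2)
qed

text \<open>This is Kelly's law.\<close>

lemma rep_lun:
  assumes "tok s" "k = ttrg s" "M = tm s"
  shows "rep (Unit k \<odot> s) s (\<l> M) []"
proof -
  note [simp] = assms
  have "can (Unit k \<odot> s) X = can s X \<cdot> (\<l> M \<rhd> X)" if X [simp]: "X \<in> Mor K" "Trg K X = tsrc s" for X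
  proof -
    have "\<l> (ev (lv s) X) \<cdot> (id1 K (ttrg s) \<lhd> can s X) = can s X \<cdot> \<l> (tm s \<otimes> X)"
      using lun_nat[of "can s X"] by simp
    hence "(\<l> (ev (lv s) X) \<cdot> (id1 K (ttrg s) \<lhd> can s X)) \<cdot> \<a> (id1 K (ttrg s)) (tm s) X
      = (can s X \<cdot> \<l> (tm s \<otimes> X)) \<cdot> \<a> (id1 K (ttrg s)) (tm s) X" by simp
    thus ?thesis using lun_comp1[of "tm s" X] by simp
  qed
  thus ?thesis by (auto simp: rep_def in_hom2)
qed

text \<open>This is the triangle axiom.\<close>

lemma rep_run:
  assumes "tok s" "k = tsrc s" "M = tm s"
  shows "rep (s \<odot> Unit k) s (\<r> M) []"
proof -
  note [simp] = assms
  have "can (s \<odot> Unit k) X = can s X \<cdot> (\<r> M \<rhd> X)" if X [simp]: "X \<in> Mor K" "Trg K X = tsrc s" for X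
    using triangle[of "tm s" X] by simp
  thus ?thesis by (auto simp: rep_def in_hom2)
qed

lemma rep_inv:
  assumes "rep s t f []" "iso f"
  shows "rep t s (inv2 K f) []"
proof -
  note f = repD[OF assms(1)]
  have [simp]: "lv s = lv t" using f(9) by simp
  note [simp] = f(1-7) assms(2)
  have "can t X = can s X \<cdot> (inv2 K f \<rhd> X)" if X [simp]: "X \<in> Mor K" "Trg K X = tsrc s" for X
  proof -
    have "okp (tsrc s) (lv t)" using tok_simps(5)[of t] by simp
    hence c: "can s X = can t X \<cdot> (f \<rhd> X)" using f(10)[OF X] by simp
    have "can s X \<cdot> (inv2 K f \<rhd> X) = can t X \<cdot> ((f \<cdot> inv2 K f) \<rhd> X)"
      unfolding c by (subst rwhisk_vcomp) simp_all
    thus ?thesis by simp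
  qed
  moreover have "okp (tsrc s) (lv t)" using tok_simps(5)[of t] by simp
  ultimately show ?thesis by (auto simp: rep_def in_hom2)
qed

lemma rep_asc_inv:
  assumes "tok s" "tok t" "tok u" "tsrc s = ttrg t" "tsrc t = ttrg u" "M = tm s" "N = tm t" "P = tm u"
  shows "rep (s \<odot> t \<odot> u) ((s \<odot> t) \<odot> u) (\<a>\<^sup>- M N P) []"
  by (rule rep_inv[OF rep_asc]) (use assms in simp_all)

lemma rep_lun_inv: "tok s \<Longrightarrow> k = ttrg s \<Longrightarrow> M = tm s \<Longrightarrow> rep s (Unit k \<odot> s) (\<l>\<^sup>- M) []"
  by (rule rep_inv[OF rep_lun]) simp_all

lemma rep_run_inv: "tok s \<Longrightarrow> k = tsrc s \<Longrightarrow> M = tm s \<Longrightarrow> rep s (s \<odot> Unit k) (\<r>\<^sup>- M) []"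
  by (rule rep_inv[OF rep_run]) simp_all

text \<open>These rules compute a representing diagram by recursion on the shape of a 2-cell. The bracketing of the target is
  found along the way, since each rule determines it from the bracketing of the source.\<close>

lemmas rep_intros = rep_asc_inv rep_lun_inv rep_run_inv rep_asc rep_lun rep_run rep_id rep_hcomp rep_vcomp

end

section \<open>The defining equations as diagrams\<close>

text \<open>The bracketing to the right of a nonempty list of 1-cells.\<close>

primrec tr :: "'m list \<Rightarrow> ('o, 'm) tree"
  where "tr [] = undefined"
  | "tr (M # Ms) = (if Ms = [] then Leaf M else Leaf M \<odot> tr Ms)"

lemma lv_tr [simp]: "Ms \<noteq> [] \<Longrightarrow> lv (tr Ms) = Ms"
  by (induction Ms) auto

context bicategory
begin

text \<open>The box of a 2-cell whose source and target are composites bracketed to the right.\<close>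

definition box :: "'m list \<Rightarrow> 'm list \<Rightarrow> 'c \<Rightarrow> ('o, 'm, 'c) gen"
  where "box Ms Ns f = cellgen (tr Ms) (tr Ns) f"

lemma box_simps [simp]:
  "Ms \<noteq> [] \<Longrightarrow> gdom (box Ms Ns f) = Ms" "Ns \<noteq> [] \<Longrightarrow> gcod (box Ms Ns f) = Ns"
  "gsrc (box Ms Ns f) = tsrc (tr Ms)"
  by (simp_all add: box_def)

lemma okg_box [simp]:
  assumes "tok (tr Ms)" "tok (tr Ns)" "tsrc (tr Ms) = tsrc (tr Ns)" "ttrg (tr Ms) = ttrg (tr Ns)"
    "f \<in> hom2 K (tm (tr Ms)) (tm (tr Ns))"
  shows "okg (box Ms Ns f)"
  unfolding box_def by (rule okg_cellgen) (use assms in auto)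

lemma rep_box:
  assumes "f \<in> hom2 K (tm (tr Ms)) (tm (tr Ns))" "tok (tr Ms)" "tok (tr Ns)"
    "tsrc (tr Ms) = tsrc (tr Ns)" "ttrg (tr Ms) = ttrg (tr Ns)" "s = tr Ms" "t = tr Ns"
  shows "rep s t f [([], box Ms Ns f, [])]"
  unfolding box_def assms(6,7) by (rule rep_cellgen) (use assms in auto)

lemma diagram_eq_iff:
  assumes "rep s t f w" "rep s t f' w'" "tsrc s = k" "lv s = P"
  shows "f = f' \<longleftrightarrow> \<langle>k, P\<rangle> w \<approx> w'"
  using rep_eq_iff[OF assms(1,2)] assms(3,4) by simp

definition mul :: "('m, 'c) monad \<Rightarrow> ('o, 'm, 'c) gen"
  where "mul A = cellgen (Leaf (mnd A) \<odot> Leaf (mnd A)) (Leaf (mnd A)) (\<mu> A)"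

definition unt :: "('m, 'c) monad \<Rightarrow> ('o, 'm, 'c) gen"
  where "unt A = cellgen (Unit (mobj K A)) (Leaf (mnd A)) (\<eta> A)"

text \<open>The typing conditions that make both sides of the monad axioms 2-cells with a common boundary.\<close>

definition premonad :: "('m, 'c) monad \<Rightarrow> bool"
  where "premonad A \<longleftrightarrow> mnd A \<in> hom1 K (mobj K A) (mobj K A) \<and>
    \<mu> A \<in> hom2 K (mnd A \<otimes> mnd A) (mnd A) \<and> \<eta> A \<in> hom2 K (id1 K (mobj K A)) (mnd A)"

lemma Src_mnd [simp]: "Src K (mnd A) = mobj K A"
  by (simp add: mobj_def)

lemma mul_unt_simps [simp]:
  "gdom (mul A) = [mnd A, mnd A]" "gcod (mul A) = [mnd A]" "gsrc (mul A) = mobj K A"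
  "gdom (unt A) = []" "gcod (unt A) = [mnd A]" "gsrc (unt A) = mobj K A"
  by (simp_all add: mul_def unt_def)

lemma premonad_simps [simp]:
  assumes "premonad A"
  shows "mnd A \<in> Mor K" "Trg K (mnd A) = mobj K A" "mobj K A \<in> Ob K"
  using assms Src_Ob[of "mnd A"] by (auto simp: premonad_def hom1_def)

lemma premonad_okg [simp]:
  assumes "premonad A"
  shows "okg (mul A)" "okg (unt A)"
  unfolding mul_def unt_def by (rule okg_cellgen; use assms in \<open>simp add: premonad_def\<close>)+

lemma rep_mul:
  assumes "premonad A" "mnd A = a"
  shows "rep (Leaf a \<odot> Leaf a) (Leaf a) (\<mu> A) [([], mul A, [])]"
  unfolding mul_def assms(2)[symmetric] by (rule rep_cellgen) (use assms(1) in \<open>simp_all add: premonad_def\<close>)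

lemma rep_unt:
  assumes "premonad A" "mnd A = a" "mobj K A = k"
  shows "rep (Unit k) (Leaf a) (\<eta> A) [([], unt A, [])]"
  unfolding unt_def assms(2,3)[symmetric] by (rule rep_cellgen) (use assms(1) in \<open>simp_all add: premonad_def\<close>)

text \<open>From here on the axioms of each structure are rewritten as equations of diagrams. All proofs have the same form:
  both sides of an equation of 2-cells are represented by diagrams, which are computed by \<open>rep_intros\<close>.\<close>

lemma is_monad_iff:
  "is_monad K A \<longleftrightarrow> premonad A \<and>
    \<langle>mobj K A, [mnd A, mnd A, mnd A]\<rangle> [([], mul A, []), ([], mul A, [mnd A])] \<approx> [([], mul A, []), ([mnd A], mul A, [])] \<and>
    \<langle>mobj K A, [mnd A]\<rangle> [([], mul A, []), ([], unt A, [mnd A])] \<approx> [] \<and>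
    \<langle>mobj K A, [mnd A]\<rangle> [([], mul A, []), ([mnd A], unt A, [])] \<approx> []"
proof (cases "premonad A")
  case True
  let ?a = "Leaf (mnd A)" and ?k = "mobj K A"
  note [simp] = True
  have "rep ((?a \<odot> ?a) \<odot> ?a) ?a (\<mu> A \<cdot> (\<mu> A \<rhd> mnd A)) [([], mul A, []), ([], mul A, [mnd A])]"
    by (rule rep_word, (rule rep_intros rep_mul True | simp)+)
  moreover have "rep ((?a \<odot> ?a) \<odot> ?a) ?a (\<mu> A \<cdot> (mnd A \<lhd> \<mu> A) \<cdot> \<a> (mnd A) (mnd A) (mnd A))
      [([], mul A, []), ([mnd A], mul A, [])]"
    by (rule rep_word, (rule rep_intros rep_mul True | simp)+)
  ultimately have 1: "\<mu> A \<cdot> (\<mu> A \<rhd> mnd A) = \<mu> A \<cdot> (mnd A \<lhd> \<mu> A) \<cdot> \<a> (mnd A) (mnd A) (mnd A)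
    \<longleftrightarrow> \<langle>?k, [mnd A, mnd A, mnd A]\<rangle> [([], mul A, []), ([], mul A, [mnd A])] \<approx> [([], mul A, []), ([mnd A], mul A, [])]"
    by (auto dest: rep_eq_iff)
  have "rep (Unit ?k \<odot> ?a) ?a (\<mu> A \<cdot> (\<eta> A \<rhd> mnd A)) [([], mul A, []), ([], unt A, [mnd A])]"
    by (rule rep_word, (rule rep_intros rep_mul rep_unt True | simp)+)
  moreover have "rep (Unit ?k \<odot> ?a) ?a (\<l> (mnd A)) []"
    by (rule rep_word, (rule rep_intros rep_mul rep_unt True | simp)+)
  ultimately have 2: "\<mu> A \<cdot> (\<eta> A \<rhd> mnd A) = \<l> (mnd A) \<longleftrightarrow> \<langle>?k, [mnd A]\<rangle> [([], mul A, []), ([], unt A, [mnd A])] \<approx> []"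
    by (auto dest: rep_eq_iff)
  have "rep (?a \<odot> Unit ?k) ?a (\<mu> A \<cdot> (mnd A \<lhd> \<eta> A)) [([], mul A, []), ([mnd A], unt A, [])]"
    by (rule rep_word, (rule rep_intros rep_mul rep_unt True | simp)+)
  moreover have "rep (?a \<odot> Unit ?k) ?a (\<r> (mnd A)) []"
    by (rule rep_word, (rule rep_intros rep_mul rep_unt True | simp)+)
  ultimately have 3: "\<mu> A \<cdot> (mnd A \<lhd> \<eta> A) = \<r> (mnd A) \<longleftrightarrow> \<langle>?k, [mnd A]\<rangle> [([], mul A, []), ([mnd A], unt A, [])] \<approx> []"
    by (auto dest: rep_eq_iff)
  show ?thesis using True 1 2 3 by (simp add: is_monad_def Let_def premonad_def)
next
  case False
  thus ?thesis by (auto simp: is_monad_def Let_def premonad_def)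
qed

text \<open>The 2-cell of an identity morphism consists of unitors, so its diagram is empty.\<close>

lemma rep_mm_id:
  assumes "premonad A"
  shows "rep (Leaf (mnd A) \<odot> Unit (mobj K A)) (Unit (mobj K A) \<odot> Leaf (mnd A)) (mm_id K A) []"
  unfolding mm_id_def using assms by - (rule rep_word, (rule rep_intros | simp)+)

text \<open>The 1-cells that carry the two morphisms may themselves be bracketed composites. This makes the diagrams for iterated
  composites and for composites with identities available, and with them the coherence 2-cells of the
  bicategories built below.\<close>

lemma rep_mm_comp:
  assumes "premonad A" "premonad A'" "premonad A''"
    and "tok v" "tsrc v = mobj K A" "ttrg v = mobj K A'"
    and "tok v'" "tsrc v' = mobj K A'" "ttrg v' = mobj K A''"
    and x: "rep (Leaf (mnd A') \<odot> v) (v \<odot> Leaf (mnd A)) \<xi> x"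
    and x': "rep (Leaf (mnd A'') \<odot> v') (v' \<odot> Leaf (mnd A')) \<xi>' x'"
    and "V = tm v" "V' = tm v'"
  shows "rep (Leaf (mnd A'') \<odot> v' \<odot> v) ((v' \<odot> v) \<odot> Leaf (mnd A))
    (mm_comp K A A' A'' V' \<xi>' V \<xi>) (whisk (lv v') x [] @ whisk [] x' (lv v))"
  unfolding mm_comp_def using assms by - (rule rep_word, (rule rep_intros x x' | simp)+)

lemma monad_morphism_iff:
  assumes A: "is_monad K A" "is_monad K A'"
    and v: "tok v" "tsrc v = mobj K A" "ttrg v = mobj K A'" "V = tm v"
    and x: "rep (Leaf (mnd A') \<odot> v) (v \<odot> Leaf (mnd A)) \<xi> x"
  shows "monad_morphism K A A' V \<xi> \<longleftrightarrow>
    \<langle>mobj K A, mnd A' # mnd A' # lv v\<rangle> x @ [([], mul A', lv v)]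
      \<approx> (lv v, mul A, []) # whisk [] x [mnd A] @ whisk [mnd A'] x [] \<and>
    \<langle>mobj K A, lv v\<rangle> x @ [([], unt A', lv v)] \<approx> [(lv v, unt A, [])]"
proof -
  let ?a = "Leaf (mnd A)" and ?a' = "Leaf (mnd A')"
  have p [simp]: "premonad A" "premonad A'" using A by (auto simp: is_monad_iff)
  note [simp] = v
  note r = rep_intros x rep_mul rep_unt
  have 1: "\<xi> \<cdot> (\<mu> A' \<rhd> V) = (V \<lhd> \<mu> A) \<cdot> \<a> V (mnd A) (mnd A) \<cdot> (\<xi> \<rhd> mnd A)
      \<cdot> \<a>\<^sup>- (mnd A') V (mnd A) \<cdot> (mnd A' \<lhd> \<xi>) \<cdot> \<a> (mnd A') (mnd A') V \<longleftrightarrow>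
    \<langle>mobj K A, mnd A' # mnd A' # lv v\<rangle> x @ [([], mul A', lv v)]
      \<approx> (lv v, mul A, []) # whisk [] x [mnd A] @ whisk [mnd A'] x []"
    by (rule diagram_eq_iff[of "(?a' \<odot> ?a') \<odot> v" "v \<odot> ?a"]; (rule rep_word)?, (rule r | simp)+)
  have 2: "\<xi> \<cdot> (\<eta> A' \<rhd> V) = (V \<lhd> \<eta> A) \<cdot> \<r>\<^sup>- V \<cdot> \<l> V \<longleftrightarrow>
    \<langle>mobj K A, lv v\<rangle> x @ [([], unt A', lv v)] \<approx> [(lv v, unt A, [])]"
    by (rule diagram_eq_iff[of "Unit (mobj K A') \<odot> v" "v \<odot> ?a"]; (rule rep_word)?, (rule r | simp)+)
  have "V \<in> hom1 K (mobj K A) (mobj K A')" by (simp add: hom1_def)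
  moreover have "\<xi> \<in> hom2 K (mnd A' \<otimes> V) (V \<otimes> mnd A)" using x by (auto simp: rep_def)
  ultimately show ?thesis using A unfolding monad_morphism_def Let_def 1 2 by simp
qed

lemma monad_transformation_iff:
  assumes A: "premonad A" "premonad A'"
    and v: "tok v" "tsrc v = mobj K A" "ttrg v = mobj K A'" "V = tm v"
    and u: "tok u" "tsrc u = mobj K A" "ttrg u = mobj K A'" "U = tm u"
    and x: "rep (Leaf (mnd A') \<odot> v) (v \<odot> Leaf (mnd A)) \<xi> x"
    and y: "rep (Leaf (mnd A') \<odot> u) (u \<odot> Leaf (mnd A)) \<upsilon> y"
    and o: "rep v u \<omega> w"
  shows "monad_transformation K A A' V \<xi> U \<upsilon> \<omega> \<longleftrightarrow>
    \<langle>mobj K A, mnd A' # lv v\<rangle> y @ whisk [mnd A'] w [] \<approx> whisk [] w [mnd A] @ x"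
proof -
  note [simp] = A v u
  have 1: "\<upsilon> \<cdot> (mnd A' \<lhd> \<omega>) = (\<omega> \<rhd> mnd A) \<cdot> \<xi> \<longleftrightarrow>
    \<langle>mobj K A, mnd A' # lv v\<rangle> y @ whisk [mnd A'] w [] \<approx> whisk [] w [mnd A] @ x"
    by (rule diagram_eq_iff[of "Leaf (mnd A') \<odot> v" "u \<odot> Leaf (mnd A)"];
        (rule rep_word)?, (rule rep_intros x y o | simp)+)
  have "\<omega> \<in> hom2 K V U" using o by (auto simp: rep_def)
  thus ?thesis by (simp add: monad_transformation_def 1)
qed

text \<open>The typing conditions of a weak distributive law.\<close>

definition prelaw :: "('m, 'c) monad \<Rightarrow> ('m, 'c) monad \<Rightarrow> 'c \<Rightarrow> bool"
  where "prelaw A B \<Psi> \<longleftrightarrow> is_monad K A \<and> is_monad K B \<and> mobj K A = mobj K B \<and>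
    \<Psi> \<in> hom2 K (mnd A \<otimes> mnd B) (mnd B \<otimes> mnd A)"

lemma is_monad_premonad: "is_monad K A \<Longrightarrow> premonad A"
  by (simp add: is_monad_iff)

lemma weak_distributive_law_iff:
  assumes ab: "mnd A = a" "mnd B = b" "mobj K B = k"
  shows "weak_distributive_law K A B \<Psi> \<longleftrightarrow> prelaw A B \<Psi> \<and>
    \<langle>k, [a, a, b]\<rangle> [([], box [a, b] [b, a] \<Psi>, []), ([], mul A, [b])]
      \<approx> [([b], mul A, []), ([], box [a, b] [b, a] \<Psi>, [a]), ([a], box [a, b] [b, a] \<Psi>, [])] \<and>
    \<langle>k, [a, b, b]\<rangle> [([], box [a, b] [b, a] \<Psi>, []), ([a], mul B, [])]
      \<approx> [([], mul B, [a]), ([b], box [a, b] [b, a] \<Psi>, []), ([], box [a, b] [b, a] \<Psi>, [b])] \<and>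
    \<langle>k, [b, a]\<rangle> [([], mul B, [a]), ([b], box [a, b] [b, a] \<Psi>, []), ([b, a], unt B, [])]
      \<approx> [([b], mul A, []), ([], box [a, b] [b, a] \<Psi>, [a]), ([], unt A, [b, a])]"
proof (cases "prelaw A B \<Psi>")
  case True
  hence p: "premonad A" "premonad B" and [simp]: "mobj K A = mobj K B" "\<Psi> \<in> hom2 K (a \<otimes> b) (b \<otimes> a)"
    by (auto simp: prelaw_def is_monad_iff ab)
  note [simp] = p premonad_simps[OF p(1), unfolded ab] premonad_simps[OF p(2), unfolded ab] ab
    Src_mnd[of A, unfolded ab] Src_mnd[of B, unfolded ab]
  have "Src K a = k" "Src K b = k" using Src_mnd[of A] Src_mnd[of B] by simp_all
  note [simp] = this
  note r = rep_intros rep_mul rep_unt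
    rep_box[of \<Psi> "[a, b]" "[b, a]"]
  have 1: "\<Psi> \<cdot> (\<mu> A \<rhd> b) = (b \<lhd> \<mu> A) \<cdot> \<a> b a a \<cdot> (\<Psi> \<rhd> a) \<cdot> \<a>\<^sup>- a b a \<cdot> (a \<lhd> \<Psi>) \<cdot> \<a> a a b \<longleftrightarrow>
    \<langle>k, [a, a, b]\<rangle> [([], box [a, b] [b, a] \<Psi>, []), ([], mul A, [b])]
      \<approx> [([b], mul A, []), ([], box [a, b] [b, a] \<Psi>, [a]), ([a], box [a, b] [b, a] \<Psi>, [])]"
    by (rule diagram_eq_iff[of "(Leaf a \<odot> Leaf a) \<odot> Leaf b" "Leaf b \<odot> Leaf a"];
        (rule rep_word)?, (rule r | simp)+)
  have 2: "\<Psi> \<cdot> (a \<lhd> \<mu> B)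
      = (\<mu> B \<rhd> a) \<cdot> \<a>\<^sup>- b b a \<cdot> (b \<lhd> \<Psi>) \<cdot> \<a> b a b \<cdot> (\<Psi> \<rhd> b) \<cdot> \<a>\<^sup>- a b b \<longleftrightarrow>
    \<langle>k, [a, b, b]\<rangle> [([], box [a, b] [b, a] \<Psi>, []), ([a], mul B, [])]
      \<approx> [([], mul B, [a]), ([b], box [a, b] [b, a] \<Psi>, []), ([], box [a, b] [b, a] \<Psi>, [b])]"
    by (rule diagram_eq_iff[of "Leaf a \<odot> Leaf b \<odot> Leaf b" "Leaf b \<odot> Leaf a"];
        (rule rep_word)?, (rule r | simp)+)
  have 3: "(\<mu> B \<rhd> a) \<cdot> \<a>\<^sup>- b b a \<cdot> (b \<lhd> \<Psi>) \<cdot> (b \<lhd> (a \<lhd> \<eta> B)) \<cdot> (b \<lhd> \<r>\<^sup>- a)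
      = (b \<lhd> \<mu> A) \<cdot> \<a> b a a \<cdot> (\<Psi> \<rhd> a) \<cdot> ((\<eta> A \<rhd> b) \<rhd> a) \<cdot> (\<l>\<^sup>- b \<rhd> a) \<longleftrightarrow>
    \<langle>k, [b, a]\<rangle> [([], mul B, [a]), ([b], box [a, b] [b, a] \<Psi>, []), ([b, a], unt B, [])]
      \<approx> [([b], mul A, []), ([], box [a, b] [b, a] \<Psi>, [a]), ([], unt A, [b, a])]"
    by (rule diagram_eq_iff[of "Leaf b \<odot> Leaf a" "Leaf b \<odot> Leaf a"];
        (rule rep_word)?, (rule r | simp)+)
  show ?thesis using True unfolding weak_distributive_law_def Let_def ab 1 2 3 by (simp add: prelaw_def)
next
  case False
  thus ?thesis by (auto simp: weak_distributive_law_def prelaw_def Let_def)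
qed

lemma rep_Psi_bar:
  assumes \<Psi>: "prelaw A B \<Psi>" and ab: "mnd A = a" "mnd B = b"
  shows "rep (Leaf b \<odot> Leaf a) (Leaf b \<odot> Leaf a) (Psi_bar K A B \<Psi>)
    [([], mul B, [a]), ([b, b], mul A, []), ([b], box [a, b] [b, a] \<Psi>, [a]), ([b], unt A, [b, a]), ([b], unt B, [a])]"
proof -
  have p: "premonad A" "premonad B" and [simp]: "mobj K A = mobj K B" "\<Psi> \<in> hom2 K (a \<otimes> b) (b \<otimes> a)"
    using \<Psi> by (auto simp: prelaw_def is_monad_iff ab)
  note [simp] = p premonad_simps[OF p(1), unfolded ab] premonad_simps[OF p(2), unfolded ab] ab
  have "Src K a = mobj K B" "Src K b = mobj K B" using Src_mnd[of A] Src_mnd[of B] by simp_all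
  note [simp] = this
  note r = rep_intros rep_mul rep_unt
    rep_box[of \<Psi> "[a, b]" "[b, a]"]
  show ?thesis unfolding Psi_bar_def Let_def ab by (rule rep_word, (rule r | simp)+)
qed

lemma wdl1_compatibility_iff:
  assumes \<Psi>: "prelaw A B \<Psi>" and ab: "mnd A = a" "mnd B = b" "mobj K B = k"
    and \<Psi>': "prelaw A' B' \<Psi>'" and ab': "mnd A' = a'" "mnd B' = b'" "mobj K B' = k'"
    and v: "tok v" "tsrc v = k" "ttrg v = k'" "V = tm v"
    and x: "rep (Leaf a' \<odot> v) (v \<odot> Leaf a) \<xi> x" and z: "rep (Leaf b' \<odot> v) (v \<odot> Leaf b) \<zeta> z"
  shows "(V \<lhd> Psi_bar K A B \<Psi>) \<cdot> \<a> V b a \<cdot> (\<zeta> \<rhd> a) \<cdot> \<a>\<^sup>- b' V a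
          \<cdot> (b' \<lhd> \<xi>) \<cdot> \<a> b' a' V \<cdot> (\<Psi>' \<rhd> V)
        = (V \<lhd> \<Psi>) \<cdot> \<a> V a b \<cdot> (\<xi> \<rhd> b) \<cdot> \<a>\<^sup>- a' V b \<cdot> (a' \<lhd> \<zeta>) \<cdot> \<a> a' b' V \<longleftrightarrow>
    \<langle>k, a' # b' # lv v\<rangle>
      (lv v, box [b, a] [b, a] (Psi_bar K A B \<Psi>), []) # whisk [] z [a] @ whisk [b'] x [] @ [([], box [a', b'] [b', a'] \<Psi>', lv v)]
      \<approx> (lv v, box [a, b] [b, a] \<Psi>, []) # whisk [] x [b] @ whisk [a'] z []"
proof -
  have p: "premonad A" "premonad B" and [simp]: "mobj K A = k" "\<Psi> \<in> hom2 K (a \<otimes> b) (b \<otimes> a)"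
    using \<Psi> by (auto simp: prelaw_def is_monad_iff ab)
  note [simp] = p premonad_simps[OF p(1), unfolded ab] premonad_simps[OF p(2), unfolded ab] ab
  have "Src K a = k" "Src K b = k" using Src_mnd[of A] Src_mnd[of B] by simp_all
  note [simp] = this
  have p': "premonad A'" "premonad B'" and [simp]: "mobj K A' = k'" "\<Psi>' \<in> hom2 K (a' \<otimes> b') (b' \<otimes> a')"
    using \<Psi>' by (auto simp: prelaw_def is_monad_iff ab')
  note [simp] = p' premonad_simps[OF p'(1), unfolded ab'] premonad_simps[OF p'(2), unfolded ab'] ab'
  have "Src K a' = k'" "Src K b' = k'" using Src_mnd[of A'] Src_mnd[of B'] by simp_all
  note [simp] = this
  have [simp]: "Psi_bar K A B \<Psi> \<in> hom2 K (b \<otimes> a) (b \<otimes> a)" using rep_Psi_bar[OF \<Psi> ab(1,2)] by (auto simp: rep_def)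
  note [simp] = v
  note r = rep_intros x z rep_box[of \<Psi> "[a, b]" "[b, a]"] rep_box[of \<Psi>' "[a', b']" "[b', a']"]
    rep_box[of "Psi_bar K A B \<Psi>" "[b, a]" "[b, a]"]
  show ?thesis
    by (rule diagram_eq_iff[of "(Leaf a' \<odot> Leaf b') \<odot> v" "v \<odot> Leaf b \<odot> Leaf a"];
        (rule rep_word)?, (rule r | simp)+)
qed

lemma monad_map_iff:
  assumes A: "premonad A" "mnd A = a" "mobj K A = k" and R: "premonad R" "mnd R = r" "mobj K R = k"
  shows "monad_map K A R \<alpha> \<longleftrightarrow> \<alpha> \<in> hom2 K a r \<and>
    \<langle>k, [a, a]\<rangle> [([], box [a] [r] \<alpha>, []), ([], mul A, [])]
      \<approx> [([], mul R, []), ([], box [a] [r] \<alpha>, [r]), ([a], box [a] [r] \<alpha>, [])] \<and>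
    \<langle>k, []\<rangle> [([], box [a] [r] \<alpha>, []), ([], unt A, [])] \<approx> [([], unt R, [])]"
proof (cases "\<alpha> \<in> hom2 K a r")
  case True
  note [simp] = A R True premonad_simps[OF A(1), unfolded A(2,3)] premonad_simps[OF R(1), unfolded R(2,3)]
  have "Src K a = k" "Src K r = k" using Src_mnd[of A] Src_mnd[of R] by simp_all
  note [simp] = this
  note r = rep_intros rep_mul rep_unt rep_box[of \<alpha> "[a]" "[r]"]
  have 1: "\<alpha> \<cdot> \<mu> A = \<mu> R \<cdot> (\<alpha> \<star> \<alpha>) \<longleftrightarrow>
    \<langle>k, [a, a]\<rangle> [([], box [a] [r] \<alpha>, []), ([], mul A, [])]
      \<approx> [([], mul R, []), ([], box [a] [r] \<alpha>, [r]), ([a], box [a] [r] \<alpha>, [])]"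
    by (rule diagram_eq_iff[of "Leaf a \<odot> Leaf a" "Leaf r"]; (rule rep_word)?, (rule r | simp)+)
  have 2: "\<alpha> \<cdot> \<eta> A = \<eta> R \<longleftrightarrow> \<langle>k, []\<rangle> [([], box [a] [r] \<alpha>, []), ([], unt A, [])] \<approx> [([], unt R, [])]"
    by (rule diagram_eq_iff[of "Unit k" "Leaf r"]; (rule rep_word)?, (rule r | simp)+)
  show ?thesis using True by (simp add: monad_map_def 1 2)
next
  case False
  thus ?thesis by (simp add: monad_map_def A R)
qed

text \<open>The typing conditions of a bilinear factorization structure.\<close>

definition prefact :: "('m, 'c) monad \<Rightarrow> ('m, 'c) monad \<Rightarrow> ('m, 'c) monad \<Rightarrow> 'c \<Rightarrow> 'c \<Rightarrow> 'c \<Rightarrow> bool"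
  where "prefact A B R \<alpha> \<beta> \<iota> \<longleftrightarrow> is_monad K A \<and> is_monad K B \<and> is_monad K R \<and>
    mobj K A = mobj K R \<and> mobj K B = mobj K R \<and>
    \<alpha> \<in> hom2 K (mnd A) (mnd R) \<and> \<beta> \<in> hom2 K (mnd B) (mnd R) \<and> \<iota> \<in> hom2 K (mnd R) (mnd B \<otimes> mnd A)"

lemma is_bfs_iff:
  assumes n: "mnd A = a" "mnd B = b" "mnd R = r" "mobj K R = k"
  shows "is_bfs K (BFS A B R \<alpha> \<beta> \<iota>) \<longleftrightarrow> prefact A B R \<alpha> \<beta> \<iota> \<and>
    \<langle>k, [a, a]\<rangle> [([], box [a] [r] \<alpha>, []), ([], mul A, [])]
      \<approx> [([], mul R, []), ([], box [a] [r] \<alpha>, [r]), ([a], box [a] [r] \<alpha>, [])] \<and>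
    \<langle>k, []\<rangle> [([], box [a] [r] \<alpha>, []), ([], unt A, [])] \<approx> [([], unt R, [])] \<and>
    \<langle>k, [b, b]\<rangle> [([], box [b] [r] \<beta>, []), ([], mul B, [])]
      \<approx> [([], mul R, []), ([], box [b] [r] \<beta>, [r]), ([b], box [b] [r] \<beta>, [])] \<and>
    \<langle>k, []\<rangle> [([], box [b] [r] \<beta>, []), ([], unt B, [])] \<approx> [([], unt R, [])] \<and>
    \<langle>k, [b, r]\<rangle> [([], box [r] [b, a] \<iota>, []), ([], mul R, []), ([], box [b] [r] \<beta>, [r])]
      \<approx> [([], mul B, [a]), ([b], box [r] [b, a] \<iota>, [])] \<and>
    \<langle>k, [r, a]\<rangle> [([], box [r] [b, a] \<iota>, []), ([], mul R, []), ([r], box [a] [r] \<alpha>, [])]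
      \<approx> [([b], mul A, []), ([], box [r] [b, a] \<iota>, [a])] \<and>
    \<langle>k, [r]\<rangle> [([], mul R, []), ([], box [b] [r] \<beta>, [r]), ([b], box [a] [r] \<alpha>, []), ([], box [r] [b, a] \<iota>, [])] \<approx> []"
proof (cases "prefact A B R \<alpha> \<beta> \<iota>")
  case True
  hence p: "premonad A" "premonad B" "premonad R" and [simp]: "mobj K A = k" "mobj K B = k"
      "\<alpha> \<in> hom2 K a r" "\<beta> \<in> hom2 K b r" "\<iota> \<in> hom2 K r (b \<otimes> a)"
    and m: "is_monad K A" "is_monad K B" "is_monad K R"
    by (auto simp: prefact_def is_monad_iff n)
  note [simp] = p n premonad_simps[OF p(1), unfolded n] premonad_simps[OF p(2), unfolded n] premonad_simps[OF p(3), unfolded n]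
  have "Src K a = k" "Src K b = k" "Src K r = k" using Src_mnd[of A] Src_mnd[of B] Src_mnd[of R] by simp_all
  note [simp] = this
  note r = rep_intros rep_mul rep_unt rep_box[of \<alpha> "[a]" "[r]"] rep_box[of \<beta> "[b]" "[r]"] rep_box[of \<iota> "[r]" "[b, a]"]
  have 1: "\<iota> \<cdot> (\<mu> R \<cdot> (\<beta> \<rhd> r)) = ((\<mu> B \<rhd> a) \<cdot> \<a>\<^sup>- b b a) \<cdot> (b \<lhd> \<iota>) \<longleftrightarrow>
    \<langle>k, [b, r]\<rangle> [([], box [r] [b, a] \<iota>, []), ([], mul R, []), ([], box [b] [r] \<beta>, [r])]
      \<approx> [([], mul B, [a]), ([b], box [r] [b, a] \<iota>, [])]"
    by (rule diagram_eq_iff[of "Leaf b \<odot> Leaf r" "Leaf b \<odot> Leaf a"]; (rule rep_word)?, (rule r | simp del: vassoc)+)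
  have 2: "\<iota> \<cdot> (\<mu> R \<cdot> (r \<lhd> \<alpha>)) = ((b \<lhd> \<mu> A) \<cdot> \<a> b a a) \<cdot> (\<iota> \<rhd> a) \<longleftrightarrow>
    \<langle>k, [r, a]\<rangle> [([], box [r] [b, a] \<iota>, []), ([], mul R, []), ([r], box [a] [r] \<alpha>, [])]
      \<approx> [([b], mul A, []), ([], box [r] [b, a] \<iota>, [a])]"
    by (rule diagram_eq_iff[of "Leaf r \<odot> Leaf a" "Leaf b \<odot> Leaf a"]; (rule rep_word)?, (rule r | simp del: vassoc)+)
  have 3: "(\<mu> R \<cdot> (\<beta> \<star> \<alpha>)) \<cdot> \<iota> = id2 K r \<longleftrightarrow>
    \<langle>k, [r]\<rangle> [([], mul R, []), ([], box [b] [r] \<beta>, [r]), ([b], box [a] [r] \<alpha>, []), ([], box [r] [b, a] \<iota>, [])] \<approx> []"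
    by (rule diagram_eq_iff[of "Leaf r" "Leaf r"]; (rule rep_word)?, (rule r | simp del: vassoc)+)
  show ?thesis using True m
    monad_map_iff[of A a k R r \<alpha>] monad_map_iff[of B b k R r \<beta>]
    by (simp add: is_bfs_def Let_def bimodule_morphism_def 1 2 3)
next
  case False
  thus ?thesis by (auto simp: is_bfs_def prefact_def Let_def monad_map_def bimodule_morphism_def)
qed

lemma rep_F0:
  assumes "prefact A B R \<alpha> \<beta> \<iota>" and n: "mnd A = a" "mnd B = b" "mnd R = r"
  shows "rep (Leaf a \<odot> Leaf b) (Leaf b \<odot> Leaf a) (\<iota> \<cdot> \<mu> R \<cdot> (\<alpha> \<star> \<beta>))
    [([], box [r] [b, a] \<iota>, []), ([], mul R, []), ([], box [a] [r] \<alpha>, [r]), ([a], box [b] [r] \<beta>, [])]"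
proof -
  have p: "premonad A" "premonad B" "premonad R" and [simp]: "mobj K A = mobj K R" "mobj K B = mobj K R"
      "\<alpha> \<in> hom2 K a r" "\<beta> \<in> hom2 K b r" "\<iota> \<in> hom2 K r (b \<otimes> a)"
    using assms(1) by (auto simp: prefact_def is_monad_iff n)
  note [simp] = p n premonad_simps[OF p(1), unfolded n] premonad_simps[OF p(2), unfolded n] premonad_simps[OF p(3), unfolded n]
  have "Src K a = mobj K R" "Src K b = mobj K R" "Src K r = mobj K R" using Src_mnd[of A] Src_mnd[of B] Src_mnd[of R] by simp_all
  note [simp] = this
  note r = rep_intros rep_mul rep_unt rep_box[of \<alpha> "[a]" "[r]"] rep_box[of \<beta> "[b]" "[r]"] rep_box[of \<iota> "[r]" "[b, a]"]
  show ?thesis by (rule rep_word, (rule r | simp del: vassoc)+)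
qed

lemma intertwine_iff:
  assumes "\<alpha> \<in> hom2 K a r" "\<alpha>' \<in> hom2 K a' r'"
    and "a \<in> hom1 K k k" "r \<in> hom1 K k k" "a' \<in> hom1 K k' k'" "r' \<in> hom1 K k' k'"
    and v: "tok v" "tsrc v = k" "ttrg v = k'" "V = tm v"
    and x: "rep (Leaf a' \<odot> v) (v \<odot> Leaf a) \<xi> x" and y: "rep (Leaf r' \<odot> v) (v \<odot> Leaf r) \<rho> y"
  shows "\<rho> \<cdot> (\<alpha>' \<rhd> V) = (V \<lhd> \<alpha>) \<cdot> \<xi> \<longleftrightarrow>
    \<langle>k, a' # lv v\<rangle> y @ [([], box [a'] [r'] \<alpha>', lv v)] \<approx> (lv v, box [a] [r] \<alpha>, []) # x"
proof -
  have [simp]: "a \<in> Mor K" "r \<in> Mor K" "a' \<in> Mor K" "r' \<in> Mor K" "Src K a = k" "Src K r = k" "Src K a' = k'" "Src K r' = k'"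
    "Trg K a = k" "Trg K r = k" "Trg K a' = k'" "Trg K r' = k'"
    using assms(3-6) by (auto simp: hom1_def)
  note [simp] = assms(1,2) v
  note r = rep_intros x y rep_box[of \<alpha> "[a]" "[r]"] rep_box[of \<alpha>' "[a']" "[r']"]
  show ?thesis
    by (rule diagram_eq_iff[of "Leaf a' \<odot> v" "v \<odot> Leaf r"]; (rule rep_word)?, (rule r | simp del: vassoc)+)
qed

end

section \<open>Rewriting of diagrams\<close>

lemma slide_numeral [simp]: "slide (numeral n) (l # w) = l # slide (pred_numeral n) w"
  by (simp add: numeral_eq_Suc)

text \<open>The 1-cells to the left (and in the next definition to the right) of an occurrence of \<open>u\<close> that begins at
  layer \<open>i\<close>, found by comparing this layer with the first layer of \<open>u\<close>.\<close>

definition left_ctx :: "nat \<Rightarrow> ('o, 'm, 'c) diagram \<Rightarrow> ('o, 'm, 'c) diagram \<Rightarrow> 'm list"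
  where [simp]: "left_ctx i u w = take (length (fst (w ! i)) - length (fst (hd u))) (fst (w ! i))"

definition right_ctx :: "nat \<Rightarrow> ('o, 'm, 'c) diagram \<Rightarrow> ('o, 'm, 'c) diagram \<Rightarrow> 'm list"
  where [simp]: "right_ctx i u w = drop (length (snd (snd (hd u)))) (snd (snd (w ! i)))"

definition replace :: "nat \<Rightarrow> 'm list \<Rightarrow> ('o, 'm, 'c) diagram \<Rightarrow> ('o, 'm, 'c) diagram \<Rightarrow> 'm list
    \<Rightarrow> ('o, 'm, 'c) diagram \<Rightarrow> ('o, 'm, 'c) diagram"
  where [simp]: "replace i L u v R w = take i w @ whisk L v R @ drop (i + length u) w"

context bicategory
begin

text \<open>After the interchanges \<open>js\<close>, the rule replaces \<open>u\<close>, which begins at layer \<open>i\<close> between \<open>L\<close> and \<open>R\<close>. For a nonempty \<open>u\<close>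
  the lists \<open>L\<close> and \<open>R\<close> can be read off from the diagram, see \<open>step\<close>.\<close>

lemma step_at:
  fixes L R :: "'m list"
  assumes "\<langle>k', P'\<rangle> u \<approx> v" "wt k P w"
    and "replace i L u u R (slides js w) = slides js w" "replace i L u v R (slides js w) = w'"
    and "ptrg k R = k'" "tgt P (drop (i + length u) (slides js w)) = L @ P' @ R"
  shows "\<langle>k, P\<rangle> w \<approx> w'"
  by (rule rewrite[OF assms(1,2), where js = js and x = "take i (slides js w)" and y = "drop (i + length u) (slides js w)"])
    (use assms(3-6) in simp_all)

lemma step:
  assumes "\<langle>k', P'\<rangle> u \<approx> v" "wt k P w"
    and "replace i (left_ctx i u (slides js w)) u u (right_ctx i u (slides js w)) (slides js w) = slides js w"
    and "replace i (left_ctx i u (slides js w)) u v (right_ctx i u (slides js w)) (slides js w) = w'"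
    and "ptrg k (right_ctx i u (slides js w)) = k'"
    and "tgt P (drop (i + length u) (slides js w))
      = left_ctx i u (slides js w) @ P' @ right_ctx i u (slides js w)"
  shows "\<langle>k, P\<rangle> w \<approx> w'"
  using assms by (rule step_at)

lemmas plain_step = step[where js = "[]"]

lemma slide_step: "wt k P w \<Longrightarrow> slides js w = w' \<Longrightarrow> \<langle>k, P\<rangle> w \<approx> w'"
  using eqd_slides by blast

definition gentype :: "'o \<Rightarrow> 'm list \<Rightarrow> 'm list \<Rightarrow> ('o, 'm, 'c) gen \<Rightarrow> bool"
  where "gentype k P Q g \<longleftrightarrow> okg g \<and> gsrc g = k \<and> gdom g = P \<and> gcod g = Q"

lemma gentypeD:
  assumes "gentype k P Q g"
  shows "okg g" "gsrc g = k" "gdom g = P" "gcod g = Q"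
  using assms by (auto simp: gentype_def)

lemma hom1D:
  assumes "M \<in> hom1 K a b"
  shows "M \<in> Mor K" "Src K M = a" "Trg K M = b"
  using assms by (auto simp: hom1_def)

end

section \<open>Diagrammatic algebra of weak distributive laws\<close>

text \<open>The axioms of the structures are collected in locales whose parameters are boxes. This keeps the letters of
  the diagrams short and lets primed copies of a structure share its lemmas.\<close>

locale monad_diagrams = bicategory K for K :: "('o, 'm, 'c) bicat" (structure) +
  fixes k :: 'o and a :: 'm and m e :: "('o, 'm, 'c) gen"
  assumes k: "k \<in> Ob K" and a: "a \<in> hom1 K k k"
    and m: "gentype k [a, a] [a] m" and e: "gentype k [] [a] e"
    and assoc: "\<langle>k, [a, a, a]\<rangle> [([], m, []), ([], m, [a])] \<approx> [([], m, []), ([a], m, [])]"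
    and unitl: "\<langle>k, [a]\<rangle> [([], m, []), ([], e, [a])] \<approx> []"
    and unitr: "\<langle>k, [a]\<rangle> [([], m, []), ([a], e, [])] \<approx> []"
begin

lemmas types [simp] = k hom1D[OF a] gentypeD[OF m] gentypeD[OF e]

end

locale monad_morphism_diagrams =
  bicategory K +
  S: monad_diagrams K k a m e + T: monad_diagrams K k' a' m' e'
  for K :: "('o, 'm, 'c) bicat" (structure) and k a m e k' a' m' e' +
  fixes V :: 'm and x :: "('o, 'm, 'c) gen"
  assumes V: "V \<in> hom1 K k k'" and x: "gentype k [a', V] [V, a] x"
    and mul: "\<langle>k, [a', a', V]\<rangle> [([], x, []), ([], m', [V])] \<approx> [([V], m, []), ([], x, [a]), ([a'], x, [])]"
    and unt: "\<langle>k, [V]\<rangle> [([], x, []), ([], e', [V])] \<approx> [([V], e, [])]"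
begin

lemmas types [simp] = hom1D[OF V] gentypeD[OF x]

end

locale monad_morphism_composite =
  bicategory K +
  M: monad_morphism_diagrams K k a m e k' a' m' e' V x +
  N: monad_morphism_diagrams K k' a' m' e' k'' a'' m'' e'' V' x'
  for K :: "('o, 'm, 'c) bicat" (structure) and k a m e k' a' m' e' V x k'' a'' m'' e'' V' x'
begin

lemma comp_mul:
  "\<langle>k, [a'', a'', V', V]\<rangle> [([V'], x, []), ([], x', [V]), ([], m'', [V', V])]
    \<approx> [([V', V], m, []), ([V'], x, [a]), ([], x', [V, a]), ([a'', V'], x, []), ([a''], x', [V])]" (is "eqd _ _ ?x ?y")
proof -
  let ?E = "eqd k [a'', a'', V', V]"
  have "?E ?x
      [([V'], x, []), ([V'], m', [V]), ([], x', [a', V]), ([a''], x', [V])]"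
    by (rule plain_step[where i = 1, OF N.mul]) simp_all
  also have "?E \<dots>
      [([V', V], m, []), ([V'], x, [a]), ([V', a'], x, []), ([], x', [a', V]), ([a''], x', [V])]"
    by (rule plain_step[where i = 0, OF M.mul]) simp_all
  also have "?E \<dots> ?y"
    by (rule slide_step[where js = "[2]"]) simp_all
  finally show ?thesis .
qed

lemma comp_unt:
  "\<langle>k, [V', V]\<rangle> [([V'], x, []), ([], x', [V]), ([], e'', [V', V])]
    \<approx> [([V', V], e, [])]" (is "eqd _ _ ?x ?y")
proof -
  let ?E = "eqd k [V', V]"
  have "?E ?x
      [([V'], x, []), ([V'], e', [V])]"
    by (rule plain_step[where i = 1, OF N.unt]) simp_all
  also have "?E \<dots> ?y"
    by (rule plain_step[where i = 0, OF M.unt]) simp_all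
  finally show ?thesis .
qed

end

text \<open>The box \<open>pb\<close> is the idempotent \<open>\<Psi>bar\<close> attached to the law \<open>psi\<close>.\<close>

locale law_diagrams =
  bicategory K +
  A: monad_diagrams K k a mA eA + B: monad_diagrams K k b mB eB
  for K :: "('o, 'm, 'c) bicat" (structure) and k a mA eA b mB eB +
  fixes psi pb :: "('o, 'm, 'c) gen"
  assumes psi: "gentype k [a, b] [b, a] psi" and pb: "gentype k [b, a] [b, a] pb"
    and psi_mA: "\<langle>k, [a, a, b]\<rangle> [([], psi, []), ([], mA, [b])] \<approx> [([b], mA, []), ([], psi, [a]), ([a], psi, [])]"
    and psi_mB: "\<langle>k, [a, b, b]\<rangle> [([], psi, []), ([a], mB, [])] \<approx> [([], mB, [a]), ([b], psi, []), ([], psi, [b])]"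
    and psi_unit: "\<langle>k, [b, a]\<rangle> [([], mB, [a]), ([b], psi, []), ([b, a], eB, [])]
      \<approx> [([b], mA, []), ([], psi, [a]), ([], eA, [b, a])]"
    and pb_def: "\<langle>k, [b, a]\<rangle> [([], pb, [])]
      \<approx> [([], mB, [a]), ([b, b], mA, []), ([b], psi, [a]), ([b], eA, [b, a]), ([b], eB, [a])]"
begin

lemmas types [simp] = gentypeD[OF psi] gentypeD[OF pb]

text \<open>The third axiom trades the part with \<open>\<eta>\<^sub>A\<close> and \<open>\<mu>\<^sub>A\<close> for one with \<open>\<eta>\<^sub>B\<close> and \<open>\<mu>\<^sub>B\<close>, and the inner unit of \<open>B\<close> cancels.\<close>

lemma pb_left:
  "\<langle>k, [b, a]\<rangle> [([], pb, [])]
    \<approx> [([], mB, [a]), ([b], psi, []), ([b, a], eB, [])]" (is "eqd _ _ ?x ?y")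
proof -
  let ?E = "eqd k [b, a]"
  have "?E ?x
      [([], mB, [a]), ([b, b], mA, []), ([b], psi, [a]), ([b], eA, [b, a]), ([b], eB, [a])]"
    by (rule plain_step[where i = 0, OF pb_def]) simp_all
  also have "?E \<dots>
      [([], mB, [a]), ([b], mB, [a]), ([b, b], psi, []), ([b, b, a], eB, []), ([b], eB, [a])]"
    by (rule plain_step[where i = 1, OF psi_unit[symmetric]]) simp_all
  also have "?E \<dots> ?y"
    by (rule step[where i = 1 and js = "[3, 2]", OF B.unitl]) simp_all
  finally show ?thesis .
qed

lemma pb_right:
  "\<langle>k, [b, a]\<rangle> [([], pb, [])]
    \<approx> [([b], mA, []), ([], psi, [a]), ([], eA, [b, a])]" (is "eqd _ _ ?x ?y")
proof -
  let ?E = "eqd k [b, a]"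
  have "?E ?x
      [([], mB, [a]), ([b], psi, []), ([b, a], eB, [])]"
    by (rule plain_step[where i = 0, OF pb_left]) simp_all
  also have "?E \<dots> ?y"
    by (rule plain_step[where i = 0, OF psi_unit]) simp_all
  finally show ?thesis .
qed

text \<open>In the form \<open>pb_left\<close> the idempotent is visibly left \<open>B\<close>-linear, in the form \<open>pb_right\<close> right \<open>A\<close>-linear.\<close>

lemma pb_mB:
  "\<langle>k, [b, b, a]\<rangle> [([], pb, []), ([], mB, [a])]
    \<approx> [([], mB, [a]), ([b], pb, [])]" (is "eqd _ _ ?x ?y")
proof -
  let ?E = "eqd k [b, b, a]"
  have "?E ?x
      [([], mB, [a]), ([b], psi, []), ([b, a], eB, []), ([], mB, [a])]"
    by (rule plain_step[where i = 0, OF pb_left]) simp_all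
  also have "?E \<dots>
      [([], mB, [a]), ([b], mB, [a]), ([b, b], psi, []), ([b, b, a], eB, [])]"
    by (rule step[where i = 0 and js = "[2, 1]", OF B.assoc]) simp_all
  also have "?E \<dots> ?y"
    by (rule plain_step[where i = 1, OF pb_left[symmetric]]) simp_all
  finally show ?thesis .
qed

lemma pb_mA:
  "\<langle>k, [b, a, a]\<rangle> [([], pb, []), ([b], mA, [])]
    \<approx> [([b], mA, []), ([], pb, [a])]" (is "eqd _ _ ?x ?y")
proof -
  let ?E = "eqd k [b, a, a]"
  have "?E ?x
      [([b], mA, []), ([], psi, [a]), ([], eA, [b, a]), ([b], mA, [])]"
    by (rule plain_step[where i = 0, OF pb_right]) simp_all
  also have "?E \<dots>
      [([b], mA, []), ([b], mA, [a]), ([], psi, [a, a]), ([], eA, [b, a, a])]"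
    by (rule step[where i = 0 and js = "[2, 1]", OF A.assoc[symmetric]]) simp_all
  also have "?E \<dots> ?y"
    by (rule plain_step[where i = 1, OF pb_right[symmetric]]) simp_all
  finally show ?thesis .
qed

text \<open>By multiplicativity in \<open>A\<close>, the two copies of \<open>\<Psi>\<close> merge into one copy whose first input is multiplied by \<open>\<eta>\<^sub>A\<close>.\<close>

lemma pb_psi:
  "\<langle>k, [a, b]\<rangle> [([], pb, []), ([], psi, [])]
    \<approx> [([], psi, [])]" (is "eqd _ _ ?x ?y")
proof -
  let ?E = "eqd k [a, b]"
  have "?E ?x
      [([b], mA, []), ([], psi, [a]), ([], eA, [b, a]), ([], psi, [])]"
    by (rule plain_step[where i = 0, OF pb_right]) simp_all
  also have "?E \<dots>
      [([], psi, []), ([], mA, [b]), ([], eA, [a, b])]"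
    by (rule step[where i = 0 and js = "[2]", OF psi_mA[symmetric]]) simp_all
  also have "?E \<dots> ?y"
    by (rule plain_step[where i = 1, OF A.unitl]) simp_all
  finally show ?thesis .
qed

lemma pb_pb:
  "\<langle>k, [b, a]\<rangle> [([], pb, []), ([], pb, [])]
    \<approx> [([], pb, [])]" (is "eqd _ _ ?x ?y")
proof -
  let ?E = "eqd k [b, a]"
  have "?E ?x
      [([], pb, []), ([b], mA, []), ([], psi, [a]), ([], eA, [b, a])]"
    by (rule plain_step[where i = 1, OF pb_right]) simp_all
  also have "?E \<dots>
      [([b], mA, []), ([], pb, [a]), ([], psi, [a]), ([], eA, [b, a])]"
    by (rule plain_step[where i = 0, OF pb_mA]) simp_all
  also have "?E \<dots>
      [([b], mA, []), ([], psi, [a]), ([], eA, [b, a])]"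
    by (rule plain_step[where i = 1, OF pb_psi]) simp_all
  also have "?E \<dots> ?y"
    by (rule plain_step[where i = 0, OF pb_right[symmetric]]) simp_all
  finally show ?thesis .
qed

end

locale law_morphism_diagrams =
  bicategory K +
  S: law_diagrams K k a mA eA b mB eB psi pb + T: law_diagrams K k' a' mA' eA' b' mB' eB' psi' pb' +
  X: monad_morphism_diagrams K k a mA eA k' a' mA' eA' V xi +
  Z: monad_morphism_diagrams K k b mB eB k' b' mB' eB' V ze
  for K :: "('o, 'm, 'c) bicat" (structure) and k a mA eA b mB eB psi pb k' a' mA' eA' b' mB' eB' psi' pb' V xi ze +
  assumes compat: "\<langle>k, [a', b', V]\<rangle> [([V], pb, []), ([], ze, [a]), ([b'], xi, []), ([], psi', [V])]
    \<approx> [([V], psi, []), ([], xi, [b]), ([a'], ze, [])]"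
begin

text \<open>The key identity \<open>(V \<otimes> \<Psi>bar) \<theta> (\<Psi>'bar \<otimes> V) = (V \<otimes> \<Psi>bar) \<theta>\<close>. Write \<open>\<Psi>'bar\<close> with \<open>\<Psi>'\<close> and the unit of \<open>A'\<close>. The two inputs from \<open>A'\<close> are
  multiplied after passing \<open>V\<close>, and by right \<open>A\<close>-linearity \<open>\<Psi>bar\<close> meets \<open>\<theta>\<close> and \<open>\<Psi>'\<close>, where the compatibility condition
  applies. The unit of \<open>A'\<close> then becomes the unit of \<open>A\<close>, and \<open>\<Psi>bar\<close> reappears.\<close>

lemma absorb:
  "\<langle>k, [b', a', V]\<rangle> [([V], pb, []), ([], ze, [a]), ([b'], xi, []), ([], pb', [V])]
    \<approx> [([V], pb, []), ([], ze, [a]), ([b'], xi, [])]" (is "eqd _ _ ?x ?y")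
proof -
  let ?E = "eqd k [b', a', V]"
  have "?E ?x
      [([V], pb, []), ([], ze, [a]), ([b'], xi, []), ([b'], mA', [V]), ([], psi', [a', V]), ([], eA', [b', a', V])]"
    by (rule plain_step[where i = 3, OF T.pb_right]) simp_all
  also have "?E \<dots>
      [([V], pb, []), ([], ze, [a]), ([b', V], mA, []), ([b'], xi, [a]), ([b', a'], xi, []), ([], psi', [a', V]), ([], eA', [b', a', V])]"
    by (rule plain_step[where i = 2, OF X.mul]) simp_all
  also have "?E \<dots>
      [([V, b], mA, []), ([V], pb, [a]), ([], ze, [a, a]), ([b'], xi, [a]), ([], psi', [V, a]), ([], eA', [b', V, a]), ([b'], xi, [])]"
    by (rule step[where i = 0 and js = "[1, 4, 5]", OF S.pb_mA]) simp_all
  also have "?E \<dots>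
      [([V, b], mA, []), ([V], psi, [a]), ([], xi, [b, a]), ([a'], ze, [a]), ([], eA', [b', V, a]), ([b'], xi, [])]"
    by (rule plain_step[where i = 1, OF compat]) simp_all
  also have "?E \<dots>
      [([V, b], mA, []), ([V], psi, [a]), ([V], eA, [b, a]), ([], ze, [a]), ([b'], xi, [])]"
    by (rule step[where i = 2 and js = "[3]", OF X.unt]) simp_all
  also have "?E \<dots> ?y"
    by (rule plain_step[where i = 0, OF S.pb_right[symmetric]]) simp_all
  finally show ?thesis .
qed

end

locale law_morphism_composite =
  bicategory K +
  M: law_morphism_diagrams K k a mA eA b mB eB psi pb k' a' mA' eA' b' mB' eB' psi' pb' V xi ze +
  N: law_morphism_diagrams K k' a' mA' eA' b' mB' eB' psi' pb' k'' a'' mA'' eA'' b'' mB'' eB'' psi'' pb'' V' xi' ze'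
  for K :: "('o, 'm, 'c) bicat" (structure) and k a mA eA b mB eB psi pb k' a' mA' eA' b' mB' eB' psi' pb' V xi ze
    k'' a'' mA'' eA'' b'' mB'' eB'' psi'' pb'' V' xi' ze'
begin

text \<open>In the composite, \<open>\<Psi>'bar\<close> may be inserted between the two copies of \<open>\<theta>\<close> by \<open>absorb\<close>, and then both compatibility
  conditions apply one after the other.\<close>

lemma comp_compat:
  "\<langle>k, [a'', b'', V', V]\<rangle> [([V', V], pb, []), ([V'], ze, [a]), ([], ze', [V, a]), ([b'', V'], xi, []), ([b''], xi', [V]), ([], psi'', [V', V])]
    \<approx> [([V', V], psi, []), ([V'], xi, [b]), ([], xi', [V, b]), ([a'', V'], ze, []), ([a''], ze', [V])]" (is "eqd _ _ ?x ?y")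
proof -
  let ?E = "eqd k [a'', b'', V', V]"
  have "?E ?x
      [([V', V], pb, []), ([V'], ze, [a]), ([V', b'], xi, []), ([V'], pb', [V]), ([], ze', [a', V]), ([b''], xi', [V]), ([], psi'', [V', V])]"
    by (rule step[where i = 0 and js = "[2]", OF M.absorb[symmetric]]) simp_all
  also have "?E \<dots>
      [([V', V], pb, []), ([V'], ze, [a]), ([V', b'], xi, []), ([V'], psi', [V]), ([], xi', [b', V]), ([a''], ze', [V])]"
    by (rule plain_step[where i = 3, OF N.compat]) simp_all
  also have "?E \<dots>
      [([V', V], psi, []), ([V'], xi, [b]), ([V', a'], ze, []), ([], xi', [b', V]), ([a''], ze', [V])]"
    by (rule plain_step[where i = 0, OF M.compat]) simp_all
  also have "?E \<dots> ?y"
    by (rule slide_step[where js = "[2]"]) simp_all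
  finally show ?thesis .
qed

end

locale transformation_hcomp =
  bicategory K for K :: "('o, 'm, 'c) bicat" (structure) +
  fixes k k' k'' a a' a'' V U V' U' xi ups xi' ups' om om'
  assumes 1: "a \<in> hom1 K k k" "a' \<in> hom1 K k' k'" "a'' \<in> hom1 K k'' k''"
    "V \<in> hom1 K k k'" "U \<in> hom1 K k k'" "V' \<in> hom1 K k' k''" "U' \<in> hom1 K k' k''"
    and 2: "gentype k [a', V] [V, a] xi" "gentype k [a', U] [U, a] ups"
    "gentype k' [a'', V'] [V', a'] xi'" "gentype k' [a'', U'] [U', a'] ups'"
    "gentype k [V] [U] om" "gentype k' [V'] [U'] om'"
    and tr: "\<langle>k, [a', V]\<rangle> [([], ups, []), ([a'], om, [])] \<approx> [([], om, [a]), ([], xi, [])]"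
    and tr': "\<langle>k', [a'', V']\<rangle> [([], ups', []), ([a''], om', [])] \<approx> [([], om', [a']), ([], xi', [])]"
begin

lemmas types [simp] = 1[THEN hom1D(1)] 1[THEN hom1D(2)] 1[THEN hom1D(3)]
  2[THEN gentypeD(1)] 2[THEN gentypeD(2)] 2[THEN gentypeD(3)] 2[THEN gentypeD(4)]

lemma objects [simp]: "k \<in> Ob K" "k' \<in> Ob K" "k'' \<in> Ob K"
  using Src_Ob[of a] Src_Ob[of a'] Src_Ob[of a''] by simp_all

lemma tr_hcomp:
  "\<langle>k, [a'', V', V]\<rangle> [([U'], ups, []), ([], ups', [U]), ([a''], om', [U]), ([a'', V'], om, [])]
    \<approx> [([], om', [U, a]), ([V'], om, [a]), ([V'], xi, []), ([], xi', [V])]" (is "eqd _ _ ?x ?y")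
proof -
  let ?E = "eqd k [a'', V', V]"
  have "?E ?x
      [([U'], ups, []), ([], om', [a', U]), ([], xi', [U]), ([a'', V'], om, [])]"
    by (rule plain_step[where i = 1, OF tr']) simp_all
  also have "?E \<dots> ?y"
    by (rule step[where i = 1 and js = "[0, 2]", OF tr]) simp_all
  finally show ?thesis .
qed

end

locale intertwiner_composite =
  bicategory K for K :: "('o, 'm, 'c) bicat" (structure) +
  fixes k k' k'' a a' a'' r r' r'' V V' xi rho xi' rho' al al' al''
  assumes 1: "a \<in> hom1 K k k" "a' \<in> hom1 K k' k'" "a'' \<in> hom1 K k'' k''"
    "r \<in> hom1 K k k" "r' \<in> hom1 K k' k'" "r'' \<in> hom1 K k'' k''"
    "V \<in> hom1 K k k'" "V' \<in> hom1 K k' k''"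
    and 2: "gentype k [a', V] [V, a] xi" "gentype k' [a'', V'] [V', a'] xi'"
    "gentype k [r', V] [V, r] rho" "gentype k' [r'', V'] [V', r'] rho'"
    "gentype k [a] [r] al" "gentype k' [a'] [r'] al'" "gentype k'' [a''] [r''] al''"
    and int: "\<langle>k, [a', V]\<rangle> [([], rho, []), ([], al', [V])] \<approx> [([V], al, []), ([], xi, [])]"
    and int': "\<langle>k', [a'', V']\<rangle> [([], rho', []), ([], al'', [V'])] \<approx> [([V'], al', []), ([], xi', [])]"
begin

lemmas types [simp] = 1[THEN hom1D(1)] 1[THEN hom1D(2)] 1[THEN hom1D(3)]
  2[THEN gentypeD(1)] 2[THEN gentypeD(2)] 2[THEN gentypeD(3)] 2[THEN gentypeD(4)]

lemma objects [simp]: "k \<in> Ob K" "k' \<in> Ob K" "k'' \<in> Ob K"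
  using Src_Ob[of a] Src_Ob[of a'] Src_Ob[of a''] by simp_all

lemma int_comp:
  "\<langle>k, [a'', V', V]\<rangle> [([V'], rho, []), ([], rho', [V]), ([], al'', [V', V])]
    \<approx> [([V', V], al, []), ([V'], xi, []), ([], xi', [V])]" (is "eqd _ _ ?x ?y")
proof -
  let ?E = "eqd k [a'', V', V]"
  have "?E ?x
      [([V'], rho, []), ([V'], al', [V]), ([], xi', [V])]"
    by (rule plain_step[where i = 1, OF int']) simp_all
  also have "?E \<dots> ?y"
    by (rule plain_step[where i = 0, OF int]) simp_all
  finally show ?thesis .
qed

end

section \<open>Diagrammatic algebra of bilinear factorizations\<close>

text \<open>The boxes \<open>mR\<close>, \<open>be\<close>, \<open>al\<close> composed as \<open>mR ; be ; al\<close> form \<open>\<pi>\<close>. The box \<open>psi\<close> stands for \<open>\<iota> \<mu>\<^sub>R (\<alpha> \<otimes> \<beta>)\<close>.\<close>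

locale factorization_diagrams =
  bicategory K +
  A: monad_diagrams K k a mA eA + B: monad_diagrams K k b mB eB + R: monad_diagrams K k r mR eR
  for K :: "('o, 'm, 'c) bicat" (structure) and k a mA eA b mB eB r mR eR +
  fixes al be io psi :: "('o, 'm, 'c) gen"
  assumes al: "gentype k [a] [r] al" and be: "gentype k [b] [r] be" and io: "gentype k [r] [b, a] io"
    and psi: "gentype k [a, b] [b, a] psi"
    and al_mul: "\<langle>k, [a, a]\<rangle> [([], al, []), ([], mA, [])] \<approx> [([], mR, []), ([], al, [r]), ([a], al, [])]"
    and al_unt: "\<langle>k, []\<rangle> [([], al, []), ([], eA, [])] \<approx> [([], eR, [])]"
    and be_mul: "\<langle>k, [b, b]\<rangle> [([], be, []), ([], mB, [])] \<approx> [([], mR, []), ([], be, [r]), ([b], be, [])]"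
    and be_unt: "\<langle>k, []\<rangle> [([], be, []), ([], eB, [])] \<approx> [([], eR, [])]"
    and io_left: "\<langle>k, [b, r]\<rangle> [([], io, []), ([], mR, []), ([], be, [r])] \<approx> [([], mB, [a]), ([b], io, [])]"
    and io_right: "\<langle>k, [r, a]\<rangle> [([], io, []), ([], mR, []), ([r], al, [])] \<approx> [([b], mA, []), ([], io, [a])]"
    and pi_io: "\<langle>k, [r]\<rangle> [([], mR, []), ([], be, [r]), ([b], al, []), ([], io, [])] \<approx> []"
    and psi_def: "\<langle>k, [a, b]\<rangle> [([], psi, [])] \<approx> [([], io, []), ([], mR, []), ([], al, [r]), ([a], be, [])]"
begin

lemmas types [simp] = gentypeD[OF al] gentypeD[OF be] gentypeD[OF io] gentypeD[OF psi]

lemma pi_psi: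
  "\<langle>k, [a, b]\<rangle> [([], mR, []), ([], be, [r]), ([b], al, []), ([], psi, [])]
    \<approx> [([], mR, []), ([], al, [r]), ([a], be, [])]" (is "eqd _ _ ?x ?y")
proof -
  let ?E = "eqd k [a, b]"
  have "?E ?x
      [([], mR, []), ([], be, [r]), ([b], al, []), ([], io, []), ([], mR, []), ([], al, [r]), ([a], be, [])]"
    by (rule plain_step[where i = 3, OF psi_def]) simp_all
  also have "?E \<dots> ?y"
    by (rule plain_step[where i = 0, OF pi_io]) simp_all
  finally show ?thesis .
qed

text \<open>Since \<open>\<pi> \<Psi> = \<mu>\<^sub>R (\<alpha> \<otimes> \<beta>)\<close>, two copies of \<open>\<Psi>\<close> multiply in \<open>R\<close>; the outer \<open>\<iota>\<close> is right \<open>A\<close>-linear. The other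
  multiplicativity law is the mirror image.\<close>

lemma psi_mA:
  "\<langle>k, [a, a, b]\<rangle> [([], psi, []), ([], mA, [b])]
    \<approx> [([b], mA, []), ([], psi, [a]), ([a], psi, [])]" (is "eqd _ _ ?x ?y")
proof -
  let ?E = "eqd k [a, a, b]"
  have "?E ?x
      [([], io, []), ([], mR, []), ([], al, [r]), ([a], be, []), ([], mA, [b])]"
    by (rule plain_step[where i = 0, OF psi_def]) simp_all
  also have "?E \<dots>
      [([], io, []), ([], mR, []), ([], mR, [r]), ([], al, [r, r]), ([a], al, [r]), ([a, a], be, [])]"
    by (rule step[where i = 2 and js = "[3]", OF al_mul]) simp_all
  also have "?E \<dots>
      [([], io, []), ([], mR, []), ([r], mR, []), ([], al, [r, r]), ([a], al, [r]), ([a, a], be, [])]"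
    by (rule plain_step[where i = 1, OF R.assoc]) simp_all
  also have "?E \<dots>
      [([], io, []), ([], mR, []), ([], al, [r]), ([a], mR, []), ([a], be, [r]), ([a, b], al, []), ([a], psi, [])]"
    by (rule step[where i = 3 and js = "[2]", OF pi_psi[symmetric]]) simp_all
  also have "?E \<dots>
      [([], io, []), ([], mR, []), ([], mR, [r]), ([], al, [r, r]), ([a], be, [r]), ([a, b], al, []), ([a], psi, [])]"
    by (rule step[where i = 1 and js = "[2]", OF R.assoc[symmetric]]) simp_all
  also have "?E \<dots>
      [([b], mA, []), ([], io, [a]), ([], mR, [a]), ([], al, [r, a]), ([a], be, [a]), ([a], psi, [])]"
    by (rule step[where i = 0 and js = "[4, 3, 2]", OF io_right]) simp_all
  also have "?E \<dots> ?y"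
    by (rule plain_step[where i = 1, OF psi_def[symmetric]]) simp_all
  finally show ?thesis .
qed

lemma psi_mB:
  "\<langle>k, [a, b, b]\<rangle> [([], psi, []), ([a], mB, [])]
    \<approx> [([], mB, [a]), ([b], psi, []), ([], psi, [b])]" (is "eqd _ _ ?x ?y")
proof -
  let ?E = "eqd k [a, b, b]"
  have "?E ?x
      [([], io, []), ([], mR, []), ([], al, [r]), ([a], be, []), ([a], mB, [])]"
    by (rule plain_step[where i = 0, OF psi_def]) simp_all
  also have "?E \<dots>
      [([], io, []), ([], mR, []), ([], al, [r]), ([a], mR, []), ([a], be, [r]), ([a, b], be, [])]"
    by (rule plain_step[where i = 3, OF be_mul]) simp_all
  also have "?E \<dots>
      [([], io, []), ([], mR, []), ([], mR, [r]), ([], al, [r, r]), ([a], be, [r]), ([a, b], be, [])]"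
    by (rule step[where i = 1 and js = "[2]", OF R.assoc[symmetric]]) simp_all
  also have "?E \<dots>
      [([], io, []), ([], mR, []), ([], mR, [r]), ([], be, [r, r]), ([b], al, [r]), ([], psi, [r]), ([a, b], be, [])]"
    by (rule plain_step[where i = 2, OF pi_psi[symmetric]]) simp_all
  also have "?E \<dots>
      [([], io, []), ([], mR, []), ([r], mR, []), ([], be, [r, r]), ([b], al, [r]), ([], psi, [r]), ([a, b], be, [])]"
    by (rule plain_step[where i = 1, OF R.assoc]) simp_all
  also have "?E \<dots>
      [([], mB, [a]), ([b], io, []), ([b], mR, []), ([b], al, [r]), ([], psi, [r]), ([a, b], be, [])]"
    by (rule step[where i = 0 and js = "[2]", OF io_left]) simp_all
  also have "?E \<dots> ?y"
    by (rule step[where i = 1 and js = "[4]", OF psi_def[symmetric]]) simp_all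
  finally show ?thesis .
qed

text \<open>Both sides of the unit axiom of a weak distributive law are \<open>\<iota> \<pi>\<close>.\<close>

lemma unit_left:
  "\<langle>k, [b, a]\<rangle> [([], mB, [a]), ([b], psi, []), ([b, a], eB, [])]
    \<approx> [([], io, []), ([], mR, []), ([], be, [r]), ([b], al, [])]" (is "eqd _ _ ?x ?y")
proof -
  let ?E = "eqd k [b, a]"
  have "?E ?x
      [([], mB, [a]), ([b], io, []), ([b], mR, []), ([b], al, [r]), ([b, a], be, []), ([b, a], eB, [])]"
    by (rule plain_step[where i = 1, OF psi_def]) simp_all
  also have "?E \<dots>
      [([], mB, [a]), ([b], io, []), ([b], mR, []), ([b], al, [r]), ([b, a], eR, [])]"
    by (rule plain_step[where i = 4, OF be_unt]) simp_all
  also have "?E \<dots>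
      [([], io, []), ([], mR, []), ([], be, [r]), ([b], mR, []), ([b], al, [r]), ([b, a], eR, [])]"
    by (rule plain_step[where i = 0, OF io_left[symmetric]]) simp_all
  also have "?E \<dots> ?y"
    by (rule step[where i = 2 and js = "[2, 4, 3]", OF R.unitr]) simp_all
  finally show ?thesis .
qed

lemma unit_right:
  "\<langle>k, [b, a]\<rangle> [([b], mA, []), ([], psi, [a]), ([], eA, [b, a])]
    \<approx> [([], io, []), ([], mR, []), ([], be, [r]), ([b], al, [])]" (is "eqd _ _ ?x ?y")
proof -
  let ?E = "eqd k [b, a]"
  have "?E ?x
      [([b], mA, []), ([], io, [a]), ([], mR, [a]), ([], al, [r, a]), ([a], be, [a]), ([], eA, [b, a])]"
    by (rule plain_step[where i = 1, OF psi_def]) simp_all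
  also have "?E \<dots>
      [([b], mA, []), ([], io, [a]), ([], mR, [a]), ([], eR, [r, a]), ([], be, [a])]"
    by (rule step[where i = 3 and js = "[4]", OF al_unt]) simp_all
  also have "?E \<dots>
      [([], io, []), ([], mR, []), ([r], al, []), ([], mR, [a]), ([], eR, [r, a]), ([], be, [a])]"
    by (rule plain_step[where i = 0, OF io_right[symmetric]]) simp_all
  also have "?E \<dots> ?y"
    by (rule step[where i = 2 and js = "[2, 3, 4]", OF R.unitl]) simp_all
  finally show ?thesis .
qed

lemma pi_eB:
  "\<langle>k, [a]\<rangle> [([], mR, []), ([], be, [r]), ([b], al, []), ([], eB, [a])]
    \<approx> [([], al, [])]" (is "eqd _ _ ?x ?y")
proof -
  let ?E = "eqd k [a]"
  have "?E ?x
      [([], mR, []), ([], eR, [r]), ([], al, [])]"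
    by (rule step[where i = 1 and js = "[2]", OF be_unt]) simp_all
  also have "?E \<dots> ?y"
    by (rule plain_step[where i = 0, OF R.unitl]) simp_all
  finally show ?thesis .
qed

lemma pi_eA:
  "\<langle>k, [b]\<rangle> [([], mR, []), ([], be, [r]), ([b], al, []), ([b], eA, [])]
    \<approx> [([], be, [])]" (is "eqd _ _ ?x ?y")
proof -
  let ?E = "eqd k [b]"
  have "?E ?x
      [([], mR, []), ([], be, [r]), ([b], eR, [])]"
    by (rule plain_step[where i = 2, OF al_unt]) simp_all
  also have "?E \<dots> ?y"
    by (rule step[where i = 0 and js = "[1]", OF R.unitr]) simp_all
  finally show ?thesis .
qed

lemma pi_left:
  "\<langle>k, [b, b, a]\<rangle> [([], mR, []), ([], be, [r]), ([b], mR, []), ([b], be, [r]), ([b, b], al, [])]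
    \<approx> [([], mR, []), ([], be, [r]), ([b], al, []), ([], mB, [a])]" (is "eqd _ _ ?x ?y")
proof -
  let ?E = "eqd k [b, b, a]"
  have "?E ?x
      [([], mR, []), ([], mR, [r]), ([], be, [r, r]), ([b], be, [r]), ([b, b], al, [])]"
    by (rule step[where i = 0 and js = "[1]", OF R.assoc[symmetric]]) simp_all
  also have "?E \<dots>
      [([], mR, []), ([], be, [r]), ([], mB, [r]), ([b, b], al, [])]"
    by (rule plain_step[where i = 1, OF be_mul[symmetric]]) simp_all
  also have "?E \<dots> ?y"
    by (rule slide_step[where js = "[2]"]) simp_all
  finally show ?thesis .
qed

lemma pi_right:
  "\<langle>k, [b, a, a]\<rangle> [([], mR, []), ([r], al, []), ([], mR, [a]), ([], be, [r, a]), ([b], al, [a])]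
    \<approx> [([], mR, []), ([], be, [r]), ([b], al, []), ([b], mA, [])]" (is "eqd _ _ ?x ?y")
proof -
  let ?E = "eqd k [b, a, a]"
  have "?E ?x
      [([], mR, []), ([r], mR, []), ([], be, [r, r]), ([b], al, [r]), ([b, a], al, [])]"
    by (rule step[where i = 0 and js = "[1, 2, 3]", OF R.assoc]) simp_all
  also have "?E \<dots> ?y"
    by (rule step[where i = 2 and js = "[1]", OF al_mul[symmetric]]) simp_all
  finally show ?thesis .
qed

lemma psi_unit: "\<langle>k, [b, a]\<rangle> [([], mB, [a]), ([b], psi, []), ([b, a], eB, [])]
    \<approx> [([b], mA, []), ([], psi, [a]), ([], eA, [b, a])]"
  using unit_left eqd_sym[OF unit_right] by (rule eqd_trans)

end

locale factorization_law_diagrams =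
  bicategory K +
  factorization_diagrams K k a mA eA b mB eB r mR eR al be io psi
  for K :: "('o, 'm, 'c) bicat" (structure) and k a mA eA b mB eB r mR eR al be io psi +
  fixes pb :: "('o, 'm, 'c) gen"
  assumes pb: "gentype k [b, a] [b, a] pb"
    and pb_def: "\<langle>k, [b, a]\<rangle> [([], pb, [])]
      \<approx> [([], mB, [a]), ([b, b], mA, []), ([b], psi, [a]), ([b], eA, [b, a]), ([b], eB, [a])]"
begin

sublocale law: law_diagrams K k a mA eA b mB eB psi pb
  by unfold_locales (fact psi pb psi_mA psi_mB psi_unit pb_def)+

lemma pb_pi: "\<langle>k, [b, a]\<rangle> [([], pb, [])] \<approx> [([], io, []), ([], mR, []), ([], be, [r]), ([b], al, [])]"
  using law.pb_left unit_left by (rule eqd_trans)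

lemma pi_pb:
  "\<langle>k, [b, a]\<rangle> [([], mR, []), ([], be, [r]), ([b], al, []), ([], pb, [])]
    \<approx> [([], mR, []), ([], be, [r]), ([b], al, [])]" (is "eqd _ _ ?x ?y")
proof -
  let ?E = "eqd k [b, a]"
  have "?E ?x
      [([], mR, []), ([], be, [r]), ([b], al, []), ([], io, []), ([], mR, []), ([], be, [r]), ([b], al, [])]"
    by (rule plain_step[where i = 3, OF pb_pi]) simp_all
  also have "?E \<dots> ?y"
    by (rule plain_step[where i = 0, OF pi_io]) simp_all
  finally show ?thesis .
qed

end

locale factorization_morphism_diagrams =
  bicategory K +
  S: factorization_law_diagrams K k a mA eA b mB eB r mR eR al be io psi pb +
  T: factorization_law_diagrams K k' a' mA' eA' b' mB' eB' r' mR' eR' al' be' io' psi' pb' +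
  X: monad_morphism_diagrams K k a mA eA k' a' mA' eA' V xi +
  Z: monad_morphism_diagrams K k b mB eB k' b' mB' eB' V ze +
  P: monad_morphism_diagrams K k r mR eR k' r' mR' eR' V rho
  for K :: "('o, 'm, 'c) bicat" (structure) and k a mA eA b mB eB r mR eR al be io psi pb
    k' a' mA' eA' b' mB' eB' r' mR' eR' al' be' io' psi' pb' V xi ze rho +
  assumes int_al: "\<langle>k, [a', V]\<rangle> [([], rho, []), ([], al', [V])] \<approx> [([V], al, []), ([], xi, [])]"
    and int_be: "\<langle>k, [b', V]\<rangle> [([], rho, []), ([], be', [V])] \<approx> [([V], be, []), ([], ze, [])]"
begin

lemma rho_pi:
  "\<langle>k, [b', a', V]\<rangle> [([], rho, []), ([], mR', [V]), ([], be', [r', V]), ([b'], al', [V])]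
    \<approx> [([V], mR, []), ([V], be, [r]), ([V, b], al, []), ([], ze, [a]), ([b'], xi, [])]" (is "eqd _ _ ?x ?y")
proof -
  let ?E = "eqd k [b', a', V]"
  have "?E ?x
      [([V], mR, []), ([], rho, [r]), ([r'], rho, []), ([], be', [r', V]), ([b'], al', [V])]"
    by (rule plain_step[where i = 0, OF P.mul]) simp_all
  also have "?E \<dots>
      [([V], mR, []), ([V], be, [r]), ([], ze, [r]), ([b'], rho, []), ([b'], al', [V])]"
    by (rule step[where i = 1 and js = "[2]", OF int_be]) simp_all
  also have "?E \<dots>
      [([V], mR, []), ([V], be, [r]), ([], ze, [r]), ([b', V], al, []), ([b'], xi, [])]"
    by (rule plain_step[where i = 3, OF int_al]) simp_all
  also have "?E \<dots> ?y"
    by (rule slide_step[where js = "[2]"]) simp_all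
  finally show ?thesis .
qed

lemma rho_psi:
  "\<langle>k, [a', b', V]\<rangle> [([], rho, []), ([], mR', [V]), ([], al', [r', V]), ([a'], be', [V])]
    \<approx> [([V], mR, []), ([V], al, [r]), ([V, a], be, []), ([], xi, [b]), ([a'], ze, [])]" (is "eqd _ _ ?x ?y")
proof -
  let ?E = "eqd k [a', b', V]"
  have "?E ?x
      [([V], mR, []), ([], rho, [r]), ([r'], rho, []), ([], al', [r', V]), ([a'], be', [V])]"
    by (rule plain_step[where i = 0, OF P.mul]) simp_all
  also have "?E \<dots>
      [([V], mR, []), ([], rho, [r]), ([], al', [V, r]), ([a', V], be, []), ([a'], ze, [])]"
    by (rule step[where i = 3 and js = "[2]", OF int_be]) simp_all
  also have "?E \<dots>
      [([V], mR, []), ([V], al, [r]), ([], xi, [r]), ([a', V], be, []), ([a'], ze, [])]"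
    by (rule plain_step[where i = 1, OF int_al]) simp_all
  also have "?E \<dots> ?y"
    by (rule slide_step[where js = "[2]"]) simp_all
  finally show ?thesis .
qed

text \<open>Both sides become \<open>(V \<otimes> \<iota>) \<rho> (\<mu>\<^sub>R' (\<alpha>' \<otimes> \<beta>') \<otimes> V)\<close>, since \<open>\<Psi>bar = \<iota> \<pi>\<close>.\<close>

lemma bfs_compat:
  "\<langle>k, [a', b', V]\<rangle> [([V], pb, []), ([], ze, [a]), ([b'], xi, []), ([], psi', [V])]
    \<approx> [([V], psi, []), ([], xi, [b]), ([a'], ze, [])]" (is "eqd _ _ ?x ?y")
proof -
  let ?E = "eqd k [a', b', V]"
  have "?E ?x
      [([V], io, []), ([V], mR, []), ([V], be, [r]), ([V, b], al, []), ([], ze, [a]), ([b'], xi, []), ([], psi', [V])]"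
    by (rule plain_step[where i = 0, OF S.pb_pi]) simp_all
  also have "?E \<dots>
      [([V], io, []), ([], rho, []), ([], mR', [V]), ([], be', [r', V]), ([b'], al', [V]), ([], psi', [V])]"
    by (rule plain_step[where i = 1, OF rho_pi[symmetric]]) simp_all
  also have "?E \<dots>
      [([V], io, []), ([], rho, []), ([], mR', [V]), ([], al', [r', V]), ([a'], be', [V])]"
    by (rule plain_step[where i = 2, OF T.pi_psi]) simp_all
  also have "?E \<dots>
      [([V], io, []), ([V], mR, []), ([V], al, [r]), ([V, a], be, []), ([], xi, [b]), ([a'], ze, [])]"
    by (rule plain_step[where i = 1, OF rho_psi]) simp_all
  also have "?E \<dots> ?y"
    by (rule plain_step[where i = 0, OF S.psi_def[symmetric]]) simp_all
  finally show ?thesis .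
qed

text \<open>As \<open>\<pi>' \<iota>'\<close> is an identity, \<open>\<rho>\<close> is determined by \<open>\<xi>\<close> and \<open>\<zeta>\<close>.\<close>

lemma rho_eq:
  "\<langle>k, [r', V]\<rangle> [([], rho, [])]
    \<approx> [([V], mR, []), ([V], be, [r]), ([V, b], al, []), ([], ze, [a]), ([b'], xi, []), ([], io', [V])]" (is "eqd _ _ ?x ?y")
proof -
  let ?E = "eqd k [r', V]"
  have "?E ?x
      [([], rho, []), ([], mR', [V]), ([], be', [r', V]), ([b'], al', [V]), ([], io', [V])]"
    by (rule step_at[where i = 1 and L = "[]" and R = "[V]" and js = "[]", OF T.pi_io[symmetric]]) simp_all
  also have "?E \<dots> ?y"
    by (rule plain_step[where i = 0, OF rho_pi]) simp_all
  finally show ?thesis .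
qed

end

text \<open>Conversely, let only \<open>\<xi>\<close> and \<open>\<zeta>\<close> be given, and define \<open>\<rho>\<close> by the formula \<open>\<rho> = (V \<otimes> \<pi>) \<theta> (\<iota>' \<otimes> V)\<close>.\<close>

locale factorization_lift_diagrams =
  bicategory K +
  S: factorization_law_diagrams K k a mA eA b mB eB r mR eR al be io psi pb +
  T: factorization_law_diagrams K k' a' mA' eA' b' mB' eB' r' mR' eR' al' be' io' psi' pb' +
  L: law_morphism_diagrams K k a mA eA b mB eB psi pb k' a' mA' eA' b' mB' eB' psi' pb' V xi ze
  for K :: "('o, 'm, 'c) bicat" (structure) and k a mA eA b mB eB r mR eR al be io psi pb
    k' a' mA' eA' b' mB' eB' r' mR' eR' al' be' io' psi' pb' V xi ze +
  fixes rho :: "('o, 'm, 'c) gen"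
  assumes rho: "gentype k [r', V] [V, r] rho"
    and rho_def: "\<langle>k, [r', V]\<rangle> [([], rho, [])]
      \<approx> [([V], mR, []), ([V], be, [r]), ([V, b], al, []), ([], ze, [a]), ([b'], xi, []), ([], io', [V])]"
begin

lemmas types [simp] = gentypeD[OF rho]

text \<open>The composite \<open>\<iota>' \<pi>'\<close> is the idempotent, which is absorbed.\<close>

lemma rho_pi:
  "\<langle>k, [b', a', V]\<rangle> [([], rho, []), ([], mR', [V]), ([], be', [r', V]), ([b'], al', [V])]
    \<approx> [([V], mR, []), ([V], be, [r]), ([V, b], al, []), ([], ze, [a]), ([b'], xi, [])]" (is "eqd _ _ ?x ?y")
proof -
  let ?E = "eqd k [b', a', V]"
  have "?E ?x
      [([V], mR, []), ([V], be, [r]), ([V, b], al, []), ([], ze, [a]), ([b'], xi, []), ([], io', [V]), ([], mR', [V]), ([], be', [r', V]), ([b'], al', [V])]"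
    by (rule plain_step[where i = 0, OF rho_def]) simp_all
  also have "?E \<dots>
      [([V], mR, []), ([V], be, [r]), ([], ze, [r]), ([b', V], al, []), ([b'], xi, []), ([], pb', [V])]"
    by (rule step[where i = 5 and js = "[2]", OF T.pb_pi[symmetric]]) simp_all
  also have "?E \<dots>
      [([V], mR, []), ([V], be, [r]), ([V, b], al, []), ([V], pb, []), ([], ze, [a]), ([b'], xi, []), ([], pb', [V])]"
    by (rule step[where i = 0 and js = "[2]", OF S.pi_pb[symmetric]]) simp_all
  also have "?E \<dots>
      [([V], mR, []), ([V], be, [r]), ([V, b], al, []), ([V], pb, []), ([], ze, [a]), ([b'], xi, [])]"
    by (rule plain_step[where i = 3, OF L.absorb]) simp_all
  also have "?E \<dots> ?y"
    by (rule plain_step[where i = 0, OF S.pi_pb]) simp_all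
  finally show ?thesis .
qed

text \<open>The compatibility condition of a 1-cell, followed by \<open>\<pi>\<close>.\<close>

lemma pi_theta_psi:
  "\<langle>k, [a', b', V]\<rangle> [([V], mR, []), ([V], be, [r]), ([V, b], al, []), ([], ze, [a]), ([b'], xi, []), ([], psi', [V])]
    \<approx> [([V], mR, []), ([V], al, [r]), ([V, a], be, []), ([], xi, [b]), ([a'], ze, [])]" (is "eqd _ _ ?x ?y")
proof -
  let ?E = "eqd k [a', b', V]"
  have "?E ?x
      [([V], mR, []), ([V], be, [r]), ([V, b], al, []), ([V], pb, []), ([], ze, [a]), ([b'], xi, []), ([], psi', [V])]"
    by (rule plain_step[where i = 0, OF S.pi_pb[symmetric]]) simp_all
  also have "?E \<dots>
      [([V], mR, []), ([V], be, [r]), ([V, b], al, []), ([V], psi, []), ([], xi, [b]), ([a'], ze, [])]"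
    by (rule plain_step[where i = 3, OF L.compat]) simp_all
  also have "?E \<dots> ?y"
    by (rule plain_step[where i = 0, OF S.pi_psi]) simp_all
  finally show ?thesis .
qed

text \<open>The map \<open>\<alpha>'\<close> is \<open>\<pi>'\<close> preceded by the unit of \<open>B'\<close>.\<close>

lemma int_al:
  "\<langle>k, [a', V]\<rangle> [([], rho, []), ([], al', [V])]
    \<approx> [([V], al, []), ([], xi, [])]" (is "eqd _ _ ?x ?y")
proof -
  let ?E = "eqd k [a', V]"
  have "?E ?x
      [([], rho, []), ([], mR', [V]), ([], be', [r', V]), ([b'], al', [V]), ([], eB', [a', V])]"
    by (rule plain_step[where i = 1, OF T.pi_eB[symmetric]]) simp_all
  also have "?E \<dots>
      [([V], mR, []), ([V], be, [r]), ([V, b], al, []), ([], ze, [a]), ([b'], xi, []), ([], eB', [a', V])]"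
    by (rule plain_step[where i = 0, OF rho_pi]) simp_all
  also have "?E \<dots>
      [([V], mR, []), ([V], be, [r]), ([V], eB, [r]), ([V], al, []), ([], xi, [])]"
    by (rule step[where i = 2 and js = "[2, 4, 3]", OF L.Z.unt]) simp_all
  also have "?E \<dots> ?y"
    by (rule step[where i = 0 and js = "[2]", OF S.pi_eB]) simp_all
  finally show ?thesis .
qed

lemma int_be:
  "\<langle>k, [b', V]\<rangle> [([], rho, []), ([], be', [V])]
    \<approx> [([V], be, []), ([], ze, [])]" (is "eqd _ _ ?x ?y")
proof -
  let ?E = "eqd k [b', V]"
  have "?E ?x
      [([], rho, []), ([], mR', [V]), ([], be', [r', V]), ([b'], al', [V]), ([b'], eA', [V])]"
    by (rule plain_step[where i = 1, OF T.pi_eA[symmetric]]) simp_all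
  also have "?E \<dots>
      [([V], mR, []), ([V], be, [r]), ([V, b], al, []), ([], ze, [a]), ([b'], xi, []), ([b'], eA', [V])]"
    by (rule plain_step[where i = 0, OF rho_pi]) simp_all
  also have "?E \<dots>
      [([V], mR, []), ([V], be, [r]), ([], ze, [r]), ([b', V], al, []), ([b', V], eA, [])]"
    by (rule step[where i = 4 and js = "[2]", OF L.X.unt]) simp_all
  also have "?E \<dots> ?y"
    by (rule step[where i = 0 and js = "[2, 3]", OF S.pi_eA]) simp_all
  finally show ?thesis .
qed

lemma rho_unt:
  "\<langle>k, [V]\<rangle> [([], rho, []), ([], eR', [V])]
    \<approx> [([V], eR, [])]" (is "eqd _ _ ?x ?y")
proof -
  let ?E = "eqd k [V]"
  have "?E ?x
      [([], rho, []), ([], al', [V]), ([], eA', [V])]"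
    by (rule plain_step[where i = 1, OF T.al_unt[symmetric]]) simp_all
  also have "?E \<dots>
      [([V], al, []), ([], xi, []), ([], eA', [V])]"
    by (rule plain_step[where i = 0, OF int_al]) simp_all
  also have "?E \<dots>
      [([V], al, []), ([V], eA, [])]"
    by (rule plain_step[where i = 1, OF L.X.unt]) simp_all
  also have "?E \<dots> ?y"
    by (rule plain_step[where i = 0, OF S.al_unt]) simp_all
  finally show ?thesis .
qed

text \<open>Multiplicativity of \<open>\<rho>\<close> when its left argument comes from \<open>B'\<close>. It is enough to test this on the image of \<open>\<pi>'\<close> in
  the right argument, where \<open>\<pi>'\<close> is left \<open>B'\<close>-linear.\<close>

lemma rho_be_pi:
  "\<langle>k, [b', b', a', V]\<rangle> [([], rho, []), ([], mR', [V]), ([], be', [r', V]), ([b'], mR', [V]), ([b'], be', [r', V]), ([b', b'], al', [V])]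
    \<approx> [([V], mR, []), ([], rho, [r]), ([r'], rho, []), ([], be', [r', V]), ([b'], mR', [V]), ([b'], be', [r', V]), ([b', b'], al', [V])]" (is "eqd _ _ ?x ?y")
proof -
  let ?E = "eqd k [b', b', a', V]"
  have "?E ?x
      [([], rho, []), ([], mR', [V]), ([], be', [r', V]), ([b'], al', [V]), ([], mB', [a', V])]"
    by (rule plain_step[where i = 1, OF T.pi_left]) simp_all
  also have "?E \<dots>
      [([V], mR, []), ([V], be, [r]), ([V, b], al, []), ([], ze, [a]), ([b'], xi, []), ([], mB', [a', V])]"
    by (rule plain_step[where i = 0, OF rho_pi]) simp_all
  also have "?E \<dots>
      [([V], mR, []), ([V], be, [r]), ([V], mB, [r]), ([], ze, [b, r]), ([b'], ze, [r]), ([b', b', V], al, []), ([b', b'], xi, [])]"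
    by (rule step[where i = 2 and js = "[2, 4, 3]", OF L.Z.mul]) simp_all
  also have "?E \<dots>
      [([V], mR, []), ([V], be, [r]), ([V, b], mR, []), ([V, b], be, [r]), ([V, b, b], al, []), ([], ze, [b, a]), ([b'], ze, [a]), ([b', b'], xi, [])]"
    by (rule step[where i = 0 and js = "[4, 3, 2]", OF S.pi_left[symmetric]]) simp_all
  also have "?E \<dots>
      [([V], mR, []), ([], rho, [r]), ([], be', [V, r]), ([b', V], mR, []), ([b', V], be, [r]), ([b'], ze, [r]), ([b', b', V], al, []), ([b', b'], xi, [])]"
    by (rule step[where i = 1 and js = "[4, 3, 2, 5]", OF int_be[symmetric]]) simp_all
  also have "?E \<dots>
      [([V], mR, []), ([], rho, [r]), ([], be', [V, r]), ([b'], rho, []), ([b'], mR', [V]), ([b'], be', [r', V]), ([b', b'], al', [V])]"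
    by (rule step[where i = 3 and js = "[5]", OF rho_pi[symmetric]]) simp_all
  also have "?E \<dots> ?y"
    by (rule slide_step[where js = "[2]"]) simp_all
  finally show ?thesis .
qed

lemma rho_be:
  "\<langle>k, [b', r', V]\<rangle> [([], rho, []), ([], mR', [V]), ([], be', [r', V])]
    \<approx> [([V], mR, []), ([], rho, [r]), ([r'], rho, []), ([], be', [r', V])]" (is "eqd _ _ ?x ?y")
proof -
  let ?E = "eqd k [b', r', V]"
  have "?E ?x
      [([], rho, []), ([], mR', [V]), ([r'], mR', [V]), ([r'], be', [r', V]), ([r', b'], al', [V]), ([r'], io', [V]), ([], be', [r', V])]"
    by (rule step_at[where i = 2 and L = "[r']" and R = "[V]" and js = "[]", OF T.pi_io[symmetric]]) simp_all
  also have "?E \<dots>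
      [([V], mR, []), ([], rho, [r]), ([r'], rho, []), ([], be', [r', V]), ([b'], mR', [V]), ([b'], be', [r', V]), ([b', b'], al', [V]), ([b'], io', [V])]"
    by (rule step[where i = 0 and js = "[5, 4, 3, 2]", OF rho_be_pi]) simp_all
  also have "?E \<dots>
      [([V], mR, []), ([], rho, [r]), ([], be', [V, r]), ([b'], rho, [])]"
    by (rule step[where i = 4 and js = "[2]", OF T.pi_io]) simp_all
  also have "?E \<dots> ?y"
    by (rule slide_step[where js = "[2]"]) simp_all
  finally show ?thesis .
qed

text \<open>Multiplicativity of \<open>\<rho>\<close> when its left argument comes from \<open>A'\<close>. In the product with \<open>\<pi>'\<close> the elements of \<open>A'\<close>
  and \<open>B'\<close> are interchanged by \<open>\<Psi>'\<close>, and \<open>pi_theta_psi\<close> undoes this on the other side of \<open>V\<close>.\<close>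

lemma rho_al_pi:
  "\<langle>k, [a', b', a', V]\<rangle> [([], rho, []), ([], mR', [V]), ([], al', [r', V]), ([a'], mR', [V]), ([a'], be', [r', V]), ([a', b'], al', [V])]
    \<approx> [([V], mR, []), ([], rho, [r]), ([r'], rho, []), ([], al', [r', V]), ([a'], mR', [V]), ([a'], be', [r', V]), ([a', b'], al', [V])]" (is "eqd _ _ ?x ?y")
proof -
  let ?E = "eqd k [a', b', a', V]"
  have "?E ?x
      [([], rho, []), ([], mR', [V]), ([], mR', [r', V]), ([], al', [r', r', V]), ([a'], be', [r', V]), ([a', b'], al', [V])]"
    by (rule step[where i = 1 and js = "[2]", OF T.R.assoc[symmetric]]) simp_all
  also have "?E \<dots>
      [([], rho, []), ([], mR', [V]), ([], mR', [r', V]), ([], be', [r', r', V]), ([b'], al', [r', V]), ([], psi', [r', V]), ([a', b'], al', [V])]"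
    by (rule plain_step[where i = 2, OF T.pi_psi[symmetric]]) simp_all
  also have "?E \<dots>
      [([], rho, []), ([], mR', [V]), ([], be', [r', V]), ([b'], al', [V]), ([b'], mA', [V]), ([], psi', [a', V])]"
    by (rule step[where i = 1 and js = "[5, 4, 3, 2]", OF T.pi_right]) simp_all
  also have "?E \<dots>
      [([V], mR, []), ([V], be, [r]), ([V, b], al, []), ([], ze, [a]), ([b'], xi, []), ([b'], mA', [V]), ([], psi', [a', V])]"
    by (rule plain_step[where i = 0, OF rho_pi]) simp_all
  also have "?E \<dots>
      [([V], mR, []), ([V], be, [r]), ([], ze, [r]), ([b', V], al, []), ([b', V], mA, []), ([b'], xi, [a]), ([b', a'], xi, []), ([], psi', [a', V])]"
    by (rule step[where i = 4 and js = "[2]", OF L.X.mul]) simp_all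
  also have "?E \<dots>
      [([V], mR, []), ([V, r], al, []), ([V], mR, [a]), ([V], be, [r, a]), ([V, b], al, [a]), ([], ze, [a, a]), ([b'], xi, [a]), ([], psi', [V, a]), ([a', b'], xi, [])]"
    by (rule step[where i = 0 and js = "[2, 3, 6]", OF S.pi_right[symmetric]]) simp_all
  also have "?E \<dots>
      [([V], mR, []), ([V], mR, [r]), ([V], al, [r, r]), ([V, a], be, [r]), ([], xi, [b, r]), ([a'], ze, [r]), ([a', b', V], al, []), ([a', b'], xi, [])]"
    by (rule step[where i = 1 and js = "[1, 2, 3, 4, 5, 6]", OF pi_theta_psi]) simp_all
  also have "?E \<dots>
      [([V], mR, []), ([V, r], mR, []), ([V], al, [r, r]), ([], xi, [r, r]), ([a', V], be, [r]), ([a'], ze, [r]), ([a', b', V], al, []), ([a', b'], xi, [])]"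
    by (rule step[where i = 0 and js = "[3]", OF S.R.assoc]) simp_all
  also have "?E \<dots>
      [([V], mR, []), ([], rho, [r]), ([], al', [V, r]), ([a', V], mR, []), ([a', V], be, [r]), ([a'], ze, [r]), ([a', b', V], al, []), ([a', b'], xi, [])]"
    by (rule step[where i = 1 and js = "[1, 2]", OF int_al[symmetric]]) simp_all
  also have "?E \<dots>
      [([V], mR, []), ([], rho, [r]), ([], al', [V, r]), ([a'], rho, []), ([a'], mR', [V]), ([a'], be', [r', V]), ([a', b'], al', [V])]"
    by (rule step[where i = 3 and js = "[5]", OF rho_pi[symmetric]]) simp_all
  also have "?E \<dots> ?y"
    by (rule slide_step[where js = "[2]"]) simp_all
  finally show ?thesis .
qed

lemma rho_al:
  "\<langle>k, [a', r', V]\<rangle> [([], rho, []), ([], mR', [V]), ([], al', [r', V])]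
    \<approx> [([V], mR, []), ([], rho, [r]), ([r'], rho, []), ([], al', [r', V])]" (is "eqd _ _ ?x ?y")
proof -
  let ?E = "eqd k [a', r', V]"
  have "?E ?x
      [([], rho, []), ([], mR', [V]), ([r'], mR', [V]), ([r'], be', [r', V]), ([r', b'], al', [V]), ([r'], io', [V]), ([], al', [r', V])]"
    by (rule step_at[where i = 2 and L = "[r']" and R = "[V]" and js = "[]", OF T.pi_io[symmetric]]) simp_all
  also have "?E \<dots>
      [([V], mR, []), ([], rho, [r]), ([r'], rho, []), ([], al', [r', V]), ([a'], mR', [V]), ([a'], be', [r', V]), ([a', b'], al', [V]), ([a'], io', [V])]"
    by (rule step[where i = 0 and js = "[5, 4, 3, 2]", OF rho_al_pi]) simp_all
  also have "?E \<dots>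
      [([V], mR, []), ([], rho, [r]), ([], al', [V, r]), ([a'], rho, [])]"
    by (rule step[where i = 4 and js = "[2]", OF T.pi_io]) simp_all
  also have "?E \<dots> ?y"
    by (rule slide_step[where js = "[2]"]) simp_all
  finally show ?thesis .
qed

text \<open>Multiplicativity is inherited by products in the left argument, and \<open>\<pi>' \<iota>'\<close> writes every element of \<open>R'\<close> as
  a product of elements of \<open>B'\<close> and \<open>A'\<close>.\<close>

lemma rho_mul:
  "\<langle>k, [r', r', V]\<rangle> [([], rho, []), ([], mR', [V])]
    \<approx> [([V], mR, []), ([], rho, [r]), ([r'], rho, [])]" (is "eqd _ _ ?x ?y")
proof -
  let ?E = "eqd k [r', r', V]"
  have "?E ?x
      [([], rho, []), ([], mR', [V]), ([], mR', [r', V]), ([], be', [r', r', V]), ([b'], al', [r', V]), ([], io', [r', V])]"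
    by (rule step_at[where i = 2 and L = "[]" and R = "[r', V]" and js = "[]", OF T.pi_io[symmetric]]) simp_all
  also have "?E \<dots>
      [([], rho, []), ([], mR', [V]), ([r'], mR', [V]), ([], be', [r', r', V]), ([b'], al', [r', V]), ([], io', [r', V])]"
    by (rule plain_step[where i = 1, OF T.R.assoc]) simp_all
  also have "?E \<dots>
      [([V], mR, []), ([], rho, [r]), ([r'], rho, []), ([], be', [r', V]), ([b'], mR', [V]), ([b'], al', [r', V]), ([], io', [r', V])]"
    by (rule step[where i = 0 and js = "[2]", OF rho_be]) simp_all
  also have "?E \<dots>
      [([V], mR, []), ([], rho, [r]), ([], be', [V, r]), ([b', V], mR, []), ([b'], rho, [r]), ([b', r'], rho, []), ([b'], al', [r', V]), ([], io', [r', V])]"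
    by (rule step[where i = 3 and js = "[2]", OF rho_al]) simp_all
  also have "?E \<dots>
      [([V], mR, []), ([V], mR, [r]), ([], rho, [r, r]), ([], be', [V, r, r]), ([b'], rho, [r]), ([b'], al', [V, r]), ([], io', [V, r]), ([r'], rho, [])]"
    by (rule step[where i = 0 and js = "[2, 1, 5, 6]", OF S.R.assoc[symmetric]]) simp_all
  also have "?E \<dots>
      [([V], mR, []), ([], rho, [r]), ([], mR', [V, r]), ([], be', [r', V, r]), ([b'], al', [V, r]), ([], io', [V, r]), ([r'], rho, [])]"
    by (rule step[where i = 1 and js = "[3]", OF rho_be[symmetric]]) simp_all
  also have "?E \<dots> ?y"
    by (rule plain_step[where i = 2, OF T.pi_io]) simp_all
  finally show ?thesis .
qed

end

locale factorization_transformation_diagrams =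
  bicategory K +
  F: factorization_morphism_diagrams K k a mA eA b mB eB r mR eR al be io psi pb
    k' a' mA' eA' b' mB' eB' r' mR' eR' al' be' io' psi' pb' V xi ze rho +
  G: factorization_morphism_diagrams K k a mA eA b mB eB r mR eR al be io psi pb
    k' a' mA' eA' b' mB' eB' r' mR' eR' al' be' io' psi' pb' U ups eps sig
  for K :: "('o, 'm, 'c) bicat" (structure) and k a mA eA b mB eB r mR eR al be io psi pb
    k' a' mA' eA' b' mB' eB' r' mR' eR' al' be' io' psi' pb' V xi ze rho U ups eps sig +
  fixes om :: "('o, 'm, 'c) gen"
  assumes om: "gentype k [V] [U] om"
    and tr_xi: "\<langle>k, [a', V]\<rangle> [([], ups, []), ([a'], om, [])] \<approx> [([], om, [a]), ([], xi, [])]"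
    and tr_ze: "\<langle>k, [b', V]\<rangle> [([], eps, []), ([b'], om, [])] \<approx> [([], om, [b]), ([], ze, [])]"
begin

lemmas types [simp] = gentypeD[OF om]

text \<open>In the formula \<open>rho_eq\<close> the 2-cell can be moved through \<open>\<xi>\<close> and then through \<open>\<zeta>\<close>.\<close>

lemma tr_rho:
  "\<langle>k, [r', V]\<rangle> [([], sig, []), ([r'], om, [])]
    \<approx> [([], om, [r]), ([], rho, [])]" (is "eqd _ _ ?x ?y")
proof -
  let ?E = "eqd k [r', V]"
  have "?E ?x
      [([U], mR, []), ([U], be, [r]), ([U, b], al, []), ([], eps, [a]), ([b'], ups, []), ([], io', [U]), ([r'], om, [])]"
    by (rule plain_step[where i = 0, OF G.rho_eq]) simp_all
  also have "?E \<dots>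
      [([U], mR, []), ([U], be, [r]), ([], eps, [r]), ([b', U], al, []), ([b'], om, [a]), ([b'], xi, []), ([], io', [V])]"
    by (rule step[where i = 4 and js = "[2, 5]", OF tr_xi]) simp_all
  also have "?E \<dots>
      [([U], mR, []), ([U], be, [r]), ([], om, [b, r]), ([], ze, [r]), ([b', V], al, []), ([b'], xi, []), ([], io', [V])]"
    by (rule step[where i = 2 and js = "[3]", OF tr_ze]) simp_all
  also have "?E \<dots> ?y"
    by (rule step[where i = 1 and js = "[1, 0, 3]", OF F.rho_eq[symmetric]]) simp_all
  finally show ?thesis .
qed

end

section \<open>The monad split off by the idempotent of a weak distributive law\<close>

text \<open>The boxes \<open>pr\<close> and \<open>io\<close> split \<open>\<Psi>bar\<close>. The composite of \<open>mB\<close>, \<open>mA\<close> and \<open>psi\<close> below is the multiplication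
  \<open>m = (\<mu>\<^sub>B \<otimes> \<mu>\<^sub>A)(B \<otimes> \<Psi> \<otimes> A)\<close> on \<open>B \<otimes> A\<close>, which is associative but need not have a unit.\<close>

locale splitting_diagrams =
  bicategory K +
  law_diagrams K k a mA eA b mB eB psi pb
  for K :: "('o, 'm, 'c) bicat" (structure) and k a mA eA b mB eB psi pb +
  fixes r :: 'm and pr io mR eR al be :: "('o, 'm, 'c) gen"
  assumes r: "r \<in> hom1 K k k"
    and pr: "gentype k [b, a] [r] pr" and io: "gentype k [r] [b, a] io"
    and mR: "gentype k [r, r] [r] mR" and eR: "gentype k [] [r] eR"
    and al: "gentype k [a] [r] al" and be: "gentype k [b] [r] be"
    and split: "\<langle>k, [b, a]\<rangle> [([], io, []), ([], pr, [])] \<approx> [([], pb, [])]"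
    and retract: "\<langle>k, [r]\<rangle> [([], pr, []), ([], io, [])] \<approx> []"
    and mR_def: "\<langle>k, [r, r]\<rangle> [([], mR, [])]
      \<approx> [([], pr, []), ([], mB, [a]), ([b, b], mA, []), ([b], psi, [a]), ([], io, [b, a]), ([r], io, [])]"
    and eR_def: "\<langle>k, []\<rangle> [([], eR, [])] \<approx> [([], pr, []), ([], eB, [a]), ([], eA, [])]"
    and al_def: "\<langle>k, [a]\<rangle> [([], al, [])] \<approx> [([], pr, []), ([], eB, [a])]"
    and be_def: "\<langle>k, [b]\<rangle> [([], be, [])] \<approx> [([], pr, []), ([b], eA, [])]"
begin

lemmas split_types [simp] = hom1D[OF r] gentypeD[OF pr] gentypeD[OF io] gentypeD[OF mR] gentypeD[OF eR]
  gentypeD[OF al] gentypeD[OF be]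

lemma m_assoc:
  "\<langle>k, [b, a, b, a, b, a]\<rangle> [([], mB, [a]), ([b, b], mA, []), ([b], psi, [a]), ([], mB, [a, b, a]), ([b, b], mA, [b, a]), ([b], psi, [a, b, a])]
    \<approx> [([], mB, [a]), ([b, b], mA, []), ([b], psi, [a]), ([b, a], mB, [a]), ([b, a, b, b], mA, []), ([b, a, b], psi, [a])]" (is "eqd _ _ ?x ?y")
proof -
  let ?E = "eqd k [b, a, b, a, b, a]"
  have "?E ?x
      [([], mB, [a]), ([b], mB, [a]), ([b, b, b], mA, []), ([b, b], psi, [a]), ([b, b], mA, [b, a]), ([b], psi, [a, b, a])]"
    by (rule step[where i = 0 and js = "[2, 1]", OF B.assoc]) simp_all
  also have "?E \<dots>
      [([], mB, [a]), ([b], mB, [a]), ([b, b, b], mA, []), ([b, b, b], mA, [a]), ([b, b], psi, [a, a]), ([b, b, a], psi, [a]), ([b], psi, [a, b, a])]"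
    by (rule plain_step[where i = 3, OF psi_mA]) simp_all
  also have "?E \<dots>
      [([], mB, [a]), ([b], mB, [a]), ([b, b, b], mA, []), ([b, b, b, a], mA, []), ([b, b], psi, [a, a]), ([b], psi, [b, a, a]), ([b, a, b], psi, [a])]"
    by (rule step[where i = 2 and js = "[5]", OF A.assoc]) simp_all
  also have "?E \<dots> ?y"
    by (rule step[where i = 2 and js = "[1, 3, 4]", OF psi_mB[symmetric]]) simp_all
  finally show ?thesis .
qed

text \<open>The idempotent is \<open>B\<close>-\<open>A\<close>-bilinear, so it slides down to \<open>\<Psi>\<close>, which absorbs it.\<close>

lemma bar_m:
  "\<langle>k, [b, a, b, a]\<rangle> [([], pb, []), ([], mB, [a]), ([b, b], mA, []), ([b], psi, [a])]
    \<approx> [([], mB, [a]), ([b, b], mA, []), ([b], psi, [a])]" (is "eqd _ _ ?x ?y")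
proof -
  let ?E = "eqd k [b, a, b, a]"
  have "?E ?x
      [([], mB, [a]), ([b], pb, []), ([b, b], mA, []), ([b], psi, [a])]"
    by (rule plain_step[where i = 0, OF pb_mB]) simp_all
  also have "?E \<dots>
      [([], mB, [a]), ([b, b], mA, []), ([b], pb, [a]), ([b], psi, [a])]"
    by (rule plain_step[where i = 1, OF pb_mA]) simp_all
  also have "?E \<dots> ?y"
    by (rule plain_step[where i = 2, OF pb_psi]) simp_all
  finally show ?thesis .
qed

text \<open>Expanding the idempotent gives a copy of it in front of \<open>m\<close>, which disappears by \<open>bar_m\<close>.\<close>

lemma m_bar_left:
  "\<langle>k, [b, a, b, a]\<rangle> [([], mB, [a]), ([b, b], mA, []), ([b], psi, [a]), ([], pb, [b, a])]
    \<approx> [([], mB, [a]), ([b, b], mA, []), ([b], psi, [a])]" (is "eqd _ _ ?x ?y")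
proof -
  let ?E = "eqd k [b, a, b, a]"
  have "?E ?x
      [([], mB, [a]), ([b, b], mA, []), ([b], psi, [a]), ([b], mA, [b, a]), ([], psi, [a, b, a]), ([], eA, [b, a, b, a])]"
    by (rule plain_step[where i = 3, OF pb_right]) simp_all
  also have "?E \<dots>
      [([], mB, [a]), ([b, b], mA, []), ([b, b], mA, [a]), ([b], psi, [a, a]), ([b, a], psi, [a]), ([], psi, [a, b, a]), ([], eA, [b, a, b, a])]"
    by (rule plain_step[where i = 2, OF psi_mA]) simp_all
  also have "?E \<dots>
      [([], mB, [a]), ([b, b], mA, []), ([b, b, a], mA, []), ([b], psi, [a, a]), ([], psi, [b, a, a]), ([], eA, [b, b, a, a]), ([b], psi, [a])]"
    by (rule step[where i = 1 and js = "[4, 5]", OF A.assoc]) simp_all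
  also have "?E \<dots>
      [([b], mA, []), ([], psi, [a]), ([a], mB, [a]), ([], eA, [b, b, a]), ([b, b], mA, []), ([b], psi, [a])]"
    by (rule step[where i = 1 and js = "[0, 2, 3, 4]", OF psi_mB[symmetric]]) simp_all
  also have "?E \<dots>
      [([], pb, []), ([], mB, [a]), ([b, b], mA, []), ([b], psi, [a])]"
    by (rule step[where i = 0 and js = "[2]", OF pb_right[symmetric]]) simp_all
  also have "?E \<dots> ?y"
    by (rule plain_step[where i = 0, OF bar_m]) simp_all
  finally show ?thesis .
qed

lemma m_bar_right:
  "\<langle>k, [b, a, b, a]\<rangle> [([], mB, [a]), ([b, b], mA, []), ([b], psi, [a]), ([b, a], pb, [])]
    \<approx> [([], mB, [a]), ([b, b], mA, []), ([b], psi, [a])]" (is "eqd _ _ ?x ?y")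
proof -
  let ?E = "eqd k [b, a, b, a]"
  have "?E ?x
      [([], mB, [a]), ([b, b], mA, []), ([b], psi, [a]), ([b, a], mB, [a]), ([b, a, b], psi, []), ([b, a, b, a], eB, [])]"
    by (rule plain_step[where i = 3, OF pb_left]) simp_all
  also have "?E \<dots>
      [([], mB, [a]), ([b, b], mA, []), ([b], mB, [a, a]), ([b, b], psi, [a]), ([b], psi, [b, a]), ([b, a, b], psi, []), ([b, a, b, a], eB, [])]"
    by (rule plain_step[where i = 2, OF psi_mB]) simp_all
  also have "?E \<dots>
      [([], mB, [a]), ([], mB, [b, a]), ([b, b, b], mA, []), ([b, b], psi, [a]), ([b], psi, [b, a]), ([b, a, b], psi, []), ([b, a, b, a], eB, [])]"
    by (rule step[where i = 0 and js = "[1]", OF B.assoc[symmetric]]) simp_all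
  also have "?E \<dots>
      [([], mB, [a]), ([], mB, [b, a]), ([b, b], psi, []), ([b, b], mA, [b]), ([b], psi, [a, b]), ([b, a, b, a], eB, [])]"
    by (rule step[where i = 2 and js = "[4]", OF psi_mA[symmetric]]) simp_all
  also have "?E \<dots>
      [([], pb, []), ([], mB, [a]), ([b, b], mA, []), ([b], psi, [a])]"
    by (rule step[where i = 0 and js = "[1, 4, 3, 2]", OF pb_left[symmetric]]) simp_all
  also have "?E \<dots> ?y"
    by (rule plain_step[where i = 0, OF bar_m]) simp_all
  finally show ?thesis .
qed

lemma pr_pb:
  "\<langle>k, [b, a]\<rangle> [([], pr, []), ([], pb, [])]
    \<approx> [([], pr, [])]" (is "eqd _ _ ?x ?y")
proof -
  let ?E = "eqd k [b, a]"
  have "?E ?x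
      [([], pr, []), ([], io, []), ([], pr, [])]"
    by (rule plain_step[where i = 1, OF split[symmetric]]) simp_all
  also have "?E \<dots> ?y"
    by (rule plain_step[where i = 0, OF retract]) simp_all
  finally show ?thesis .
qed

lemma pb_io:
  "\<langle>k, [r]\<rangle> [([], pb, []), ([], io, [])]
    \<approx> [([], io, [])]" (is "eqd _ _ ?x ?y")
proof -
  let ?E = "eqd k [r]"
  have "?E ?x
      [([], io, []), ([], pr, []), ([], io, [])]"
    by (rule plain_step[where i = 0, OF split[symmetric]]) simp_all
  also have "?E \<dots> ?y"
    by (rule plain_step[where i = 1, OF retract]) simp_all
  finally show ?thesis .
qed

lemma io_mR:
  "\<langle>k, [r, r]\<rangle> [([], io, []), ([], mR, [])]
    \<approx> [([], mB, [a]), ([b, b], mA, []), ([b], psi, [a]), ([], io, [b, a]), ([r], io, [])]" (is "eqd _ _ ?x ?y")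
proof -
  let ?E = "eqd k [r, r]"
  have "?E ?x
      [([], io, []), ([], pr, []), ([], mB, [a]), ([b, b], mA, []), ([b], psi, [a]), ([], io, [b, a]), ([r], io, [])]"
    by (rule plain_step[where i = 1, OF mR_def]) simp_all
  also have "?E \<dots>
      [([], pb, []), ([], mB, [a]), ([b, b], mA, []), ([b], psi, [a]), ([], io, [b, a]), ([r], io, [])]"
    by (rule plain_step[where i = 0, OF split]) simp_all
  also have "?E \<dots> ?y"
    by (rule plain_step[where i = 0, OF bar_m]) simp_all
  finally show ?thesis .
qed

text \<open>Associativity of \<open>m\<close> suffices: by \<open>io_mR\<close> no idempotent remains between the two multiplications.\<close>

lemma mR_assoc:
  "\<langle>k, [r, r, r]\<rangle> [([], mR, []), ([], mR, [r])]
    \<approx> [([], mR, []), ([r], mR, [])]" (is "eqd _ _ ?x ?y")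
proof -
  let ?E = "eqd k [r, r, r]"
  have "?E ?x
      [([], pr, []), ([], mB, [a]), ([b, b], mA, []), ([b], psi, [a]), ([], io, [b, a]), ([r], io, []), ([], mR, [r])]"
    by (rule plain_step[where i = 0, OF mR_def]) simp_all
  also have "?E \<dots>
      [([], pr, []), ([], mB, [a]), ([b, b], mA, []), ([b], psi, [a]), ([], mB, [a, b, a]), ([b, b], mA, [b, a]), ([b], psi, [a, b, a]), ([], io, [b, a, b, a]), ([r], io, [b, a]), ([r, r], io, [])]"
    by (rule step[where i = 4 and js = "[5]", OF io_mR]) simp_all
  also have "?E \<dots>
      [([], pr, []), ([], mB, [a]), ([b, b], mA, []), ([b], psi, [a]), ([b, a], mB, [a]), ([b, a, b, b], mA, []), ([b, a, b], psi, [a]), ([], io, [b, a, b, a]), ([r], io, [b, a]), ([r, r], io, [])]"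
    by (rule plain_step[where i = 1, OF m_assoc]) simp_all
  also have "?E \<dots>
      [([], pr, []), ([], mB, [a]), ([b, b], mA, []), ([b], psi, [a]), ([], io, [b, a]), ([r], io, []), ([r], mR, [])]"
    by (rule step[where i = 5 and js = "[6, 5, 4]", OF io_mR[symmetric]]) simp_all
  also have "?E \<dots> ?y"
    by (rule plain_step[where i = 0, OF mR_def[symmetric]]) simp_all
  finally show ?thesis .
qed

text \<open>Both idempotents that arise in the arguments of \<open>m\<close> are absorbed, so the retraction is multiplicative.\<close>

lemma mR_pr:
  "\<langle>k, [b, a, b, a]\<rangle> [([], mR, []), ([], pr, [r]), ([b, a], pr, [])]
    \<approx> [([], pr, []), ([], mB, [a]), ([b, b], mA, []), ([b], psi, [a])]" (is "eqd _ _ ?x ?y")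
proof -
  let ?E = "eqd k [b, a, b, a]"
  have "?E ?x
      [([], pr, []), ([], mB, [a]), ([b, b], mA, []), ([b], psi, [a]), ([], io, [b, a]), ([r], io, []), ([], pr, [r]), ([b, a], pr, [])]"
    by (rule plain_step[where i = 0, OF mR_def]) simp_all
  also have "?E \<dots>
      [([], pr, []), ([], mB, [a]), ([b, b], mA, []), ([b], psi, [a]), ([], pb, [b, a]), ([b, a], io, []), ([b, a], pr, [])]"
    by (rule step[where i = 4 and js = "[5]", OF split]) simp_all
  also have "?E \<dots>
      [([], pr, []), ([], mB, [a]), ([b, b], mA, []), ([b], psi, [a]), ([], pb, [b, a]), ([b, a], pb, [])]"
    by (rule plain_step[where i = 5, OF split]) simp_all
  also have "?E \<dots>
      [([], pr, []), ([], mB, [a]), ([b, b], mA, []), ([b], psi, [a]), ([], pb, [b, a])]"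
    by (rule step[where i = 1 and js = "[4]", OF m_bar_right]) simp_all
  also have "?E \<dots> ?y"
    by (rule plain_step[where i = 1, OF m_bar_left]) simp_all
  finally show ?thesis .
qed

text \<open>Elements of \<open>A\<close>, embedded by \<open>\<eta>\<^sub>B\<close>, act from the right by \<open>\<mu>\<^sub>A\<close>, up to the idempotent; so do elements of \<open>B\<close>
  from the left by \<open>\<mu>\<^sub>B\<close>.\<close>

lemma m_eB:
  "\<langle>k, [b, a, a]\<rangle> [([], mB, [a]), ([b, b], mA, []), ([b], psi, [a]), ([b, a], eB, [a])]
    \<approx> [([], pb, []), ([b], mA, [])]" (is "eqd _ _ ?x ?y")
proof -
  let ?E = "eqd k [b, a, a]"
  have "?E ?x
      [([b], mA, []), ([], pb, [a])]"
    by (rule step[where i = 1 and js = "[0]", OF pb_left[symmetric]]) simp_all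
  also have "?E \<dots> ?y"
    by (rule plain_step[where i = 0, OF pb_mA[symmetric]]) simp_all
  finally show ?thesis .
qed

lemma m_eA:
  "\<langle>k, [b, b, a]\<rangle> [([], mB, [a]), ([b, b], mA, []), ([b], psi, [a]), ([b], eA, [b, a])]
    \<approx> [([], pb, []), ([], mB, [a])]" (is "eqd _ _ ?x ?y")
proof -
  let ?E = "eqd k [b, b, a]"
  have "?E ?x
      [([], mB, [a]), ([b], pb, [])]"
    by (rule plain_step[where i = 1, OF pb_right[symmetric]]) simp_all
  also have "?E \<dots> ?y"
    by (rule plain_step[where i = 0, OF pb_mB[symmetric]]) simp_all
  finally show ?thesis .
qed

lemma al_mul:
  "\<langle>k, [a, a]\<rangle> [([], al, []), ([], mA, [])]
    \<approx> [([], mR, []), ([], al, [r]), ([a], al, [])]" (is "eqd _ _ ?x ?y")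
proof -
  let ?E = "eqd k [a, a]"
  have "?E ?x
      [([], pr, []), ([], eB, [a]), ([], mA, [])]"
    by (rule plain_step[where i = 0, OF al_def]) simp_all
  also have "?E \<dots>
      [([], pr, []), ([], pb, []), ([], eB, [a]), ([], mA, [])]"
    by (rule plain_step[where i = 0, OF pr_pb[symmetric]]) simp_all
  also have "?E \<dots>
      [([], pr, []), ([], mB, [a]), ([b, b], mA, []), ([b], psi, [a]), ([b, a], eB, [a]), ([], eB, [a, a])]"
    by (rule step[where i = 1 and js = "[2]", OF m_eB[symmetric]]) simp_all
  also have "?E \<dots>
      [([], mR, []), ([], pr, [r]), ([b, a], pr, []), ([], eB, [a, b, a]), ([a], eB, [a])]"
    by (rule step[where i = 0 and js = "[4]", OF mR_pr[symmetric]]) simp_all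
  also have "?E \<dots>
      [([], mR, []), ([], pr, [r]), ([], eB, [a, r]), ([a], al, [])]"
    by (rule step[where i = 3 and js = "[2]", OF al_def[symmetric]]) simp_all
  also have "?E \<dots> ?y"
    by (rule plain_step[where i = 1, OF al_def[symmetric]]) simp_all
  finally show ?thesis .
qed

lemma al_unt:
  "\<langle>k, []\<rangle> [([], al, []), ([], eA, [])]
    \<approx> [([], eR, [])]" (is "eqd _ _ ?x ?y")
proof -
  let ?E = "eqd k []"
  have "?E ?x
      [([], pr, []), ([], eB, [a]), ([], eA, [])]"
    by (rule plain_step[where i = 0, OF al_def]) simp_all
  also have "?E \<dots> ?y"
    by (rule plain_step[where i = 0, OF eR_def[symmetric]]) simp_all
  finally show ?thesis .
qed

lemma be_unt:
  "\<langle>k, []\<rangle> [([], be, []), ([], eB, [])]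
    \<approx> [([], eR, [])]" (is "eqd _ _ ?x ?y")
proof -
  let ?E = "eqd k []"
  have "?E ?x
      [([], pr, []), ([b], eA, []), ([], eB, [])]"
    by (rule plain_step[where i = 0, OF be_def]) simp_all
  also have "?E \<dots> ?y"
    by (rule step[where i = 0 and js = "[1]", OF eR_def[symmetric]]) simp_all
  finally show ?thesis .
qed

lemma be_mul:
  "\<langle>k, [b, b]\<rangle> [([], be, []), ([], mB, [])]
    \<approx> [([], mR, []), ([], be, [r]), ([b], be, [])]" (is "eqd _ _ ?x ?y")
proof -
  let ?E = "eqd k [b, b]"
  have "?E ?x
      [([], pr, []), ([b], eA, []), ([], mB, [])]"
    by (rule plain_step[where i = 0, OF be_def]) simp_all
  also have "?E \<dots>
      [([], pr, []), ([], pb, []), ([], mB, [a]), ([b, b], eA, [])]"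
    by (rule step[where i = 0 and js = "[1]", OF pr_pb[symmetric]]) simp_all
  also have "?E \<dots>
      [([], pr, []), ([], mB, [a]), ([b, b], mA, []), ([b], psi, [a]), ([b], eA, [b, a]), ([b, b], eA, [])]"
    by (rule plain_step[where i = 1, OF m_eA[symmetric]]) simp_all
  also have "?E \<dots>
      [([], mR, []), ([], pr, [r]), ([b, a], pr, []), ([b], eA, [b, a]), ([b, b], eA, [])]"
    by (rule plain_step[where i = 0, OF mR_pr[symmetric]]) simp_all
  also have "?E \<dots>
      [([], mR, []), ([], pr, [r]), ([b], eA, [r]), ([b], be, [])]"
    by (rule step[where i = 3 and js = "[2]", OF be_def[symmetric]]) simp_all
  also have "?E \<dots> ?y"
    by (rule plain_step[where i = 1, OF be_def[symmetric]]) simp_all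
  finally show ?thesis .
qed

lemma mR_be:
  "\<langle>k, [b, r]\<rangle> [([], mR, []), ([], be, [r])]
    \<approx> [([], pr, []), ([], mB, [a]), ([b], io, [])]" (is "eqd _ _ ?x ?y")
proof -
  let ?E = "eqd k [b, r]"
  have "?E ?x
      [([], mR, []), ([], pr, [r]), ([b], eA, [r])]"
    by (rule plain_step[where i = 1, OF be_def]) simp_all
  also have "?E \<dots>
      [([], pr, []), ([], mB, [a]), ([b, b], mA, []), ([b], psi, [a]), ([], io, [b, a]), ([r], io, []), ([], pr, [r]), ([b], eA, [r])]"
    by (rule plain_step[where i = 0, OF mR_def]) simp_all
  also have "?E \<dots>
      [([], pr, []), ([], mB, [a]), ([b, b], mA, []), ([b], psi, [a]), ([], pb, [b, a]), ([b], eA, [b, a]), ([b], io, [])]"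
    by (rule step[where i = 4 and js = "[5, 6]", OF split]) simp_all
  also have "?E \<dots>
      [([], pr, []), ([], mB, [a]), ([b, b], mA, []), ([b], psi, [a]), ([b], eA, [b, a]), ([b], io, [])]"
    by (rule plain_step[where i = 1, OF m_bar_left]) simp_all
  also have "?E \<dots>
      [([], pr, []), ([], pb, []), ([], mB, [a]), ([b], io, [])]"
    by (rule plain_step[where i = 1, OF m_eA]) simp_all
  also have "?E \<dots> ?y"
    by (rule plain_step[where i = 0, OF pr_pb]) simp_all
  finally show ?thesis .
qed

lemma mR_al:
  "\<langle>k, [r, a]\<rangle> [([], mR, []), ([r], al, [])]
    \<approx> [([], pr, []), ([b], mA, []), ([], io, [a])]" (is "eqd _ _ ?x ?y")
proof -
  let ?E = "eqd k [r, a]"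
  have "?E ?x
      [([], mR, []), ([r], pr, []), ([r], eB, [a])]"
    by (rule plain_step[where i = 1, OF al_def]) simp_all
  also have "?E \<dots>
      [([], pr, []), ([], mB, [a]), ([b, b], mA, []), ([b], psi, [a]), ([], io, [b, a]), ([r], io, []), ([r], pr, []), ([r], eB, [a])]"
    by (rule plain_step[where i = 0, OF mR_def]) simp_all
  also have "?E \<dots>
      [([], pr, []), ([], mB, [a]), ([b, b], mA, []), ([b], psi, [a]), ([], io, [b, a]), ([r], pb, []), ([r], eB, [a])]"
    by (rule plain_step[where i = 5, OF split]) simp_all
  also have "?E \<dots>
      [([], pr, []), ([], mB, [a]), ([b, b], mA, []), ([b], psi, [a]), ([], io, [b, a]), ([r], eB, [a])]"
    by (rule step[where i = 1 and js = "[4]", OF m_bar_right]) simp_all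
  also have "?E \<dots>
      [([], pr, []), ([], pb, []), ([b], mA, []), ([], io, [a])]"
    by (rule step[where i = 1 and js = "[4]", OF m_eB]) simp_all
  also have "?E \<dots> ?y"
    by (rule plain_step[where i = 0, OF pr_pb]) simp_all
  finally show ?thesis .
qed

lemma io_left:
  "\<langle>k, [b, r]\<rangle> [([], io, []), ([], mR, []), ([], be, [r])]
    \<approx> [([], mB, [a]), ([b], io, [])]" (is "eqd _ _ ?x ?y")
proof -
  let ?E = "eqd k [b, r]"
  have "?E ?x
      [([], io, []), ([], pr, []), ([], mB, [a]), ([b], io, [])]"
    by (rule plain_step[where i = 1, OF mR_be]) simp_all
  also have "?E \<dots>
      [([], pb, []), ([], mB, [a]), ([b], io, [])]"
    by (rule plain_step[where i = 0, OF split]) simp_all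
  also have "?E \<dots>
      [([], mB, [a]), ([b], pb, []), ([b], io, [])]"
    by (rule plain_step[where i = 0, OF pb_mB]) simp_all
  also have "?E \<dots> ?y"
    by (rule plain_step[where i = 1, OF pb_io]) simp_all
  finally show ?thesis .
qed

lemma io_right:
  "\<langle>k, [r, a]\<rangle> [([], io, []), ([], mR, []), ([r], al, [])]
    \<approx> [([b], mA, []), ([], io, [a])]" (is "eqd _ _ ?x ?y")
proof -
  let ?E = "eqd k [r, a]"
  have "?E ?x
      [([], io, []), ([], pr, []), ([b], mA, []), ([], io, [a])]"
    by (rule plain_step[where i = 1, OF mR_al]) simp_all
  also have "?E \<dots>
      [([], pb, []), ([b], mA, []), ([], io, [a])]"
    by (rule plain_step[where i = 0, OF split]) simp_all
  also have "?E \<dots>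
      [([b], mA, []), ([], pb, [a]), ([], io, [a])]"
    by (rule plain_step[where i = 0, OF pb_mA]) simp_all
  also have "?E \<dots> ?y"
    by (rule plain_step[where i = 1, OF pb_io]) simp_all
  finally show ?thesis .
qed

text \<open>The map \<open>\<pi>\<close> of the new structure is the given retraction.\<close>

lemma pi_pr:
  "\<langle>k, [b, a]\<rangle> [([], mR, []), ([], be, [r]), ([b], al, [])]
    \<approx> [([], pr, [])]" (is "eqd _ _ ?x ?y")
proof -
  let ?E = "eqd k [b, a]"
  have "?E ?x
      [([], mR, []), ([], pr, [r]), ([b], eA, [r]), ([b], al, [])]"
    by (rule plain_step[where i = 1, OF be_def]) simp_all
  also have "?E \<dots>
      [([], mR, []), ([], pr, [r]), ([b], eA, [r]), ([b], pr, []), ([b], eB, [a])]"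
    by (rule plain_step[where i = 3, OF al_def]) simp_all
  also have "?E \<dots>
      [([], pr, []), ([], mB, [a]), ([b, b], mA, []), ([b], psi, [a]), ([b], eA, [b, a]), ([b], eB, [a])]"
    by (rule step[where i = 0 and js = "[2]", OF mR_pr]) simp_all
  also have "?E \<dots>
      [([], pr, []), ([], pb, []), ([], mB, [a]), ([b], eB, [a])]"
    by (rule plain_step[where i = 1, OF m_eA]) simp_all
  also have "?E \<dots>
      [([], pr, []), ([], mB, [a]), ([b], eB, [a])]"
    by (rule plain_step[where i = 0, OF pr_pb]) simp_all
  also have "?E \<dots> ?y"
    by (rule plain_step[where i = 1, OF B.unitr]) simp_all
  finally show ?thesis .
qed

lemma pi_io:
  "\<langle>k, [r]\<rangle> [([], mR, []), ([], be, [r]), ([b], al, []), ([], io, [])]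
    \<approx> []" (is "eqd _ _ ?x ?y")
proof -
  let ?E = "eqd k [r]"
  have "?E ?x
      [([], pr, []), ([], io, [])]"
    by (rule plain_step[where i = 0, OF pi_pr]) simp_all
  also have "?E \<dots> ?y"
    by (rule plain_step[where i = 0, OF retract]) simp_all
  finally show ?thesis .
qed

text \<open>The unit of \<open>R\<close> is the image of the unit of \<open>B\<close>, and \<open>\<beta>\<close> acts on \<open>R\<close> through the multiplication of \<open>B\<close>.\<close>

lemma unitlR:
  "\<langle>k, [r]\<rangle> [([], mR, []), ([], eR, [r])]
    \<approx> []" (is "eqd _ _ ?x ?y")
proof -
  let ?E = "eqd k [r]"
  have "?E ?x
      [([], mR, []), ([], be, [r]), ([], eB, [r])]"
    by (rule plain_step[where i = 1, OF be_unt[symmetric]]) simp_all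
  also have "?E \<dots>
      [([], pr, []), ([], mB, [a]), ([b], io, []), ([], eB, [r])]"
    by (rule plain_step[where i = 0, OF mR_be]) simp_all
  also have "?E \<dots>
      [([], pr, []), ([], io, [])]"
    by (rule step[where i = 1 and js = "[2]", OF B.unitl]) simp_all
  also have "?E \<dots> ?y"
    by (rule plain_step[where i = 0, OF retract]) simp_all
  finally show ?thesis .
qed

lemma unitrR:
  "\<langle>k, [r]\<rangle> [([], mR, []), ([r], eR, [])]
    \<approx> []" (is "eqd _ _ ?x ?y")
proof -
  let ?E = "eqd k [r]"
  have "?E ?x
      [([], mR, []), ([r], al, []), ([r], eA, [])]"
    by (rule plain_step[where i = 1, OF al_unt[symmetric]]) simp_all
  also have "?E \<dots>
      [([], pr, []), ([b], mA, []), ([], io, [a]), ([r], eA, [])]"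
    by (rule plain_step[where i = 0, OF mR_al]) simp_all
  also have "?E \<dots>
      [([], pr, []), ([], io, [])]"
    by (rule step[where i = 1 and js = "[2]", OF A.unitr]) simp_all
  also have "?E \<dots> ?y"
    by (rule plain_step[where i = 0, OF retract]) simp_all
  finally show ?thesis .
qed

text \<open>The new structure induces the given law.\<close>

lemma psi_io:
  "\<langle>k, [a, b]\<rangle> [([], io, []), ([], mR, []), ([], al, [r]), ([a], be, [])]
    \<approx> [([], psi, [])]" (is "eqd _ _ ?x ?y")
proof -
  let ?E = "eqd k [a, b]"
  have "?E ?x
      [([], io, []), ([], mR, []), ([], pr, [r]), ([], eB, [a, r]), ([a], be, [])]"
    by (rule plain_step[where i = 2, OF al_def]) simp_all
  also have "?E \<dots>
      [([], io, []), ([], mR, []), ([], pr, [r]), ([], eB, [a, r]), ([a], pr, []), ([a, b], eA, [])]"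
    by (rule plain_step[where i = 4, OF be_def]) simp_all
  also have "?E \<dots>
      [([], io, []), ([], pr, []), ([], mB, [a]), ([b, b], mA, []), ([b], psi, [a]), ([], eB, [a, b, a]), ([a, b], eA, [])]"
    by (rule step[where i = 1 and js = "[3]", OF mR_pr]) simp_all
  also have "?E \<dots>
      [([], pb, []), ([], mB, [a]), ([], eB, [b, a]), ([b], mA, []), ([], psi, [a]), ([a, b], eA, [])]"
    by (rule step[where i = 0 and js = "[4, 3]", OF split]) simp_all
  also have "?E \<dots>
      [([], mB, [a]), ([b, b], mA, []), ([b], psi, [a]), ([], eB, [a, b, a]), ([a, b], eA, [])]"
    by (rule step[where i = 0 and js = "[2, 3]", OF bar_m]) simp_all
  also have "?E \<dots>
      [([], mB, [a]), ([], eB, [b, a]), ([], psi, [])]"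
    by (rule step[where i = 0 and js = "[0, 2, 3, 2, 1]", OF A.unitr]) simp_all
  also have "?E \<dots> ?y"
    by (rule plain_step[where i = 0, OF B.unitl]) simp_all
  finally show ?thesis .
qed

end

section \<open>Monad morphisms and weak distributive laws\<close>

context bicategory
begin

lemma rep_hom2: "rep s t f w \<Longrightarrow> f \<in> hom2 K (tm s) (tm t)"
  by (simp add: rep_def)

text \<open>Hypotheses on 2-cells give instances of the diagram locales; the conclusions obtained there are turned back
  into equations of 2-cells.\<close>

lemma monad_diagrams: "is_monad K A \<Longrightarrow> monad_diagrams K (mobj K A) (mnd A) (mul A) (unt A)"
  by unfold_locales (auto simp: is_monad_iff gentype_def premonad_def)

lemma is_monadD [simp]:
  assumes "is_monad K A"
  shows "premonad A" "mnd A \<in> Mor K" "Trg K (mnd A) = mobj K A" "mobj K A \<in> Ob K"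
  using is_monad_premonad[OF assms] by simp_all

lemma monad_morphismD:
  assumes "monad_morphism K A A' V \<xi>"
  shows "is_monad K A" "is_monad K A'" "V \<in> Mor K" "Src K V = mobj K A" "Trg K V = mobj K A'"
    "\<xi> \<in> hom2 K (mnd A' \<otimes> V) (V \<otimes> mnd A)"
  using assms by (auto simp: monad_morphism_def Let_def hom1_def)

lemma rep_monad_morphism:
  assumes "monad_morphism K A A' V \<xi>"
  shows "rep (Leaf (mnd A') \<odot> Leaf V) (Leaf V \<odot> Leaf (mnd A)) \<xi> [([], box [mnd A', V] [V, mnd A] \<xi>, [])]"
  by (rule rep_box) (use monad_morphismD[OF assms] in simp_all)

lemma monad_morphism_diagrams:
  assumes "monad_morphism K A A' V \<xi>"
  shows "monad_morphism_diagrams K (mobj K A) (mnd A) (mul A) (unt A) (mobj K A') (mnd A') (mul A') (unt A')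
    V (box [mnd A', V] [V, mnd A] \<xi>)"
proof -
  note m = monad_morphismD[OF assms]
  note [simp] = m
  interpret S: monad_diagrams K "mobj K A" "mnd A" "mul A" "unt A" by (rule monad_diagrams[OF m(1)])
  interpret T: monad_diagrams K "mobj K A'" "mnd A'" "mul A'" "unt A'" by (rule monad_diagrams[OF m(2)])
  have iff: "monad_morphism K A A' V \<xi> \<longleftrightarrow>
      \<langle>mobj K A, mnd A' # mnd A' # [V]\<rangle> [([], box [mnd A', V] [V, mnd A] \<xi>, [])] @ [([], mul A', [V])]
      \<approx> ([V], mul A, []) # whisk [] [([], box [mnd A', V] [V, mnd A] \<xi>, [])] [mnd A] @ whisk [mnd A'] [([], box [mnd A', V] [V, mnd A] \<xi>, [])] [] \<and>
    \<langle>mobj K A, [V]\<rangle> [([], box [mnd A', V] [V, mnd A] \<xi>, [])] @ [([], unt A', [V])] \<approx> [([V], unt A, [])]"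
    using monad_morphism_iff[OF m(1,2) _ _ _ _ rep_monad_morphism[OF assms]] by simp
  show ?thesis
    by unfold_locales (use assms iff in \<open>auto simp: gentype_def hom1_def\<close>)
qed

lemma mm_id_monad_morphism:
  assumes "is_monad K A" "k = mobj K A"
  shows "monad_morphism K A A (id1 K k) (mm_id K A)"
proof -
  show ?thesis unfolding assms(2)
    by (subst monad_morphism_iff[OF assms(1,1) _ _ _ _ rep_mm_id]) (use assms(1) in \<open>auto intro!: eqd_refl\<close>)
qed

lemma mm_comp_monad_morphism:
  assumes f: "monad_morphism K A A' V \<xi>" and g: "monad_morphism K A' A'' V' \<xi>'"
  shows "monad_morphism K A A'' (V' \<otimes> V) (mm_comp K A A' A'' V' \<xi>' V \<xi>)"
proof -
  note m = monad_morphismD[OF f] monad_morphismD[OF g]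
  note [simp] = m
  note C = monad_morphism_composite.intro[OF bicategory_axioms monad_morphism_diagrams[OF f] monad_morphism_diagrams[OF g]]
  have r: "rep (Leaf (mnd A'') \<odot> Leaf V' \<odot> Leaf V) ((Leaf V' \<odot> Leaf V) \<odot> Leaf (mnd A))
    (mm_comp K A A' A'' V' \<xi>' V \<xi>)
    [([V'], box [mnd A', V] [V, mnd A] \<xi>, []), ([], box [mnd A'', V'] [V', mnd A'] \<xi>', [V])]"
    by (rule rep_word, rule rep_mm_comp[OF _ _ _ _ _ _ _ _ _ rep_monad_morphism[OF f] rep_monad_morphism[OF g]]) simp_all
  show ?thesis
    by (subst monad_morphism_iff[OF m(1,8) _ _ _ _ r]) (use monad_morphism_composite.comp_mul[OF C] monad_morphism_composite.comp_unt[OF C] in simp_all)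
qed

lemma monad_transformationD:
  assumes "monad_transformation K A A' V \<xi> U \<upsilon> \<omega>"
  shows "\<omega> \<in> Cell K" "Dom K \<omega> = V" "Cod K \<omega> = U" "\<upsilon> \<cdot> (mnd A' \<lhd> \<omega>) = (\<omega> \<rhd> mnd A) \<cdot> \<xi>"
  using assms by (auto simp: monad_transformation_def in_hom2)

lemma monad_transformation_id:
  assumes "monad_morphism K A A' V \<xi>"
  shows "monad_transformation K A A' V \<xi> V \<xi> (id2 K V)"
  using monad_morphismD[OF assms] by (simp add: monad_transformation_def in_hom2)

lemma monad_transformation_vcomp:
  assumes V: "monad_morphism K A A' V \<xi>" and U: "monad_morphism K A A' U \<upsilon>" and W: "monad_morphism K A A' W \<tau>"
    and f: "monad_transformation K A A' V \<xi> U \<upsilon> \<phi>" and g: "monad_transformation K A A' U \<upsilon> W \<tau> \<psi>"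
  shows "monad_transformation K A A' V \<xi> W \<tau> (\<psi> \<cdot> \<phi>)"
proof -
  note [simp] = monad_morphismD[OF V] monad_morphismD[OF U] monad_morphismD[OF W]
  note F = monad_transformationD[OF f] and G = monad_transformationD[OF g]
  note [simp] = F(1-3) G(1-3)
  have [simp]: "\<xi> \<in> Cell K" "Dom K \<xi> = mnd A' \<otimes> V" "Cod K \<xi> = V \<otimes> mnd A"
    "\<upsilon> \<in> Cell K" "Dom K \<upsilon> = mnd A' \<otimes> U" "Cod K \<upsilon> = U \<otimes> mnd A"
    "\<tau> \<in> Cell K" "Dom K \<tau> = mnd A' \<otimes> W" "Cod K \<tau> = W \<otimes> mnd A"
    using monad_morphismD(6)[OF V] monad_morphismD(6)[OF U] monad_morphismD(6)[OF W] by (auto simp: in_hom2)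
  have "\<tau> \<cdot> (mnd A' \<lhd> (\<psi> \<cdot> \<phi>)) = (\<tau> \<cdot> (mnd A' \<lhd> \<psi>)) \<cdot> (mnd A' \<lhd> \<phi>)"
    by (simp add: lwhisk_vcomp)
  also have "\<dots> = (\<psi> \<rhd> mnd A) \<cdot> (\<upsilon> \<cdot> (mnd A' \<lhd> \<phi>))"
    unfolding G(4) by simp
  also have "\<dots> = ((\<psi> \<cdot> \<phi>) \<rhd> mnd A) \<cdot> \<xi>"
    unfolding F(4) by (simp add: rwhisk_vcomp)
  finally show ?thesis by (simp add: monad_transformation_def in_hom2)
qed

lemma monad_transformation_inv:
  assumes V: "monad_morphism K A A' V \<xi>" and U: "monad_morphism K A A' U \<upsilon>"
    and f: "monad_transformation K A A' V \<xi> U \<upsilon> \<phi>" and i: "iso \<phi>"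
  shows "monad_transformation K A A' U \<upsilon> V \<xi> (inv2 K \<phi>)"
proof -
  note [simp] = monad_morphismD[OF V] monad_morphismD[OF U] i
  note F = monad_transformationD[OF f]
  note [simp] = F(1-3)
  have [simp]: "\<xi> \<in> Cell K" "Dom K \<xi> = mnd A' \<otimes> V" "Cod K \<xi> = V \<otimes> mnd A"
    "\<upsilon> \<in> Cell K" "Dom K \<upsilon> = mnd A' \<otimes> U" "Cod K \<upsilon> = U \<otimes> mnd A"
    using monad_morphismD(6)[OF V] monad_morphismD(6)[OF U] by (auto simp: in_hom2)
  have "\<xi> \<cdot> (mnd A' \<lhd> inv2 K \<phi>) = ((inv2 K \<phi> \<cdot> \<phi>) \<rhd> mnd A) \<cdot> \<xi> \<cdot> (mnd A' \<lhd> inv2 K \<phi>)"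
    by simp
  also have "\<dots> = (inv2 K \<phi> \<rhd> mnd A) \<cdot> ((\<phi> \<rhd> mnd A) \<cdot> \<xi>) \<cdot> (mnd A' \<lhd> inv2 K \<phi>)"
    by (subst rwhisk_vcomp) simp_all
  also have "\<dots> = (inv2 K \<phi> \<rhd> mnd A) \<cdot> \<upsilon> \<cdot> (mnd A' \<lhd> (\<phi> \<cdot> inv2 K \<phi>))"
    unfolding F(4)[symmetric] by (subst lwhisk_vcomp) simp_all
  also have "\<dots> = (inv2 K \<phi> \<rhd> mnd A) \<cdot> \<upsilon>" by simp
  finally show ?thesis by (simp add: monad_transformation_def in_hom2)
qed

text \<open>Coherence 2-cells are monad transformations because both of their monad morphisms have the same diagram.\<close>

lemma monad_transformation_trivial:
  assumes A: "is_monad K A" "is_monad K A'"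
    and v: "tok v" "tsrc v = mobj K A" "ttrg v = mobj K A'" "V = tm v"
    and u: "tok u" "tsrc u = mobj K A" "ttrg u = mobj K A'" "U = tm u"
    and x: "rep (Leaf (mnd A') \<odot> v) (v \<odot> Leaf (mnd A)) \<xi> x"
    and y: "rep (Leaf (mnd A') \<odot> u) (u \<odot> Leaf (mnd A)) \<upsilon> x"
    and o: "rep v u \<omega> []"
  shows "monad_transformation K A A' V \<xi> U \<upsilon> \<omega>"
  using monad_transformation_iff[OF is_monad_premonad[OF A(1)] is_monad_premonad[OF A(2)] v u x y o]
    repD(8)[OF x] v(2) by (simp add: eqd_refl)

lemma rep_mm_comp2:
  assumes f: "monad_morphism K A A' V \<xi>" and g: "monad_morphism K A' A'' V' \<xi>'"
  shows "rep (Leaf (mnd A'') \<odot> Leaf V' \<odot> Leaf V) ((Leaf V' \<odot> Leaf V) \<odot> Leaf (mnd A))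
    (mm_comp K A A' A'' V' \<xi>' V \<xi>)
    [([V'], box [mnd A', V] [V, mnd A] \<xi>, []), ([], box [mnd A'', V'] [V', mnd A'] \<xi>', [V])]"
proof -
  note [simp] = monad_morphismD[OF f] monad_morphismD[OF g]
  show ?thesis
    by (rule rep_word, rule rep_mm_comp[OF _ _ _ _ _ _ _ _ _ rep_monad_morphism[OF f] rep_monad_morphism[OF g]]) simp_all
qed

lemma monad_transformation_asc:
  assumes f: "monad_morphism K A A' V \<xi>" and g: "monad_morphism K A' A'' V' \<xi>'" and h: "monad_morphism K A'' A''' V'' \<xi>''"
  shows "monad_transformation K A A'''
    ((V'' \<otimes> V') \<otimes> V) (mm_comp K A A' A''' (V'' \<otimes> V') (mm_comp K A' A'' A''' V'' \<xi>'' V' \<xi>') V \<xi>)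
    (V'' \<otimes> (V' \<otimes> V)) (mm_comp K A A'' A''' V'' \<xi>'' (V' \<otimes> V) (mm_comp K A A' A'' V' \<xi>' V \<xi>))
    (\<a> V'' V' V)"
proof -
  note [simp] = monad_morphismD[OF f] monad_morphismD[OF g] monad_morphismD[OF h]
  note rf = rep_monad_morphism[OF f] and rh = rep_monad_morphism[OF h]
  note rgf = rep_mm_comp2[OF f g] and rhg = rep_mm_comp2[OF g h]
  have 1: "rep (Leaf (mnd A''') \<odot> (Leaf V'' \<odot> Leaf V') \<odot> Leaf V) (((Leaf V'' \<odot> Leaf V') \<odot> Leaf V) \<odot> Leaf (mnd A))
    (mm_comp K A A' A''' (V'' \<otimes> V') (mm_comp K A' A'' A''' V'' \<xi>'' V' \<xi>') V \<xi>)
    [([V'', V'], box [mnd A', V] [V, mnd A] \<xi>, []), ([V''], box [mnd A'', V'] [V', mnd A'] \<xi>', [V]),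
     ([], box [mnd A''', V''] [V'', mnd A''] \<xi>'', [V', V])]"
    by (rule rep_word, rule rep_mm_comp[OF _ _ _ _ _ _ _ _ _ rf rhg]) simp_all
  have 2: "rep (Leaf (mnd A''') \<odot> Leaf V'' \<odot> Leaf V' \<odot> Leaf V) ((Leaf V'' \<odot> Leaf V' \<odot> Leaf V) \<odot> Leaf (mnd A))
    (mm_comp K A A'' A''' V'' \<xi>'' (V' \<otimes> V) (mm_comp K A A' A'' V' \<xi>' V \<xi>))
    [([V'', V'], box [mnd A', V] [V, mnd A] \<xi>, []), ([V''], box [mnd A'', V'] [V', mnd A'] \<xi>', [V]),
     ([], box [mnd A''', V''] [V'', mnd A''] \<xi>'', [V', V])]"
    by (rule rep_word, rule rep_mm_comp[OF _ _ _ _ _ _ _ _ _ rgf rh]) simp_all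
  show ?thesis
    by (rule monad_transformation_trivial[OF _ _ _ _ _ _ _ _ _ _ 1 2 rep_asc]) simp_all
qed

lemma monad_transformation_lun:
  assumes f: "monad_morphism K A A' V \<xi>" and k: "k = mobj K A'"
  shows "monad_transformation K A A' (id1 K k \<otimes> V) (mm_comp K A A' A' (id1 K k) (mm_id K A') V \<xi>) V \<xi> (\<l> V)"
proof -
  note [simp] = monad_morphismD[OF f] k
  have 1: "rep (Leaf (mnd A') \<odot> Unit (mobj K A') \<odot> Leaf V) ((Unit (mobj K A') \<odot> Leaf V) \<odot> Leaf (mnd A))
    (mm_comp K A A' A' (id1 K (mobj K A')) (mm_id K A') V \<xi>) [([], box [mnd A', V] [V, mnd A] \<xi>, [])]"
    by (rule rep_word, rule rep_mm_comp[OF _ _ _ _ _ _ _ _ _ rep_monad_morphism[OF f] rep_mm_id]) simp_all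
  show ?thesis unfolding k
    by (rule monad_transformation_trivial[OF _ _ _ _ _ _ _ _ _ _ 1 rep_monad_morphism[OF f] rep_lun]) simp_all
qed

lemma monad_transformation_run:
  assumes f: "monad_morphism K A A' V \<xi>" and k: "k = mobj K A"
  shows "monad_transformation K A A' (V \<otimes> id1 K k) (mm_comp K A A A' V \<xi> (id1 K k) (mm_id K A)) V \<xi> (\<r> V)"
proof -
  note [simp] = monad_morphismD[OF f] k
  have 1: "rep (Leaf (mnd A') \<odot> Leaf V \<odot> Unit (mobj K A)) ((Leaf V \<odot> Unit (mobj K A)) \<odot> Leaf (mnd A))
    (mm_comp K A A A' V \<xi> (id1 K (mobj K A)) (mm_id K A)) [([], box [mnd A', V] [V, mnd A] \<xi>, [])]"
    by (rule rep_word, rule rep_mm_comp[OF _ _ _ _ _ _ _ _ _ rep_mm_id rep_monad_morphism[OF f]]) simp_all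
  show ?thesis unfolding k
    by (rule monad_transformation_trivial[OF _ _ _ _ _ _ _ _ _ _ 1 rep_monad_morphism[OF f] rep_run]) simp_all
qed

lemma rep_transformation:
  assumes V: "monad_morphism K A A' V \<xi>" and U: "monad_morphism K A A' U \<upsilon>"
    and t: "monad_transformation K A A' V \<xi> U \<upsilon> \<omega>"
  shows "rep (Leaf V) (Leaf U) \<omega> [([], box [V] [U] \<omega>, [])]"
    and "gentype (mobj K A) [V] [U] (box [V] [U] \<omega>)"
    and "\<langle>mobj K A, [mnd A', V]\<rangle> [([], box [mnd A', U] [U, mnd A] \<upsilon>, []), ([mnd A'], box [V] [U] \<omega>, [])]
      \<approx> [([], box [V] [U] \<omega>, [mnd A]), ([], box [mnd A', V] [V, mnd A] \<xi>, [])]"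
proof -
  note [simp] = monad_morphismD[OF V] monad_morphismD[OF U]
  have [simp]: "\<omega> \<in> hom2 K V U" using t by (simp add: monad_transformation_def)
  show r: "rep (Leaf V) (Leaf U) \<omega> [([], box [V] [U] \<omega>, [])]" by (rule rep_box) simp_all
  show "gentype (mobj K A) [V] [U] (box [V] [U] \<omega>)" by (auto simp: gentype_def)
  show "\<langle>mobj K A, [mnd A', V]\<rangle> [([], box [mnd A', U] [U, mnd A] \<upsilon>, []), ([mnd A'], box [V] [U] \<omega>, [])]
      \<approx> [([], box [V] [U] \<omega>, [mnd A]), ([], box [mnd A', V] [V, mnd A] \<xi>, [])]"
    using monad_transformation_iff[OF _ _ _ _ _ _ _ _ _ _ rep_monad_morphism[OF V] rep_monad_morphism[OF U] r] t by simp
qed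

lemma monad_transformation_hcomp:
  assumes V: "monad_morphism K A A' V \<xi>" and U: "monad_morphism K A A' U \<upsilon>"
    and V': "monad_morphism K A' A'' V' \<xi>'" and U': "monad_morphism K A' A'' U' \<upsilon>'"
    and t: "monad_transformation K A A' V \<xi> U \<upsilon> \<omega>" and t': "monad_transformation K A' A'' V' \<xi>' U' \<upsilon>' \<omega>'"
  shows "monad_transformation K A A'' (V' \<otimes> V) (mm_comp K A A' A'' V' \<xi>' V \<xi>) (U' \<otimes> U) (mm_comp K A A' A'' U' \<upsilon>' U \<upsilon>) (\<omega>' \<star> \<omega>)"
proof -
  note m = monad_morphismD[OF V] monad_morphismD[OF U] monad_morphismD[OF V'] monad_morphismD[OF U']
  note [simp] = m
  interpret H: transformation_hcomp K "mobj K A" "mobj K A'" "mobj K A''" "mnd A" "mnd A'" "mnd A''" V U V' U'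
    "box [mnd A', V] [V, mnd A] \<xi>" "box [mnd A', U] [U, mnd A] \<upsilon>"
    "box [mnd A'', V'] [V', mnd A'] \<xi>'" "box [mnd A'', U'] [U', mnd A'] \<upsilon>'" "box [V] [U] \<omega>" "box [V'] [U'] \<omega>'"
    using rep_transformation(2,3)[OF V U t] rep_transformation(2,3)[OF V' U' t']
    by unfold_locales (auto simp: hom1_def gentype_def)
  have o: "rep (Leaf V' \<odot> Leaf V) (Leaf U' \<odot> Leaf U) (\<omega>' \<star> \<omega>)
    [([], box [V'] [U'] \<omega>', [U]), ([V'], box [V] [U] \<omega>, [])]"
    by (rule rep_word, rule rep_hcomp[OF rep_transformation(1)[OF V' U' t'] rep_transformation(1)[OF V U t]]) simp_all
  show ?thesis
    using H.tr_hcomp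
      monad_transformation_iff[OF _ _ _ _ _ _ _ _ _ _ rep_mm_comp2[OF V V'] rep_mm_comp2[OF U U'] o] by simp
qed

lemma intertwiner_comp:
  assumes V: "monad_morphism K A A' V \<xi>" and V': "monad_morphism K A' A'' V' \<xi>'"
    and W: "monad_morphism K R R' V \<rho>" and W': "monad_morphism K R' R'' V' \<rho>'"
    and al: "monad_map K A R \<alpha>" "monad_map K A' R' \<alpha>'" "monad_map K A'' R'' \<alpha>''"
    and i: "\<rho> \<cdot> (\<alpha>' \<rhd> V) = (V \<lhd> \<alpha>) \<cdot> \<xi>" and i': "\<rho>' \<cdot> (\<alpha>'' \<rhd> V') = (V' \<lhd> \<alpha>') \<cdot> \<xi>'"
  shows "mm_comp K R R' R'' V' \<rho>' V \<rho> \<cdot> (\<alpha>'' \<rhd> (V' \<otimes> V)) = ((V' \<otimes> V) \<lhd> \<alpha>) \<cdot> mm_comp K A A' A'' V' \<xi>' V \<xi>"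
proof -
  note m = monad_morphismD[OF V] monad_morphismD[OF V'] monad_morphismD[OF W] monad_morphismD[OF W']
  note [simp] = m(1-3,6-9,12-15,18-21,24) m(4,5,11)
  have o [simp]: "mobj K R = mobj K A" "mobj K R' = mobj K A'" "mobj K R'' = mobj K A''"
    using m(4,5,11,16,17,23) by metis+
  have h [simp]: "\<alpha> \<in> hom2 K (mnd A) (mnd R)" "\<alpha>' \<in> hom2 K (mnd A') (mnd R')" "\<alpha>'' \<in> hom2 K (mnd A'') (mnd R'')"
    using al by (auto simp: monad_map_def)
  have [simp]: "Src K V' = mobj K A'" using m(10) .
  have h1: "mnd A \<in> hom1 K (mobj K A) (mobj K A)" "mnd A' \<in> hom1 K (mobj K A') (mobj K A')" "mnd A'' \<in> hom1 K (mobj K A'') (mobj K A'')"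
    "mnd R \<in> hom1 K (mobj K A) (mobj K A)" "mnd R' \<in> hom1 K (mobj K A') (mobj K A')" "mnd R'' \<in> hom1 K (mobj K A'') (mobj K A'')"
    by (auto simp: hom1_def)
  interpret H: intertwiner_composite K "mobj K A" "mobj K A'" "mobj K A''" "mnd A" "mnd A'" "mnd A''" "mnd R" "mnd R'" "mnd R''"
    V V' "box [mnd A', V] [V, mnd A] \<xi>" "box [mnd R', V] [V, mnd R] \<rho>"
    "box [mnd A'', V'] [V', mnd A'] \<xi>'" "box [mnd R'', V'] [V', mnd R'] \<rho>'"
    "box [mnd A] [mnd R] \<alpha>" "box [mnd A'] [mnd R'] \<alpha>'" "box [mnd A''] [mnd R''] \<alpha>''"
  proof unfold_locales
    show "\<langle>mobj K A, [mnd A', V]\<rangle> [([], box [mnd R', V] [V, mnd R] \<rho>, []), ([], box [mnd A'] [mnd R'] \<alpha>', [V])]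
      \<approx> [([V], box [mnd A] [mnd R] \<alpha>, []), ([], box [mnd A', V] [V, mnd A] \<xi>, [])]"
      using intertwine_iff[OF h(1,2) h1(1,4,2,5) _ _ _ _ rep_monad_morphism[OF V] rep_monad_morphism[OF W]] i by simp
    show "\<langle>mobj K A', [mnd A'', V']\<rangle> [([], box [mnd R'', V'] [V', mnd R'] \<rho>', []), ([], box [mnd A''] [mnd R''] \<alpha>'', [V'])]
      \<approx> [([V'], box [mnd A'] [mnd R'] \<alpha>', []), ([], box [mnd A'', V'] [V', mnd A'] \<xi>', [])]"
      using intertwine_iff[OF h(2,3) h1(2,5,3,6) _ _ _ _ rep_monad_morphism[OF V'] rep_monad_morphism[OF W']] i' by simp
  qed (use h1 in \<open>auto simp: hom1_def gentype_def\<close>)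
  show ?thesis
    using H.int_comp
      intertwine_iff[OF h(1,3) h1(1,4,3,6) _ _ _ _ rep_mm_comp2[OF V V'] rep_mm_comp2[OF W W']] by simp
qed

lemma monad_diagrams': "is_monad K A \<Longrightarrow> mobj K A = k \<Longrightarrow> monad_diagrams K k (mnd A) (mul A) (unt A)"
  using monad_diagrams by auto

lemma monad_morphism_diagrams':
  "monad_morphism K A A' V \<xi> \<Longrightarrow> mobj K A = k \<Longrightarrow> mobj K A' = k'
    \<Longrightarrow> monad_morphism_diagrams K k (mnd A) (mul A) (unt A) k' (mnd A') (mul A') (unt A')
      V (box [mnd A', V] [V, mnd A] \<xi>)"
  using monad_morphism_diagrams by auto

lemma law_diagrams:
  assumes law: "weak_distributive_law K A B \<Psi>" and k: "mobj K B = k"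
    and ab: "mnd A = a" "mnd B = b"
  shows "law_diagrams K k a (mul A) (unt A) b (mul B) (unt B)
    (box [a, b] [b, a] \<Psi>) (box [b, a] [b, a] (Psi_bar K A B \<Psi>))"
proof -
  note iff = law[unfolded weak_distributive_law_iff[OF ab k]]
  hence pre: "prelaw A B \<Psi>" by simp
  have A: "is_monad K A" "mobj K A = k" and B: "is_monad K B" and h [simp]: "\<Psi> \<in> hom2 K (a \<otimes> b) (b \<otimes> a)"
    using pre k by (auto simp: prelaw_def ab)
  interpret A: monad_diagrams K k a "mul A" "unt A" using monad_diagrams'[OF A] ab by simp
  interpret B: monad_diagrams K k b "mul B" "unt B" using monad_diagrams'[OF B k] ab by simp
  note r = rep_Psi_bar[OF pre ab]
  have h' [simp]: "Psi_bar K A B \<Psi> \<in> hom2 K (b \<otimes> a) (b \<otimes> a)" using rep_hom2[OF r] by simp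
  have "rep (Leaf b \<odot> Leaf a) (Leaf b \<odot> Leaf a) (Psi_bar K A B \<Psi>)
     [([], box [b, a] [b, a] (Psi_bar K A B \<Psi>), [])]"
    by (rule rep_box) simp_all
  from diagram_eq_iff[OF this r, of k "[b, a]"]
  show ?thesis using iff by unfold_locales (simp_all add: gentype_def)
qed

lemma Psi_bar_hom:
  assumes "weak_distributive_law K A B \<Psi>"
  shows "Psi_bar K A B \<Psi> \<in> hom2 K (mnd B \<otimes> mnd A) (mnd B \<otimes> mnd A)" "prelaw A B \<Psi>"
proof -
  show "prelaw A B \<Psi>" using assms weak_distributive_law_iff[of A _ B] by simp
  from rep_hom2[OF rep_Psi_bar[OF this refl refl]]
  show "Psi_bar K A B \<Psi> \<in> hom2 K (mnd B \<otimes> mnd A) (mnd B \<otimes> mnd A)" by simp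
qed

lemma is_wdl1D:
  assumes "is_wdl1 K (WDL1 (WDL A B \<Psi>) (WDL A' B' \<Psi>') V \<xi> \<zeta>)"
  shows "weak_distributive_law K A B \<Psi>" "weak_distributive_law K A' B' \<Psi>'"
    "monad_morphism K A A' V \<xi>" "monad_morphism K B B' V \<zeta>" "prelaw A B \<Psi>" "prelaw A' B' \<Psi>'"
    "mobj K A = mobj K B" "mobj K A' = mobj K B'"
  using assms Psi_bar_hom(2)[of A B \<Psi>] Psi_bar_hom(2)[of A' B' \<Psi>']
  by (auto simp: is_wdl1_def Let_def prelaw_def)

text \<open>Stated for an arbitrary bracketed 1-cell, so that it applies to composites and identities.\<close>

lemma is_wdl1_diagram_iff:
  assumes laws: "weak_distributive_law K A B \<Psi>" "weak_distributive_law K A' B' \<Psi>'"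
    and m: "monad_morphism K A A' V \<xi>" "monad_morphism K B B' V \<zeta>"
    and v: "tok v" "tsrc v = mobj K B" "ttrg v = mobj K B'" "V = tm v"
    and x: "rep (Leaf (mnd A') \<odot> v) (v \<odot> Leaf (mnd A)) \<xi> x" and z: "rep (Leaf (mnd B') \<odot> v) (v \<odot> Leaf (mnd B)) \<zeta> z"
  shows "is_wdl1 K (WDL1 (WDL A B \<Psi>) (WDL A' B' \<Psi>') V \<xi> \<zeta>) \<longleftrightarrow>
    \<langle>mobj K B, mnd A' # mnd B' # lv v\<rangle>
      (lv v, box [mnd B, mnd A] [mnd B, mnd A] (Psi_bar K A B \<Psi>), []) # whisk [] z [mnd A] @ whisk [mnd B'] x []
        @ [([], box [mnd A', mnd B'] [mnd B', mnd A'] \<Psi>', lv v)]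
      \<approx> (lv v, box [mnd A, mnd B] [mnd B, mnd A] \<Psi>, []) # whisk [] x [mnd B] @ whisk [mnd A'] z []"
  using wdl1_compatibility_iff[OF Psi_bar_hom(2)[OF laws(1)] refl refl refl Psi_bar_hom(2)[OF laws(2)] refl refl refl v x z]
    laws m by (simp add: is_wdl1_def Let_def)

lemma law_morphism_diagrams:
  assumes f: "is_wdl1 K (WDL1 (WDL A B \<Psi>) (WDL A' B' \<Psi>') V \<xi> \<zeta>)"
    and k: "mobj K B = k" "mobj K B' = k'" and ab: "mnd A = a" "mnd B = b" "mnd A' = a'" "mnd B' = b'"
  shows "law_morphism_diagrams K k a (mul A) (unt A) b (mul B) (unt B)
    (box [a, b] [b, a] \<Psi>) (box [b, a] [b, a] (Psi_bar K A B \<Psi>))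
    k' a' (mul A') (unt A') b' (mul B') (unt B')
    (box [a', b'] [b', a'] \<Psi>') (box [b', a'] [b', a'] (Psi_bar K A' B' \<Psi>'))
    V (box [a', V] [V, a] \<xi>) (box [b', V] [V, b] \<zeta>)"
proof -
  note d = is_wdl1D[OF f]
  interpret S: law_diagrams K k a "mul A" "unt A" b "mul B" "unt B"
    "box [a, b] [b, a] \<Psi>" "box [b, a] [b, a] (Psi_bar K A B \<Psi>)" by (rule law_diagrams[OF d(1) k(1) ab(1,2)])
  interpret T: law_diagrams K k' a' "mul A'" "unt A'" b' "mul B'" "unt B'"
    "box [a', b'] [b', a'] \<Psi>'" "box [b', a'] [b', a'] (Psi_bar K A' B' \<Psi>')" by (rule law_diagrams[OF d(2) k(2) ab(3,4)])
  interpret X: monad_morphism_diagrams K k a "mul A" "unt A" k' a' "mul A'" "unt A'" V "box [a', V] [V, a] \<xi>"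
    using monad_morphism_diagrams'[OF d(3), of k k'] d(7,8) k ab by simp
  interpret Z: monad_morphism_diagrams K k b "mul B" "unt B" k' b' "mul B'" "unt B'" V "box [b', V] [V, b] \<zeta>"
    using monad_morphism_diagrams'[OF d(4) k] ab by simp
  have "\<langle>k, [a', b', V]\<rangle>
    [([V], box [b, a] [b, a] (Psi_bar K A B \<Psi>), []), ([], box [b', V] [V, b] \<zeta>, [a]), ([b'], box [a', V] [V, a] \<xi>, []),
      ([], box [a', b'] [b', a'] \<Psi>', [V])]
    \<approx> [([V], box [a, b] [b, a] \<Psi>, []), ([], box [a', V] [V, a] \<xi>, [b]), ([a'], box [b', V] [V, b] \<zeta>, [])]"
    using is_wdl1_diagram_iff[OF d(1-4) _ _ _ _ rep_monad_morphism[OF d(3)] rep_monad_morphism[OF d(4)]] f k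
    by (simp add: ab)
  thus ?thesis by unfold_locales simp
qed

lemma wdl_comp1_closed:
  assumes g: "is_wdl1 K g" and f: "is_wdl1 K f" and gf: "w_src g = w_trg f"
  shows "is_wdl1 K (wdl_comp1 K g f)"
proof -
  obtain A B \<Psi> A' B' \<Psi>' V \<xi> \<zeta> where f': "f = WDL1 (WDL A B \<Psi>) (WDL A' B' \<Psi>') V \<xi> \<zeta>"
    by (metis wdl.exhaust wdl1.exhaust)
  obtain A'' B'' \<Psi>'' V' \<xi>' \<zeta>' where g': "g = WDL1 (WDL A' B' \<Psi>') (WDL A'' B'' \<Psi>'') V' \<xi>' \<zeta>'"
    using gf unfolding f' by (metis wdl.exhaust wdl1.collapse wdl1.sel(2))
  note F = is_wdl1D[OF f[unfolded f']] and G = is_wdl1D[OF g[unfolded g']]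
  note C = law_morphism_composite.intro[OF bicategory_axioms
      law_morphism_diagrams[OF f[unfolded f'] refl refl refl refl refl refl]
      law_morphism_diagrams[OF g[unfolded g'] refl refl refl refl refl refl]]
  note [simp] = monad_morphismD[OF F(3)] monad_morphismD[OF F(4)] monad_morphismD[OF G(3)] monad_morphismD[OF G(4)]
  have c: "wdl_comp1 K g f = WDL1 (WDL A B \<Psi>) (WDL A'' B'' \<Psi>'') (V' \<otimes> V)
    (mm_comp K A A' A'' V' \<xi>' V \<xi>) (mm_comp K B B' B'' V' \<zeta>' V \<zeta>)"
    by (simp add: wdl_comp1_def f' g' Let_def)
  show ?thesis unfolding c
    by (subst is_wdl1_diagram_iff[OF F(1) G(2) mm_comp_monad_morphism[OF F(3) G(3)] mm_comp_monad_morphism[OF F(4) G(4)]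
        _ _ _ _ rep_mm_comp2[OF F(3) G(3)] rep_mm_comp2[OF F(4) G(4)]])
      (use law_morphism_composite.comp_compat[OF C] F(7,8) G(8) in simp_all)
qed

text \<open>For the identity morphism the condition is \<open>\<Psi>bar \<Psi> = \<Psi>\<close>.\<close>

lemma wdl_id1_closed:
  assumes "weak_distributive_law K (wA X) (wB X) (w\<Psi> X)"
  shows "is_wdl1 K (wdl_id1 K X)"
proof (cases X)
  case (WDL A B \<Psi>)
  hence law: "weak_distributive_law K A B \<Psi>" using assms by simp
  have m: "is_monad K A" "is_monad K B" "mobj K A = mobj K B"
    using Psi_bar_hom(2)[OF law] by (auto simp: prelaw_def)
  have rA: "rep (Leaf (mnd A) \<odot> Unit (mobj K B)) (Unit (mobj K B) \<odot> Leaf (mnd A)) (mm_id K A) []"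
    using rep_mm_id[of A] m by simp
  have "is_wdl1 K (WDL1 (WDL A B \<Psi>) (WDL A B \<Psi>) (id1 K (mobj K B)) (mm_id K A) (mm_id K B))"
    by (subst is_wdl1_diagram_iff[OF law law mm_id_monad_morphism[OF m(1)] mm_id_monad_morphism[OF m(2)] _ _ _ _ rA rep_mm_id])
      (use m law_diagrams.pb_psi[OF law_diagrams[OF law refl refl refl]] in simp_all)
  thus ?thesis by (simp add: wdl_id1_def WDL m)
qed

end

section \<open>Bilinear factorization structures\<close>

context bicategory
begin

lemma is_bfsD:
  assumes "is_bfs K (BFS A B R \<alpha> \<beta> \<iota>)"
  shows "prefact A B R \<alpha> \<beta> \<iota>" "is_monad K A" "is_monad K B" "is_monad K R"
    "mobj K A = mobj K R" "mobj K B = mobj K R" "monad_map K A R \<alpha>" "monad_map K B R \<beta>"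
    "\<alpha> \<in> hom2 K (mnd A) (mnd R)" "\<beta> \<in> hom2 K (mnd B) (mnd R)" "\<iota> \<in> hom2 K (mnd R) (mnd B \<otimes> mnd A)"
proof -
  show p: "prefact A B R \<alpha> \<beta> \<iota>" using is_bfs_iff[OF refl refl refl refl] assms by blast
  show "monad_map K A R \<alpha>" "monad_map K B R \<beta>" using assms by (auto simp: is_bfs_def Let_def)
  show "is_monad K A" "is_monad K B" "is_monad K R"
    "mobj K A = mobj K R" "mobj K B = mobj K R"
    "\<alpha> \<in> hom2 K (mnd A) (mnd R)" "\<beta> \<in> hom2 K (mnd B) (mnd R)" "\<iota> \<in> hom2 K (mnd R) (mnd B \<otimes> mnd A)"
    using p by (simp_all add: prefact_def)
qed

lemma factorization_law:
  assumes X: "is_bfs K (BFS A B R \<alpha> \<beta> \<iota>)" and ab: "mnd A = a" "mnd B = b" "mnd R = r" "mobj K R = k"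
    and \<Psi>: "\<Psi> = \<iota> \<cdot> \<mu> R \<cdot> (\<alpha> \<star> \<beta>)"
  shows "factorization_law_diagrams K k a (mul A) (unt A) b (mul B) (unt B) r (mul R) (unt R)
      (box [a] [r] \<alpha>) (box [b] [r] \<beta>) (box [r] [b, a] \<iota>) (box [a, b] [b, a] \<Psi>) (box [b, a] [b, a] (Psi_bar K A B \<Psi>))"
    and "weak_distributive_law K A B \<Psi>"
proof -
  note iff = X[unfolded is_bfs_iff[OF ab]]
  note d = is_bfsD[OF X, unfolded ab]
  note [simp] = d(5,6,9-11)
  interpret A: monad_diagrams K k a "mul A" "unt A" using monad_diagrams'[OF d(2), of k] ab by simp
  interpret B: monad_diagrams K k b "mul B" "unt B" using monad_diagrams'[OF d(3), of k] ab by simp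
  interpret R: monad_diagrams K k r "mul R" "unt R" using monad_diagrams'[OF d(4), of k] ab by simp
  note rep\<Psi> = rep_F0[OF d(1) ab(1-3), folded \<Psi>]
  have h [simp]: "\<Psi> \<in> hom2 K (a \<otimes> b) (b \<otimes> a)" using rep_hom2[OF rep\<Psi>] by simp
  have "rep (Leaf a \<odot> Leaf b) (Leaf b \<odot> Leaf a) \<Psi> [([], box [a, b] [b, a] \<Psi>, [])]"
    by (rule rep_box) simp_all
  from diagram_eq_iff[OF this rep\<Psi>, of k "[a, b]"]
  have \<Psi>_def: "\<langle>k, [a, b]\<rangle> [([], box [a, b] [b, a] \<Psi>, [])]
    \<approx> [([], box [r] [b, a] \<iota>, []), ([], mul R, []), ([], box [a] [r] \<alpha>, [r]), ([a], box [b] [r] \<beta>, [])]" by simp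
  interpret F: factorization_diagrams K k a "mul A" "unt A" b "mul B" "unt B" r "mul R" "unt R"
    "box [a] [r] \<alpha>" "box [b] [r] \<beta>" "box [r] [b, a] \<iota>" "box [a, b] [b, a] \<Psi>"
    using iff \<Psi>_def by unfold_locales (simp_all add: gentype_def)
  have pre: "prelaw A B \<Psi>" using d ab by (simp add: prelaw_def)
  have kB: "mobj K B = k" using d(6) ab by simp
  show law: "weak_distributive_law K A B \<Psi>"
    unfolding weak_distributive_law_iff[OF ab(1,2) kB] using pre F.psi_mA F.psi_mB F.psi_unit by simp
  interpret L: law_diagrams K k a "mul A" "unt A" b "mul B" "unt B" "box [a, b] [b, a] \<Psi>" "box [b, a] [b, a] (Psi_bar K A B \<Psi>)"
    by (rule law_diagrams[OF law kB ab(1,2)])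
  show "factorization_law_diagrams K k a (mul A) (unt A) b (mul B) (unt B) r (mul R) (unt R)
      (box [a] [r] \<alpha>) (box [b] [r] \<beta>) (box [r] [b, a] \<iota>) (box [a, b] [b, a] \<Psi>) (box [b, a] [b, a] (Psi_bar K A B \<Psi>))"
    by unfold_locales (fact L.pb L.pb_def)+
qed

lemma F0_law: "is_bfs K X \<Longrightarrow> weak_distributive_law K (wA (F0 K X)) (wB (F0 K X)) (w\<Psi> (F0 K X))"
  using factorization_law(2) by (cases X) (simp add: F0_def)

lemma is_bfs1D:
  assumes "is_bfs1 K (BFS1 (BFS A B R \<alpha> \<beta> \<iota>) (BFS A' B' R' \<alpha>' \<beta>' \<iota>') V \<xi> \<zeta> \<rho>)"
  shows "is_bfs K (BFS A B R \<alpha> \<beta> \<iota>)" "is_bfs K (BFS A' B' R' \<alpha>' \<beta>' \<iota>')"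
    "monad_morphism K A A' V \<xi>" "monad_morphism K B B' V \<zeta>" "monad_morphism K R R' V \<rho>"
    "\<rho> \<cdot> (\<alpha>' \<rhd> V) = (V \<lhd> \<alpha>) \<cdot> \<xi>" "\<rho> \<cdot> (\<beta>' \<rhd> V) = (V \<lhd> \<beta>) \<cdot> \<zeta>"
  using assms by (auto simp: is_bfs1_def Let_def)

lemma factorization_morphism_diagrams:
  assumes f: "is_bfs1 K (BFS1 (BFS A B R \<alpha> \<beta> \<iota>) (BFS A' B' R' \<alpha>' \<beta>' \<iota>') V \<xi> \<zeta> \<rho>)"
    and ab: "mnd A = a" "mnd B = b" "mnd R = r" "mobj K R = k"
    and ab': "mnd A' = a'" "mnd B' = b'" "mnd R' = r'" "mobj K R' = k'"
    and \<Psi>: "\<Psi> = \<iota> \<cdot> \<mu> R \<cdot> (\<alpha> \<star> \<beta>)" and \<Psi>': "\<Psi>' = \<iota>' \<cdot> \<mu> R' \<cdot> (\<alpha>' \<star> \<beta>')"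
  shows "factorization_morphism_diagrams K k a (mul A) (unt A) b (mul B) (unt B) r (mul R) (unt R)
      (box [a] [r] \<alpha>) (box [b] [r] \<beta>) (box [r] [b, a] \<iota>) (box [a, b] [b, a] \<Psi>) (box [b, a] [b, a] (Psi_bar K A B \<Psi>))
      k' a' (mul A') (unt A') b' (mul B') (unt B') r' (mul R') (unt R')
      (box [a'] [r'] \<alpha>') (box [b'] [r'] \<beta>') (box [r'] [b', a'] \<iota>') (box [a', b'] [b', a'] \<Psi>') (box [b', a'] [b', a'] (Psi_bar K A' B' \<Psi>'))
      V (box [a', V] [V, a] \<xi>) (box [b', V] [V, b] \<zeta>) (box [r', V] [V, r] \<rho>)"
proof -
  note d = is_bfs1D[OF f]
  note X = is_bfsD[OF d(1), unfolded ab] and X' = is_bfsD[OF d(2), unfolded ab']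
  interpret S: factorization_law_diagrams K k a "mul A" "unt A" b "mul B" "unt B" r "mul R" "unt R"
      "box [a] [r] \<alpha>" "box [b] [r] \<beta>" "box [r] [b, a] \<iota>" "box [a, b] [b, a] \<Psi>" "box [b, a] [b, a] (Psi_bar K A B \<Psi>)"
    by (rule factorization_law(1)[OF d(1) ab \<Psi>])
  interpret T: factorization_law_diagrams K k' a' "mul A'" "unt A'" b' "mul B'" "unt B'" r' "mul R'" "unt R'"
      "box [a'] [r'] \<alpha>'" "box [b'] [r'] \<beta>'" "box [r'] [b', a'] \<iota>'" "box [a', b'] [b', a'] \<Psi>'" "box [b', a'] [b', a'] (Psi_bar K A' B' \<Psi>')"
    by (rule factorization_law(1)[OF d(2) ab' \<Psi>'])
  interpret X: monad_morphism_diagrams K k a "mul A" "unt A" k' a' "mul A'" "unt A'" V "box [a', V] [V, a] \<xi>"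
    using monad_morphism_diagrams'[OF d(3) X(5) X'(5)] by (simp add: ab ab')
  interpret Z: monad_morphism_diagrams K k b "mul B" "unt B" k' b' "mul B'" "unt B'" V "box [b', V] [V, b] \<zeta>"
    using monad_morphism_diagrams'[OF d(4) X(6) X'(6)] by (simp add: ab ab')
  interpret P: monad_morphism_diagrams K k r "mul R" "unt R" k' r' "mul R'" "unt R'" V "box [r', V] [V, r] \<rho>"
    using monad_morphism_diagrams'[OF d(5) ab(4) ab'(4)] by (simp add: ab ab')
  note rx = rep_monad_morphism[OF d(3), unfolded ab ab'] and rz = rep_monad_morphism[OF d(4), unfolded ab ab']
    and ry = rep_monad_morphism[OF d(5), unfolded ab ab']
  have "\<langle>k, [a', V]\<rangle> [([], box [r', V] [V, r] \<rho>, []), ([], box [a'] [r'] \<alpha>', [V])] \<approx> [([V], box [a] [r] \<alpha>, []), ([], box [a', V] [V, a] \<xi>, [])]"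
    using intertwine_iff[OF X(9) X'(9) _ _ _ _ _ _ _ _ rx ry, of k k' V] d(6) by (simp add: hom1_def)
  moreover have "\<langle>k, [b', V]\<rangle> [([], box [r', V] [V, r] \<rho>, []), ([], box [b'] [r'] \<beta>', [V])] \<approx> [([V], box [b] [r] \<beta>, []), ([], box [b', V] [V, b] \<zeta>, [])]"
    using intertwine_iff[OF X(10) X'(10) _ _ _ _ _ _ _ _ rz ry, of k k' V] d(7) by (simp add: hom1_def)
  ultimately show ?thesis by unfold_locales
qed

lemma F1_law_morphism:
  assumes f: "is_bfs1 K (BFS1 (BFS A B R \<alpha> \<beta> \<iota>) (BFS A' B' R' \<alpha>' \<beta>' \<iota>') V \<xi> \<zeta> \<rho>)"
  shows "is_wdl1 K (WDL1 (F0 K (BFS A B R \<alpha> \<beta> \<iota>)) (F0 K (BFS A' B' R' \<alpha>' \<beta>' \<iota>')) V \<xi> \<zeta>)"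
proof -
  note d = is_bfs1D[OF f]
  note X = is_bfsD[OF d(1)] and X' = is_bfsD[OF d(2)]
  note compat = factorization_morphism_diagrams.bfs_compat[OF
      factorization_morphism_diagrams[OF f refl refl refl refl refl refl refl refl refl refl]]
  note [simp] = monad_morphismD[OF d(3)]
  have ob: "tsrc (Leaf V) = mobj K B" "ttrg (Leaf V) = mobj K B'" using X(5,6) X'(5,6) by simp_all
  show ?thesis
    using is_wdl1_diagram_iff[OF factorization_law(2)[OF d(1) refl refl refl refl refl]
        factorization_law(2)[OF d(2) refl refl refl refl refl] d(3,4) _ ob _ rep_monad_morphism[OF d(3)] rep_monad_morphism[OF d(4)]]
      compat X(5,6) X'(5,6)
    by (simp add: F0_def)
qed

lemma bfs_comp1_closed:
  assumes g: "is_bfs1 K g" and f: "is_bfs1 K f" and gf: "b_src g = b_trg f"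
  shows "is_bfs1 K (bfs_comp1 K g f)"
proof -
  obtain A B R \<alpha> \<beta> \<iota> A' B' R' \<alpha>' \<beta>' \<iota>' V \<xi> \<zeta> \<rho>
    where f': "f = BFS1 (BFS A B R \<alpha> \<beta> \<iota>) (BFS A' B' R' \<alpha>' \<beta>' \<iota>') V \<xi> \<zeta> \<rho>"
    by (metis bfs.exhaust bfs1.exhaust)
  obtain A'' B'' R'' \<alpha>'' \<beta>'' \<iota>'' V' \<xi>' \<zeta>' \<rho>'
    where g': "g = BFS1 (BFS A' B' R' \<alpha>' \<beta>' \<iota>') (BFS A'' B'' R'' \<alpha>'' \<beta>'' \<iota>'') V' \<xi>' \<zeta>' \<rho>'"
    using gf unfolding f' by (metis bfs.exhaust bfs1.collapse bfs1.sel(2))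
  note F = is_bfs1D[OF f[unfolded f']] and G = is_bfs1D[OF g[unfolded g']]
  note X = is_bfsD[OF F(1)] and X' = is_bfsD[OF F(2)] and X'' = is_bfsD[OF G(2)]
  have c: "bfs_comp1 K g f = BFS1 (BFS A B R \<alpha> \<beta> \<iota>) (BFS A'' B'' R'' \<alpha>'' \<beta>'' \<iota>'') (V' \<otimes> V)
    (mm_comp K A A' A'' V' \<xi>' V \<xi>) (mm_comp K B B' B'' V' \<zeta>' V \<zeta>) (mm_comp K R R' R'' V' \<rho>' V \<rho>)"
    by (simp add: bfs_comp1_def f' g' Let_def)
  show ?thesis unfolding c is_bfs1_def Let_def
    using F(1) G(2) mm_comp_monad_morphism[OF F(3) G(3)] mm_comp_monad_morphism[OF F(4) G(4)]
      mm_comp_monad_morphism[OF F(5) G(5)]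
      intertwiner_comp[OF F(3) G(3) F(5) G(5) X(7) X'(7) X''(7) F(6) G(6)]
      intertwiner_comp[OF F(4) G(4) F(5) G(5) X(8) X'(8) X''(8) F(7) G(7)]
    by simp
qed

lemma intertwiner_id:
  assumes A: "is_monad K A" and R: "is_monad K R" and k: "mobj K A = k" "mobj K R = k" and \<alpha>: "\<alpha> \<in> hom2 K (mnd A) (mnd R)"
  shows "mm_id K R \<cdot> (\<alpha> \<rhd> id1 K k) = (id1 K k \<lhd> \<alpha>) \<cdot> mm_id K A"
proof -
  note [simp] = is_monadD[OF A, unfolded k] is_monadD[OF R, unfolded k] k \<alpha>
  have h: "mnd A \<in> hom1 K k k" "mnd R \<in> hom1 K k k" by (auto simp: hom1_def)
  have "wt k [mnd A] [([], box [mnd A] [mnd R] \<alpha>, [])]" by simp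
  moreover have "rep (Leaf (mnd A) \<odot> Unit k) (Unit k \<odot> Leaf (mnd A)) (mm_id K A) []"
    "rep (Leaf (mnd R) \<odot> Unit k) (Unit k \<odot> Leaf (mnd R)) (mm_id K R) []"
    using rep_mm_id[of A] rep_mm_id[of R] by simp_all
  ultimately show ?thesis
    using intertwine_iff[OF \<alpha> \<alpha> h h, of "Unit k" "id1 K k"] by (simp add: eqd_refl)
qed

lemma bfs_id1_closed:
  assumes "is_bfs K X"
  shows "is_bfs1 K (bfs_id1 K X)"
proof (cases X)
  case (BFS A B R \<alpha> \<beta> \<iota>)
  note d = is_bfsD[OF assms[unfolded BFS]]
  show ?thesis
    using assms d mm_id_monad_morphism[of A "mobj K R"] mm_id_monad_morphism[of B "mobj K R"] mm_id_monad_morphism[of R "mobj K R"]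
      intertwiner_id[of A R "mobj K R" \<alpha>] intertwiner_id[of B R "mobj K R" \<beta>]
    by (simp add: is_bfs1_def bfs_id1_def BFS Let_def)
qed

lemma F1_closed:
  assumes "is_bfs1 K f"
  shows "is_wdl1 K (F1 K f)"
proof (cases f)
  case (BFS1 X X' V \<xi> \<zeta> \<rho>)
  thus ?thesis using F1_law_morphism assms by (cases X; cases X') (auto simp: F1_def)
qed

text \<open>The 2-cell \<open>\<rho>\<close> below is the formula \<open>(V \<otimes> \<pi>)(\<zeta> \<otimes> A)(B' \<otimes> \<xi>)(\<iota>' \<otimes> V)\<close> with its coherence cells.\<close>

lemma F1_lift:
  assumes X: "is_bfs K (BFS A B R \<alpha> \<beta> \<iota>)" and X': "is_bfs K (BFS A' B' R' \<alpha>' \<beta>' \<iota>')"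
    and f: "is_wdl1 K (WDL1 (F0 K (BFS A B R \<alpha> \<beta> \<iota>)) (F0 K (BFS A' B' R' \<alpha>' \<beta>' \<iota>')) V \<xi> \<zeta>)"
  shows "\<exists>\<rho>. is_bfs1 K (BFS1 (BFS A B R \<alpha> \<beta> \<iota>) (BFS A' B' R' \<alpha>' \<beta>' \<iota>') V \<xi> \<zeta> \<rho>)"
proof -
  define \<Psi> where "\<Psi> = \<iota> \<cdot> \<mu> R \<cdot> (\<alpha> \<star> \<beta>)"
  define \<Psi>' where "\<Psi>' = \<iota>' \<cdot> \<mu> R' \<cdot> (\<alpha>' \<star> \<beta>')"
  define a b r k where ab: "a = mnd A" "b = mnd B" "r = mnd R" "k = mobj K R"
  define a' b' r' k' where ab': "a' = mnd A'" "b' = mnd B'" "r' = mnd R'" "k' = mobj K R'"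
  note ab = ab[symmetric] and ab' = ab'[symmetric]
  have f: "is_wdl1 K (WDL1 (WDL A B \<Psi>) (WDL A' B' \<Psi>') V \<xi> \<zeta>)"
    using f by (simp add: F0_def \<Psi>_def \<Psi>'_def)
  note d = is_wdl1D[OF f] and D = is_bfsD[OF X, unfolded ab] and D' = is_bfsD[OF X', unfolded ab']
  interpret S: factorization_law_diagrams K k a "mul A" "unt A" b "mul B" "unt B" r "mul R" "unt R"
      "box [a] [r] \<alpha>" "box [b] [r] \<beta>" "box [r] [b, a] \<iota>" "box [a, b] [b, a] \<Psi>" "box [b, a] [b, a] (Psi_bar K A B \<Psi>)"
    by (rule factorization_law(1)[OF X ab \<Psi>_def])
  interpret T: factorization_law_diagrams K k' a' "mul A'" "unt A'" b' "mul B'" "unt B'" r' "mul R'" "unt R'"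
      "box [a'] [r'] \<alpha>'" "box [b'] [r'] \<beta>'" "box [r'] [b', a'] \<iota>'" "box [a', b'] [b', a'] \<Psi>'" "box [b', a'] [b', a'] (Psi_bar K A' B' \<Psi>')"
    by (rule factorization_law(1)[OF X' ab' \<Psi>'_def])
  interpret L: law_morphism_diagrams K k a "mul A" "unt A" b "mul B" "unt B"
    "box [a, b] [b, a] \<Psi>" "box [b, a] [b, a] (Psi_bar K A B \<Psi>)"
    k' a' "mul A'" "unt A'" b' "mul B'" "unt B'"
    "box [a', b'] [b', a'] \<Psi>'" "box [b', a'] [b', a'] (Psi_bar K A' B' \<Psi>')"
    V "box [a', V] [V, a] \<xi>" "box [b', V] [V, b] \<zeta>"
    by (rule law_morphism_diagrams[OF f D(6) D'(6) ab(1,2) ab'(1,2)])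
  define \<rho> where "\<rho> = (V \<lhd> (\<mu> R \<cdot> (\<beta> \<star> \<alpha>))) \<cdot> \<a> V b a \<cdot> (\<zeta> \<rhd> a) \<cdot> \<a>\<^sup>- b' V a
    \<cdot> (b' \<lhd> \<xi>) \<cdot> \<a> b' a' V \<cdot> (\<iota>' \<rhd> V)"
  have prem: "premonad R" using D(4) by simp
  note rx = rep_monad_morphism[OF d(3), unfolded ab ab'] and rz = rep_monad_morphism[OF d(4), unfolded ab ab']
  note [simp] = D(9-11) D'(9-11) prem ab ab'
  have rep\<rho>: "rep (Leaf r' \<odot> Leaf V) (Leaf V \<odot> Leaf r) \<rho>
    [([V], mul R, []), ([V], box [b] [r] \<beta>, [r]), ([V, b], box [a] [r] \<alpha>, []), ([], box [b', V] [V, b] \<zeta>, [a]),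
      ([b'], box [a', V] [V, a] \<xi>, []), ([], box [r'] [b', a'] \<iota>', [V])]"
    unfolding \<rho>_def
    by (rule rep_word, (rule rep_intros rx rz rep_mul rep_box[of \<alpha> "[a]" "[r]"] rep_box[of \<beta> "[b]" "[r]"]
        rep_box[of \<iota>' "[r']" "[b', a']"] | simp del: vassoc)+)
  have \<rho> [simp]: "\<rho> \<in> hom2 K (r' \<otimes> V) (V \<otimes> r)" using rep_hom2[OF rep\<rho>] by simp
  have rep\<rho>': "rep (Leaf r' \<odot> Leaf V) (Leaf V \<odot> Leaf r) \<rho> [([], box [r', V] [V, r] \<rho>, [])]"
    by (rule rep_box) simp_all
  interpret Lift: factorization_lift_diagrams K k a "mul A" "unt A" b "mul B" "unt B" r "mul R" "unt R"
      "box [a] [r] \<alpha>" "box [b] [r] \<beta>" "box [r] [b, a] \<iota>" "box [a, b] [b, a] \<Psi>" "box [b, a] [b, a] (Psi_bar K A B \<Psi>)"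
      k' a' "mul A'" "unt A'" b' "mul B'" "unt B'" r' "mul R'" "unt R'"
      "box [a'] [r'] \<alpha>'" "box [b'] [r'] \<beta>'" "box [r'] [b', a'] \<iota>'" "box [a', b'] [b', a'] \<Psi>'" "box [b', a'] [b', a'] (Psi_bar K A' B' \<Psi>')"
      V "box [a', V] [V, a] \<xi>" "box [b', V] [V, b] \<zeta>" "box [r', V] [V, r] \<rho>"
    using diagram_eq_iff[OF rep\<rho>' rep\<rho>, of k "[r', V]"] by unfold_locales (simp_all add: gentype_def)
  have "monad_morphism K R R' V \<rho>"
    using monad_morphism_iff[OF D(4) D'(4), of "Leaf V" V \<rho>] rep\<rho>' Lift.rho_mul Lift.rho_unt by simp
  moreover have "\<rho> \<cdot> (\<alpha>' \<rhd> V) = (V \<lhd> \<alpha>) \<cdot> \<xi>"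
    using intertwine_iff[OF D(9) D'(9) _ _ _ _ _ _ _ _ rx rep\<rho>', of k k' V] Lift.int_al by (simp add: hom1_def)
  moreover have "\<rho> \<cdot> (\<beta>' \<rhd> V) = (V \<lhd> \<beta>) \<cdot> \<zeta>"
    using intertwine_iff[OF D(10) D'(10) _ _ _ _ _ _ _ _ rz rep\<rho>', of k k' V] Lift.int_be by (simp add: hom1_def)
  ultimately have "is_bfs1 K (BFS1 (BFS A B R \<alpha> \<beta> \<iota>) (BFS A' B' R' \<alpha>' \<beta>' \<iota>') V \<xi> \<zeta> \<rho>)"
    using X X' d(3,4) by (simp add: is_bfs1_def)
  thus ?thesis ..
qed

lemma F1_lift_unique:
  assumes f: "is_bfs1 K (BFS1 (BFS A B R \<alpha> \<beta> \<iota>) (BFS A' B' R' \<alpha>' \<beta>' \<iota>') V \<xi> \<zeta> \<rho>)"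
    and g: "is_bfs1 K (BFS1 (BFS A B R \<alpha> \<beta> \<iota>) (BFS A' B' R' \<alpha>' \<beta>' \<iota>') V \<xi> \<zeta> \<sigma>)"
  shows "\<rho> = \<sigma>"
proof -
  note F = factorization_morphism_diagrams[OF f refl refl refl refl refl refl refl refl refl refl]
    and G = factorization_morphism_diagrams[OF g refl refl refl refl refl refl refl refl refl refl]
  note e = factorization_morphism_diagrams.rho_eq[OF F]
    eqd_sym[OF factorization_morphism_diagrams.rho_eq[OF G]]
  note r = rep_monad_morphism[OF is_bfs1D(5)[OF f]] rep_monad_morphism[OF is_bfs1D(5)[OF g]]
  show ?thesis
    using diagram_eq_iff[OF r, of "mobj K R" "[mnd R', V]"] eqd_trans[OF e]
      monad_morphismD[OF is_bfs1D(5)[OF f]] by simp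
qed

lemma F2_lift:
  assumes f: "is_bfs1 K (BFS1 (BFS A B R \<alpha> \<beta> \<iota>) (BFS A' B' R' \<alpha>' \<beta>' \<iota>') V \<xi> \<zeta> \<rho>)"
    and g: "is_bfs1 K (BFS1 (BFS A B R \<alpha> \<beta> \<iota>) (BFS A' B' R' \<alpha>' \<beta>' \<iota>') U \<upsilon> \<epsilon> \<sigma>)"
    and tA: "monad_transformation K A A' V \<xi> U \<upsilon> \<omega>" and tB: "monad_transformation K B B' V \<zeta> U \<epsilon> \<omega>"
  shows "monad_transformation K R R' V \<rho> U \<sigma> \<omega>"
proof -
  note d = is_bfs1D[OF f] and e = is_bfs1D[OF g]
  note X = is_bfsD[OF d(1)] and X' = is_bfsD[OF d(2)]
  note F = factorization_morphism_diagrams[OF f refl refl refl refl refl refl refl refl refl refl]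
    and G = factorization_morphism_diagrams[OF g refl refl refl refl refl refl refl refl refl refl]
  note t = rep_transformation[OF d(3) e(3) tA] rep_transformation[OF d(4) e(4) tB]
  have "factorization_transformation_diagrams_axioms K (mobj K R) (mnd A) (mnd B) (mnd A') (mnd B') V
     (box [mnd A', V] [V, mnd A] \<xi>) (box [mnd B', V] [V, mnd B] \<zeta>) U
     (box [mnd A', U] [U, mnd A] \<upsilon>) (box [mnd B', U] [U, mnd B] \<epsilon>) (box [V] [U] \<omega>)"
    using t X(5,6) by (simp add: factorization_transformation_diagrams_axioms_def)
  note T = factorization_transformation_diagrams.tr_rho[OF factorization_transformation_diagrams.intro[OF bicategory_axioms F G this]]
  show ?thesis
    using monad_transformation_iff[OF _ _ _ _ _ _ _ _ _ _ rep_monad_morphism[OF d(5)] rep_monad_morphism[OF e(5)] t(1)]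
      T monad_morphismD[OF d(5)] monad_morphismD[OF e(5)] X X' by simp
qed

text \<open>Here idempotents have to split. The 2-cells \<open>m\<close>, \<open>e\<close>, \<open>\<alpha>\<close>, \<open>\<beta>\<close> below spell out the boxes
  \<open>mR\<close>, \<open>eR\<close>, \<open>al\<close>, \<open>be\<close> of the split monad.\<close>

lemma splitting_factorization:
  assumes law: "weak_distributive_law K A B \<Psi>" and split: "idempotents_split K"
  shows "\<exists>X. is_bfs K X \<and> F0 K X = WDL A B \<Psi>"
proof -
  define a b k where ab: "a = mnd A" "b = mnd B" "k = mobj K B"
  note ab = ab[symmetric]
  define \<Phi> where "\<Phi> = Psi_bar K A B \<Psi>"
  note iff = law[unfolded weak_distributive_law_iff[OF ab]]
  hence pre: "prelaw A B \<Psi>" by simp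
  have A: "is_monad K A" and kA: "mobj K A = k" and B: "is_monad K B" and h [simp]: "\<Psi> \<in> hom2 K (a \<otimes> b) (b \<otimes> a)"
    using pre ab by (simp_all add: prelaw_def)
  have p: "premonad A" "premonad B" using A B by simp_all
  interpret L: law_diagrams K k a "mul A" "unt A" b "mul B" "unt B" "box [a, b] [b, a] \<Psi>" "box [b, a] [b, a] \<Phi>"
    unfolding \<Phi>_def by (rule law_diagrams[OF law ab(3,1,2)])
  have \<Phi> [simp]: "\<Phi> \<in> hom2 K (b \<otimes> a) (b \<otimes> a)" using Psi_bar_hom(1)[OF law] by (simp add: \<Phi>_def ab)
  have rep\<Phi>: "rep (Leaf b \<odot> Leaf a) (Leaf b \<odot> Leaf a) \<Phi> [([], box [b, a] [b, a] \<Phi>, [])]" by (rule rep_box) simp_all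
  have "rep (Leaf b \<odot> Leaf a) (Leaf b \<odot> Leaf a) (\<Phi> \<cdot> \<Phi>) [([], box [b, a] [b, a] \<Phi>, []), ([], box [b, a] [b, a] \<Phi>, [])]"
    by (rule rep_word, rule rep_vcomp[OF rep\<Phi> rep\<Phi>]) simp
  from diagram_eq_iff[OF this rep\<Phi>, of k "[b, a]"] have "\<Phi> \<cdot> \<Phi> = \<Phi>" using L.pb_pb by simp
  moreover have "b \<otimes> a \<in> Mor K" by simp
  ultimately obtain r q i where r [simp]: "r \<in> Mor K" and q: "q \<in> hom2 K (b \<otimes> a) r" and i: "i \<in> hom2 K r (b \<otimes> a)"
    and iq: "\<Phi> = i \<cdot> q" and qi: "q \<cdot> i = id2 K r"
    using split \<Phi> unfolding idempotents_split_def by metis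
  have r1 [simp]: "Src K r = k" "Trg K r = k"
    using q Src_Dom_Cod[of q] Trg_Dom_Cod[of q] by (auto simp: in_hom2)
  have q' [simp]: "q \<in> hom2 K (b \<otimes> a) r" and i' [simp]: "i \<in> hom2 K r (b \<otimes> a)" using q i .
  define m where "m = q \<cdot> (\<mu> B \<star> \<mu> A) \<cdot> \<a> (b \<otimes> b) a a \<cdot> (\<a>\<^sup>- b b a \<rhd> a) \<cdot> ((b \<lhd> \<Psi>) \<rhd> a)
    \<cdot> (\<a> b a b \<rhd> a) \<cdot> \<a>\<^sup>- (b \<otimes> a) b a \<cdot> (i \<star> i)"
  define e where "e = q \<cdot> (\<eta> B \<star> \<eta> A) \<cdot> \<l>\<^sup>- (id1 K k)"
  define \<alpha> where "\<alpha> = q \<cdot> (\<eta> B \<rhd> a) \<cdot> \<l>\<^sup>- a"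
  define \<beta> where "\<beta> = q \<cdot> (b \<lhd> \<eta> A) \<cdot> \<r>\<^sup>- b"
  define R where "R = Monad r m e"
  have R [simp]: "mnd R = r" "\<mu> R = m" "\<eta> R = e" "mobj K R = k" by (simp_all add: R_def mobj_def)
  note [simp] = p ab kA
  have o: "k = k" ..
  note rules = rep_intros rep_mul[OF p(1) ab(1)] rep_mul[OF p(2) ab(2)] rep_unt[OF p(1) ab(1) kA] rep_unt[OF p(2) ab(2,3)]
    rep_box[of q "[b, a]" "[r]"] rep_box[of i "[r]" "[b, a]"] rep_box[of \<Psi> "[a, b]" "[b, a]"]
  have rep_m: "rep (Leaf r \<odot> Leaf r) (Leaf r) m
    [([], box [b, a] [r] q, []), ([], mul B, [a]), ([b, b], mul A, []), ([b], box [a, b] [b, a] \<Psi>, [a]),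
      ([], box [r] [b, a] i, [b, a]), ([r], box [r] [b, a] i, [])]"
    unfolding m_def by (rule rep_word, (rule rules | simp del: vassoc)+)
  have rep_e: "rep (Unit k) (Leaf r) e [([], box [b, a] [r] q, []), ([], unt B, [a]), ([], unt A, [])]"
    unfolding e_def by (rule rep_word, (rule rules | simp del: vassoc)+)
  have rep_\<alpha>: "rep (Leaf a) (Leaf r) \<alpha> [([], box [b, a] [r] q, []), ([], unt B, [a])]"
    unfolding \<alpha>_def by (rule rep_word, (rule rules | simp del: vassoc)+)
  have rep_\<beta>: "rep (Leaf b) (Leaf r) \<beta> [([], box [b, a] [r] q, []), ([b], unt A, [])]"
    unfolding \<beta>_def by (rule rep_word, (rule rules | simp del: vassoc)+)
  have h' [simp]: "m \<in> hom2 K (r \<otimes> r) r" "e \<in> hom2 K (id1 K k) r" "\<alpha> \<in> hom2 K a r" "\<beta> \<in> hom2 K b r"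
    using rep_hom2[OF rep_m] rep_hom2[OF rep_e] rep_hom2[OF rep_\<alpha>] rep_hom2[OF rep_\<beta>] by simp_all
  have pR: "premonad R" by (simp add: premonad_def hom1_def)
  have rep_mR: "rep (Leaf r \<odot> Leaf r) (Leaf r) m [([], mul R, [])]" and rep_eR: "rep (Unit k) (Leaf r) e [([], unt R, [])]"
    using rep_mul[OF pR, of r] rep_unt[OF pR, of r k] by simp_all
  have rep_al: "rep (Leaf a) (Leaf r) \<alpha> [([], box [a] [r] \<alpha>, [])]" and rep_be: "rep (Leaf b) (Leaf r) \<beta> [([], box [b] [r] \<beta>, [])]"
    by (rule rep_box; simp)+
  have rep_q: "rep (Leaf b \<odot> Leaf a) (Leaf r) q [([], box [b, a] [r] q, [])]"
    and rep_i: "rep (Leaf r) (Leaf b \<odot> Leaf a) i [([], box [r] [b, a] i, [])]"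
    by (rule rep_box; simp)+
  have rep_iq: "rep (Leaf b \<odot> Leaf a) (Leaf b \<odot> Leaf a) (i \<cdot> q) [([], box [r] [b, a] i, []), ([], box [b, a] [r] q, [])]"
    by (rule rep_word, rule rep_vcomp[OF rep_q rep_i]) simp
  have rep_qi: "rep (Leaf r) (Leaf r) (q \<cdot> i) [([], box [b, a] [r] q, []), ([], box [r] [b, a] i, [])]"
    by (rule rep_word, rule rep_vcomp[OF rep_i rep_q]) simp
  have rep_r: "rep (Leaf r) (Leaf r) (id2 K r) []" by (rule rep_id) simp_all
  interpret S: splitting_diagrams K k a "mul A" "unt A" b "mul B" "unt B" "box [a, b] [b, a] \<Psi>" "box [b, a] [b, a] \<Phi>"
    r "box [b, a] [r] q" "box [r] [b, a] i" "mul R" "unt R" "box [a] [r] \<alpha>" "box [b] [r] \<beta>"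
  proof unfold_locales
    show "\<langle>k, [b, a]\<rangle> [([], box [r] [b, a] i, []), ([], box [b, a] [r] q, [])] \<approx> [([], box [b, a] [b, a] \<Phi>, [])]"
      using diagram_eq_iff[OF rep_iq rep\<Phi>, of k "[b, a]"] iq by simp
    show "\<langle>k, [r]\<rangle> [([], box [b, a] [r] q, []), ([], box [r] [b, a] i, [])] \<approx> []"
      using diagram_eq_iff[OF rep_qi rep_r, of k "[r]"] qi by simp
    show "\<langle>k, [r, r]\<rangle> [([], mul R, [])]
      \<approx> [([], box [b, a] [r] q, []), ([], mul B, [a]), ([b, b], mul A, []), ([b], box [a, b] [b, a] \<Psi>, [a]),
        ([], box [r] [b, a] i, [b, a]), ([r], box [r] [b, a] i, [])]"
      using diagram_eq_iff[OF rep_mR rep_m, of k "[r, r]"] by simp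
    show "\<langle>k, []\<rangle> [([], unt R, [])] \<approx> [([], box [b, a] [r] q, []), ([], unt B, [a]), ([], unt A, [])]"
      using diagram_eq_iff[OF rep_eR rep_e, of k "[]"] by simp
    show "\<langle>k, [a]\<rangle> [([], box [a] [r] \<alpha>, [])] \<approx> [([], box [b, a] [r] q, []), ([], unt B, [a])]"
      using diagram_eq_iff[OF rep_al rep_\<alpha>, of k "[a]"] by simp
    show "\<langle>k, [b]\<rangle> [([], box [b] [r] \<beta>, [])] \<approx> [([], box [b, a] [r] q, []), ([b], unt A, [])]"
      using diagram_eq_iff[OF rep_be rep_\<beta>, of k "[b]"] by simp
  qed (use pR in \<open>simp_all add: gentype_def hom1_def\<close>)
  have "is_monad K R"
    using pR S.mR_assoc S.unitlR S.unitrR by (simp add: is_monad_iff)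
  hence pf: "prefact A B R \<alpha> \<beta> i"
    using A B by (simp add: prefact_def)
  have "is_bfs K (BFS A B R \<alpha> \<beta> i)"
    unfolding is_bfs_iff[OF ab(1,2) R(1,4)]
    using pf S.al_mul S.al_unt S.be_mul S.be_unt S.io_left S.io_right S.pi_io by simp
  moreover have "i \<cdot> \<mu> R \<cdot> (\<alpha> \<star> \<beta>) = \<Psi>"
  proof -
    have "rep (Leaf a \<odot> Leaf b) (Leaf b \<odot> Leaf a) \<Psi> [([], box [a, b] [b, a] \<Psi>, [])]" by (rule rep_box) simp_all
    from diagram_eq_iff[OF rep_F0[OF pf ab(1,2) R(1)] this, of k "[a, b]"] show ?thesis
      using S.psi_io by simp
  qed
  ultimately show ?thesis
    by (intro exI[of _ "BFS A B R \<alpha> \<beta> i"]) (simp add: F0_def)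
qed

end

section \<open>Bicategories whose cells carry monads\<close>

text \<open>Both bicategories have the following form. A 0-cell \<open>x\<close> carries \<open>n\<close> monads \<open>mon x j\<close> on one object \<open>u0 x\<close>, a 1-cell \<open>f\<close> carries
  monad morphisms \<open>act f j\<close> along a common 1-cell \<open>u1 f\<close>, and 2-cells are simultaneous monad transformations. As
  soon as the chosen 1-cells contain the identities and are closed under composition, the coherence
  2-cells of \<open>K\<close> make this a bicategory.\<close>

locale monad_bicategory = bicategory K for K :: "('o, 'm, 'c) bicat" (structure) +
  fixes Obs :: "'x set" and Ar :: "'y set" and sr tg :: "'y \<Rightarrow> 'x" and u0 :: "'x \<Rightarrow> 'o" and u1 :: "'y \<Rightarrow> 'm"
    and I :: "'x \<Rightarrow> 'y" and comp :: "'y \<Rightarrow> 'y \<Rightarrow> 'y"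
    and n :: nat and mon :: "'x \<Rightarrow> nat \<Rightarrow> ('m, 'c) monad" and act :: "'y \<Rightarrow> nat \<Rightarrow> 'c"
  assumes n: "0 < n"
    and Obs: "x \<in> Obs \<Longrightarrow> j < n \<Longrightarrow> mobj K (mon x j) = u0 x"
    and Ar: "f \<in> Ar \<Longrightarrow> sr f \<in> Obs \<and> tg f \<in> Obs \<and>
      (\<forall>j<n. monad_morphism K (mon (sr f) j) (mon (tg f) j) (u1 f) (act f j))"
    and I: "x \<in> Obs \<Longrightarrow> I x \<in> Ar \<and> sr (I x) = x \<and> tg (I x) = x \<and> u1 (I x) = id1 K (u0 x) \<and>
      (\<forall>j<n. act (I x) j = mm_id K (mon x j))"
    and comp: "g \<in> Ar \<Longrightarrow> f \<in> Ar \<Longrightarrow> sr g = tg f \<Longrightarrow>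
      comp g f \<in> Ar \<and> sr (comp g f) = sr f \<and> tg (comp g f) = tg g \<and> u1 (comp g f) = u1 g \<otimes> u1 f \<and>
      (\<forall>j<n. act (comp g f) j
        = mm_comp K (mon (sr f) j) (mon (tg f) j) (mon (tg g) j) (u1 g) (act g j) (u1 f) (act f j))"
begin

definition T :: "'y \<Rightarrow> 'y \<Rightarrow> 'c \<Rightarrow> bool"
  where "T f g \<omega> \<longleftrightarrow> f \<in> Ar \<and> g \<in> Ar \<and> sr g = sr f \<and> tg g = tg f \<and>
    (\<forall>j<n. monad_transformation K (mon (sr f) j) (mon (tg f) j) (u1 f) (act f j) (u1 g) (act g j) \<omega>)"

lemma Ar_morphism: "f \<in> Ar \<Longrightarrow> j < n \<Longrightarrow> sr f = x \<Longrightarrow> tg f = y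
    \<Longrightarrow> monad_morphism K (mon x j) (mon y j) (u1 f) (act f j)"
  using Ar by blast

text \<open>The positive number \<open>n\<close> provides a monad morphism, from which the boundary of \<open>u1 f\<close> is read off.\<close>

lemma Ar_simps [simp]:
  assumes "f \<in> Ar"
  shows "sr f \<in> Obs" "tg f \<in> Obs" "u1 f \<in> Mor K" "Src K (u1 f) = u0 (sr f)" "Trg K (u1 f) = u0 (tg f)"
  using Ar[OF assms] monad_morphismD[OF Ar_morphism[OF assms n refl refl]] Obs n by auto

lemma I_simps [simp]:
  assumes "x \<in> Obs"
  shows "I x \<in> Ar" "sr (I x) = x" "tg (I x) = x" "u1 (I x) = id1 K (u0 x)" "u0 x \<in> Ob K"
    "j < n \<Longrightarrow> act (I x) j = mm_id K (mon x j)"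
proof -
  have "is_monad K (mon x 0)"
    using monad_morphismD(1)[OF Ar_morphism[of "I x" 0 x x]] I[OF assms] n by simp
  thus "u0 x \<in> Ob K" using is_monadD(4)[of "mon x 0"] Obs[OF assms n] by simp
qed (use I[OF assms] in auto)

lemma comp_simps [simp]:
  assumes "g \<in> Ar" "f \<in> Ar" "sr g = tg f"
  shows "comp g f \<in> Ar" "sr (comp g f) = sr f" "tg (comp g f) = tg g" "u1 (comp g f) = u1 g \<otimes> u1 f"
    "j < n \<Longrightarrow> act (comp g f) j
      = mm_comp K (mon (sr f) j) (mon (tg f) j) (mon (tg g) j) (u1 g) (act g j) (u1 f) (act f j)"
  using comp[OF assms] by auto

lemma TD:
  assumes "T f g \<omega>"
  shows "f \<in> Ar" "g \<in> Ar" "sr g = sr f" "tg g = tg f" "\<omega> \<in> Cell K" "Dom K \<omega> = u1 f" "Cod K \<omega> = u1 g"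
    "j < n \<Longrightarrow> monad_transformation K (mon (sr f) j) (mon (tg f) j) (u1 f) (act f j) (u1 g) (act g j) \<omega>"
  using assms n monad_transformationD[of _ _ "u1 f" _ "u1 g" _ \<omega>] by (auto simp: T_def)

lemma T_id: "f \<in> Ar \<Longrightarrow> T f f (id2 K (u1 f))"
  by (simp add: T_def Ar_morphism monad_transformation_id)

lemma T_vcomp:
  assumes "T g h \<psi>" "T f g \<phi>"
  shows "T f h (\<psi> \<cdot> \<phi>)"
  using TD[OF assms(1)] TD[OF assms(2)]
  by (auto simp: T_def Ar_morphism intro!: monad_transformation_vcomp[where U = "u1 g" and \<upsilon> = "act g _"])

lemma T_inv:
  assumes "T f g \<phi>" "iso \<phi>"
  shows "T g f (inv2 K \<phi>)"
  using TD[OF assms(1)] assms(2) by (auto simp: T_def Ar_morphism intro!: monad_transformation_inv)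

lemma T_hcomp:
  assumes "T g g' \<psi>" "T f f' \<phi>" "sr g = tg f"
  shows "T (comp g f) (comp g' f') (\<psi> \<star> \<phi>)"
  using TD[OF assms(1)] TD[OF assms(2)] assms(3)
  by (auto simp: T_def Ar_morphism intro!: monad_transformation_hcomp)

lemma T_asc:
  assumes "h \<in> Ar" "g \<in> Ar" "f \<in> Ar" "sr h = tg g" "sr g = tg f"
  shows "T (comp (comp h g) f) (comp h (comp g f)) (\<a> (u1 h) (u1 g) (u1 f))"
  using assms by (auto simp: T_def Ar_morphism intro!: monad_transformation_asc)

lemma T_lun: "f \<in> Ar \<Longrightarrow> T (comp (I (tg f)) f) f (\<l> (u1 f))"
  by (auto simp: T_def Ar_morphism Obs intro!: monad_transformation_lun)

lemma T_run: "f \<in> Ar \<Longrightarrow> T (comp f (I (sr f))) f (\<r> (u1 f))"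
  by (auto simp: T_def Ar_morphism Obs intro!: monad_transformation_run)

definition total :: "('x, 'y, ('y, 'c) over2) bicat"
  where "total = \<lparr>
    Ob = Obs, Mor = Ar, Src = sr, Trg = tg,
    Cell = {t. T (dom2 t) (cod2 t) (cell2 t)}, Dom = dom2, Cod = cod2,
    id1 = I, id2 = (\<lambda>f. Over2 f f (id2 K (u1 f))), comp1 = comp,
    hcomp = (\<lambda>s t. Over2 (comp (dom2 s) (dom2 t)) (comp (cod2 s) (cod2 t)) (cell2 s \<star> cell2 t)),
    vcomp = (\<lambda>s t. Over2 (dom2 t) (cod2 s) (cell2 s \<cdot> cell2 t)),
    asc = (\<lambda>h g f. Over2 (comp (comp h g) f) (comp h (comp g f)) (\<a> (u1 h) (u1 g) (u1 f))),
    lun = (\<lambda>f. Over2 (comp (I (tg f)) f) f (\<l> (u1 f))),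
    run = (\<lambda>f. Over2 (comp f (I (sr f))) f (\<r> (u1 f)))\<rparr>"

lemma total_simps [simp]:
  "Ob total = Obs" "Mor total = Ar" "Src total = sr" "Trg total = tg"
  "Cell total = {t. T (dom2 t) (cod2 t) (cell2 t)}" "Dom total = dom2" "Cod total = cod2"
  "id1 total = I" "id2 total f = Over2 f f (id2 K (u1 f))" "comp1 total g f = comp g f"
  "hcomp total s t = Over2 (comp (dom2 s) (dom2 t)) (comp (cod2 s) (cod2 t)) (cell2 s \<star> cell2 t)"
  "vcomp total s t = Over2 (dom2 t) (cod2 s) (cell2 s \<cdot> cell2 t)"
  "asc total h g f = Over2 (comp (comp h g) f) (comp h (comp g f)) (\<a> (u1 h) (u1 g) (u1 f))"
  "lun total f = Over2 (comp (I (tg f)) f) f (\<l> (u1 f))"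
  "run total f = Over2 (comp f (I (sr f))) f (\<r> (u1 f))"
  by (simp_all add: total_def)

lemma hom2_total: "t \<in> hom2 total f g \<longleftrightarrow> (\<exists>\<omega>. t = Over2 f g \<omega> \<and> T f g \<omega>)"
  by (cases t) (auto simp: hom2_def)

lemma iso2_total:
  assumes "T f g \<omega>" "iso \<omega>"
  shows "Over2 f g \<omega> \<in> iso2 total f g"
proof -
  have "inverse2 total (Over2 f g \<omega>) (Over2 g f (inv2 K \<omega>))"
    using T_inv[OF assms] TD[OF assms(1)] assms(2) by (simp add: inverse2_def hom2_def)
  thus ?thesis using assms(1) by (auto simp: iso2_def hom2_def)
qed

text \<open>Each axiom concerns the underlying 2-cells only and is the corresponding axiom of \<open>K\<close>.\<close>

lemma bicategory_total: "bicategory total"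
proof (unfold_locales, goal_cases)
  case (1 M) thus ?case by simp
next case (2 M) thus ?case by simp
next case (3 f) thus ?case by (auto dest: TD)
next case (4 f) thus ?case by (auto dest: TD)
next case (5 f) thus ?case by (auto dest: TD)
next case (6 f) thus ?case by (auto dest: TD)
next case (7 a) thus ?case by (simp add: hom1_def)
next case (8 M b c N a) thus ?case by (simp add: hom1_def)
next case (9 M) thus ?case by (simp add: hom2_total T_id)
next case (10 g N P f M) thus ?case by (auto simp: hom2_total intro: T_vcomp)
next case (11 h P Q g N f M)
  then obtain x y z where t: "h = Over2 P Q x" "T P Q x" "g = Over2 N P y" "T N P y" "f = Over2 M N z" "T M N z"
    by (auto simp: hom2_total)
  show ?case using TD[OF t(2)] TD[OF t(4)] TD[OF t(6)] by (simp add: t)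
next case (12 f M N)
  then obtain x where t: "f = Over2 M N x" "T M N x" by (auto simp: hom2_total)
  show ?case using TD[OF t(2)] by (simp add: t)
next case (13 f M N)
  then obtain x where t: "f = Over2 M N x" "T M N x" by (auto simp: hom2_total)
  show ?case using TD[OF t(2)] by (simp add: t)
next case (14 f M M' g N N') thus ?case by (auto simp: hom2_total intro: T_hcomp)
next case (15 M N) thus ?case by simp
next case (16 f M M' f' M'' g N N' g' N'')
  then obtain x x' y y' where t: "f = Over2 M M' x" "T M M' x" "f' = Over2 M' M'' x'" "T M' M'' x'"
      "g = Over2 N N' y" "T N N' y" "g' = Over2 N' N'' y'" "T N' N'' y'"
    by (auto simp: hom2_total)
  show ?case using TD[OF t(2)] TD[OF t(4)] TD[OF t(6)] TD[OF t(8)] 16(5) by (simp add: t exchange)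
next case (17 M N P) thus ?case using iso2_total[OF T_asc[of M N P]] by simp
next case (18 f M M' g N N' h P P')
  then obtain x y z where t: "f = Over2 M M' x" "T M M' x" "g = Over2 N N' y" "T N N' y" "h = Over2 P P' z" "T P P' z"
    by (auto simp: hom2_total)
  show ?case using TD[OF t(2)] TD[OF t(4)] TD[OF t(6)] 18(4,5) asc_nat[of x y z] by (simp add: t)
next case (19 M) thus ?case using iso2_total[OF T_lun[of M]] by simp
next case (20 f M N)
  then obtain x where t: "f = Over2 M N x" "T M N x" by (auto simp: hom2_total)
  show ?case using TD[OF t(2)] lun_nat[of x] by (simp add: t)
next case (21 M) thus ?case using iso2_total[OF T_run[of M]] by simp
next case (22 f M N)
  then obtain x where t: "f = Over2 M N x" "T M N x" by (auto simp: hom2_total)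
  show ?case using TD[OF t(2)] run_nat[of x] by (simp add: t)
next case (23 M N P Q) thus ?case using pentagon[of "u1 M" "u1 N" "u1 P" "u1 Q"] by simp
next case (24 M N) thus ?case using triangle[of "u1 M" "u1 N"] by simp
qed

end

section \<open>The comparison pseudofunctor\<close>

context bicategory
begin

lemma is_wdl1_sel:
  assumes "is_wdl1 K f"
  shows "weak_distributive_law K (wA (w_src f)) (wB (w_src f)) (w\<Psi> (w_src f))"
    "weak_distributive_law K (wA (w_trg f)) (wB (w_trg f)) (w\<Psi> (w_trg f))"
    "monad_morphism K (wA (w_src f)) (wA (w_trg f)) (w_V f) (w_\<xi> f)"
    "monad_morphism K (wB (w_src f)) (wB (w_trg f)) (w_V f) (w_\<zeta> f)"
    "mobj K (wA (w_src f)) = mobj K (wB (w_src f))" "mobj K (wA (w_trg f)) = mobj K (wB (w_trg f))"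
proof -
  obtain A B \<Psi> A' B' \<Psi>' V \<xi> \<zeta> where f: "f = WDL1 (WDL A B \<Psi>) (WDL A' B' \<Psi>') V \<xi> \<zeta>"
    by (metis wdl.exhaust wdl1.exhaust)
  note d = is_wdl1D[OF assms[unfolded f]]
  show "weak_distributive_law K (wA (w_src f)) (wB (w_src f)) (w\<Psi> (w_src f))"
    "weak_distributive_law K (wA (w_trg f)) (wB (w_trg f)) (w\<Psi> (w_trg f))"
    "monad_morphism K (wA (w_src f)) (wA (w_trg f)) (w_V f) (w_\<xi> f)"
    "monad_morphism K (wB (w_src f)) (wB (w_trg f)) (w_V f) (w_\<zeta> f)"
    "mobj K (wA (w_src f)) = mobj K (wB (w_src f))" "mobj K (wA (w_trg f)) = mobj K (wB (w_trg f))"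
    using d by (simp_all add: f)
qed

lemma is_wdl2D:
  assumes "is_wdl2 K (Over2 f g \<omega>)"
  shows "is_wdl1 K f" "is_wdl1 K g" "w_src g = w_src f" "w_trg g = w_trg f"
    "monad_transformation K (wA (w_src f)) (wA (w_trg f)) (w_V f) (w_\<xi> f) (w_V g) (w_\<xi> g) \<omega>"
    "monad_transformation K (wB (w_src f)) (wB (w_trg f)) (w_V f) (w_\<zeta> f) (w_V g) (w_\<zeta> g) \<omega>"
  using assms by (simp_all add: is_wdl2_def Let_def)

lemma wdl_comp1_sel [simp]:
  "w_src (wdl_comp1 K g f) = w_src f" "w_trg (wdl_comp1 K g f) = w_trg g" "w_V (wdl_comp1 K g f) = w_V g \<otimes> w_V f"
  "w_\<xi> (wdl_comp1 K g f) = mm_comp K (wA (w_src f)) (wA (w_trg f)) (wA (w_trg g)) (w_V g) (w_\<xi> g) (w_V f) (w_\<xi> f)"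
  "w_\<zeta> (wdl_comp1 K g f) = mm_comp K (wB (w_src f)) (wB (w_trg f)) (wB (w_trg g)) (w_V g) (w_\<zeta> g) (w_V f) (w_\<zeta> f)"
  by (simp_all add: wdl_comp1_def Let_def)

lemma wdl_id1_sel [simp]:
  "w_src (wdl_id1 K X) = X" "w_trg (wdl_id1 K X) = X" "w_V (wdl_id1 K X) = id1 K (mobj K (wA X))"
  "w_\<xi> (wdl_id1 K X) = mm_id K (wA X)" "w_\<zeta> (wdl_id1 K X) = mm_id K (wB X)"
  by (simp_all add: wdl_id1_def)

lemma all_less_2: "(\<forall>j<2. P j) \<longleftrightarrow> P 0 \<and> P (Suc 0)" and all_less_3: "(\<forall>j<3. P j) \<longleftrightarrow> P 0 \<and> P (Suc 0) \<and> P 2"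
  for P :: "nat \<Rightarrow> bool"
  by (auto simp: numeral_2_eq_2 numeral_3_eq_3 less_Suc_eq)

lemma Wdl_monad_bicategory:
  "monad_bicategory K {X. weak_distributive_law K (wA X) (wB X) (w\<Psi> X)} {f. is_wdl1 K f} w_src w_trg
    (\<lambda>X. mobj K (wA X)) w_V (wdl_id1 K) (wdl_comp1 K) 2 (\<lambda>X j. [wA X, wB X] ! j) (\<lambda>f j. [w_\<xi> f, w_\<zeta> f] ! j)"
proof (unfold_locales, goal_cases)
  case 1 show ?case by simp
next
  case (2 X j)
  thus ?case using Psi_bar_hom(2)[of "wA X" "wB X" "w\<Psi> X"] by (auto simp: prelaw_def less_2_cases_iff)
next
  case (3 f)
  thus ?case using is_wdl1_sel[of f] by (simp add: all_less_2)
next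
  case (4 X)
  thus ?case using wdl_id1_closed[of X] by (simp add: all_less_2)
next
  case (5 g f)
  thus ?case using wdl_comp1_closed[of g f] by (simp add: all_less_2)
qed

lemma bicategory_Wdl: "bicategory (Wdl K)"
proof -
  have "Wdl K = monad_bicategory.total K {X. weak_distributive_law K (wA X) (wB X) (w\<Psi> X)} {f. is_wdl1 K f}
      w_src w_trg w_V (wdl_id1 K) (wdl_comp1 K) 2 (\<lambda>X j. [wA X, wB X] ! j) (\<lambda>f j. [w_\<xi> f, w_\<zeta> f] ! j)"
    by (auto simp: Wdl_def monad_bicategory.total_def[OF Wdl_monad_bicategory]
        monad_bicategory.T_def[OF Wdl_monad_bicategory] is_wdl2_def Let_def all_less_2)
  thus ?thesis using monad_bicategory.bicategory_total[OF Wdl_monad_bicategory] by simp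
qed

lemma is_bfs1_sel:
  assumes "is_bfs1 K f"
  shows "is_bfs K (b_src f)" "is_bfs K (b_trg f)"
    "monad_morphism K (bA (b_src f)) (bA (b_trg f)) (b_V f) (b_\<xi> f)"
    "monad_morphism K (bB (b_src f)) (bB (b_trg f)) (b_V f) (b_\<zeta> f)"
    "monad_morphism K (bR (b_src f)) (bR (b_trg f)) (b_V f) (b_\<rho> f)"
  using assms by (simp_all add: is_bfs1_def Let_def)

lemma is_bfs_mobj:
  assumes "is_bfs K X"
  shows "mobj K (bA X) = mobj K (bR X)" "mobj K (bB X) = mobj K (bR X)" "mobj K (bR X) \<in> Ob K"
proof -
  obtain A B R \<alpha> \<beta> \<iota> where X: "X = BFS A B R \<alpha> \<beta> \<iota>" by (cases X)
  show "mobj K (bA X) = mobj K (bR X)" "mobj K (bB X) = mobj K (bR X)" "mobj K (bR X) \<in> Ob K"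
    using is_bfsD[OF assms[unfolded X]] by (simp_all add: X)
qed

lemma is_bfs2D:
  assumes "is_bfs2 K (Over2 f g \<omega>)"
  shows "is_bfs1 K f" "is_bfs1 K g" "b_src g = b_src f" "b_trg g = b_trg f"
    "monad_transformation K (bA (b_src f)) (bA (b_trg f)) (b_V f) (b_\<xi> f) (b_V g) (b_\<xi> g) \<omega>"
    "monad_transformation K (bB (b_src f)) (bB (b_trg f)) (b_V f) (b_\<zeta> f) (b_V g) (b_\<zeta> g) \<omega>"
    "monad_transformation K (bR (b_src f)) (bR (b_trg f)) (b_V f) (b_\<rho> f) (b_V g) (b_\<rho> g) \<omega>"
  using assms by (simp_all add: is_bfs2_def Let_def)

lemma is_bfs2I:
  assumes "is_bfs1 K f" "is_bfs1 K g" "b_src g = b_src f" "b_trg g = b_trg f"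
    "monad_transformation K (bA (b_src f)) (bA (b_trg f)) (b_V f) (b_\<xi> f) (b_V g) (b_\<xi> g) \<omega>"
    "monad_transformation K (bB (b_src f)) (bB (b_trg f)) (b_V f) (b_\<zeta> f) (b_V g) (b_\<zeta> g) \<omega>"
    "monad_transformation K (bR (b_src f)) (bR (b_trg f)) (b_V f) (b_\<rho> f) (b_V g) (b_\<rho> g) \<omega>"
  shows "is_bfs2 K (Over2 f g \<omega>)"
  using assms by (simp add: is_bfs2_def Let_def)

lemma bfs_comp1_sel [simp]:
  "b_src (bfs_comp1 K g f) = b_src f" "b_trg (bfs_comp1 K g f) = b_trg g" "b_V (bfs_comp1 K g f) = b_V g \<otimes> b_V f"
  "b_\<xi> (bfs_comp1 K g f) = mm_comp K (bA (b_src f)) (bA (b_trg f)) (bA (b_trg g)) (b_V g) (b_\<xi> g) (b_V f) (b_\<xi> f)"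
  "b_\<zeta> (bfs_comp1 K g f) = mm_comp K (bB (b_src f)) (bB (b_trg f)) (bB (b_trg g)) (b_V g) (b_\<zeta> g) (b_V f) (b_\<zeta> f)"
  "b_\<rho> (bfs_comp1 K g f) = mm_comp K (bR (b_src f)) (bR (b_trg f)) (bR (b_trg g)) (b_V g) (b_\<rho> g) (b_V f) (b_\<rho> f)"
  by (simp_all add: bfs_comp1_def Let_def)

lemma bfs_id1_sel [simp]:
  "b_src (bfs_id1 K X) = X" "b_trg (bfs_id1 K X) = X" "b_V (bfs_id1 K X) = id1 K (mobj K (bR X))"
  "b_\<xi> (bfs_id1 K X) = mm_id K (bA X)" "b_\<zeta> (bfs_id1 K X) = mm_id K (bB X)" "b_\<rho> (bfs_id1 K X) = mm_id K (bR X)"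
  by (simp_all add: bfs_id1_def)

lemma Bf_monad_bicategory:
  "monad_bicategory K {X. is_bfs K X} {f. is_bfs1 K f} b_src b_trg
    (\<lambda>X. mobj K (bR X)) b_V (bfs_id1 K) (bfs_comp1 K) 3
    (\<lambda>X j. [bA X, bB X, bR X] ! j) (\<lambda>f j. [b_\<xi> f, b_\<zeta> f, b_\<rho> f] ! j)"
proof (unfold_locales, goal_cases)
  case 1 show ?case by simp
next
  case (2 X j)
  thus ?case using is_bfs_mobj[of X] by (auto simp: numeral_3_eq_3 less_Suc_eq)
next
  case (3 f)
  thus ?case using is_bfs1_sel[of f] by (simp add: all_less_3)
next
  case (4 X)
  thus ?case using bfs_id1_closed[of X] by (simp add: all_less_3)
next
  case (5 g f)
  thus ?case using bfs_comp1_closed[of g f] by (simp add: all_less_3)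
qed

lemma bicategory_Bf: "bicategory (Bf K)"
proof -
  have "Bf K = monad_bicategory.total K {X. is_bfs K X} {f. is_bfs1 K f} b_src b_trg b_V (bfs_id1 K) (bfs_comp1 K) 3
      (\<lambda>X j. [bA X, bB X, bR X] ! j) (\<lambda>f j. [b_\<xi> f, b_\<zeta> f, b_\<rho> f] ! j)"
    by (auto simp: Bf_def monad_bicategory.total_def[OF Bf_monad_bicategory]
        monad_bicategory.T_def[OF Bf_monad_bicategory] is_bfs2_def Let_def all_less_3)
  thus ?thesis using monad_bicategory.bicategory_total[OF Bf_monad_bicategory] by simp
qed

lemma F1_sel [simp]:
  "w_src (F1 K f) = F0 K (b_src f)" "w_trg (F1 K f) = F0 K (b_trg f)" "w_V (F1 K f) = b_V f"
  "w_\<xi> (F1 K f) = b_\<xi> f" "w_\<zeta> (F1 K f) = b_\<zeta> f"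
  by (simp_all add: F1_def)

lemma F0_sel [simp]: "wA (F0 K X) = bA X" "wB (F0 K X) = bB X"
  by (simp_all add: F0_def)

lemma F1_comp: "F1 K (bfs_comp1 K g f) = wdl_comp1 K (F1 K g) (F1 K f)"
  by (simp add: F1_def wdl_comp1_def Let_def)

lemma F1_id: "is_bfs K X \<Longrightarrow> F1 K (bfs_id1 K X) = wdl_id1 K (F0 K X)"
  using is_bfs_mobj[of X] by (simp add: F1_def wdl_id1_def)

lemma F2_closed: "is_bfs2 K t \<Longrightarrow> is_wdl2 K (F2 K t)"
  by (auto simp: is_bfs2_def is_wdl2_def F2_def Let_def F1_closed)

lemma Bf_simps [simp]:
  "Ob (Bf K) = {X. is_bfs K X}" "Mor (Bf K) = {f. is_bfs1 K f}" "Src (Bf K) = b_src" "Trg (Bf K) = b_trg"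
  "Cell (Bf K) = {t. is_bfs2 K t}" "Dom (Bf K) = dom2" "Cod (Bf K) = cod2" "id1 (Bf K) = bfs_id1 K"
  "id2 (Bf K) f = Over2 f f (id2 K (b_V f))" "comp1 (Bf K) g f = bfs_comp1 K g f"
  "hcomp (Bf K) s t = Over2 (bfs_comp1 K (dom2 s) (dom2 t)) (bfs_comp1 K (cod2 s) (cod2 t)) (cell2 s \<star> cell2 t)"
  "vcomp (Bf K) s t = Over2 (dom2 t) (cod2 s) (cell2 s \<cdot> cell2 t)"
  "asc (Bf K) h g f = Over2 (bfs_comp1 K (bfs_comp1 K h g) f) (bfs_comp1 K h (bfs_comp1 K g f)) (\<a> (b_V h) (b_V g) (b_V f))"
  "lun (Bf K) f = Over2 (bfs_comp1 K (bfs_id1 K (b_trg f)) f) f (\<l> (b_V f))"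
  "run (Bf K) f = Over2 (bfs_comp1 K f (bfs_id1 K (b_src f))) f (\<r> (b_V f))"
  by (simp_all add: Bf_def)

lemma Wdl_simps [simp]:
  "Ob (Wdl K) = {X. weak_distributive_law K (wA X) (wB X) (w\<Psi> X)}" "Mor (Wdl K) = {f. is_wdl1 K f}"
  "Src (Wdl K) = w_src" "Trg (Wdl K) = w_trg"
  "Cell (Wdl K) = {t. is_wdl2 K t}" "Dom (Wdl K) = dom2" "Cod (Wdl K) = cod2" "id1 (Wdl K) = wdl_id1 K"
  "id2 (Wdl K) f = Over2 f f (id2 K (w_V f))" "comp1 (Wdl K) g f = wdl_comp1 K g f"
  "hcomp (Wdl K) s t = Over2 (wdl_comp1 K (dom2 s) (dom2 t)) (wdl_comp1 K (cod2 s) (cod2 t)) (cell2 s \<star> cell2 t)"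
  "vcomp (Wdl K) s t = Over2 (dom2 t) (cod2 s) (cell2 s \<cdot> cell2 t)"
  "asc (Wdl K) h g f = Over2 (wdl_comp1 K (wdl_comp1 K h g) f) (wdl_comp1 K h (wdl_comp1 K g f)) (\<a> (w_V h) (w_V g) (w_V f))"
  "lun (Wdl K) f = Over2 (wdl_comp1 K (wdl_id1 K (w_trg f)) f) f (\<l> (w_V f))"
  "run (Wdl K) f = Over2 (wdl_comp1 K f (wdl_id1 K (w_src f))) f (\<r> (w_V f))"
  by (simp_all add: Wdl_def)

lemma F_simps [simp]:
  "P0 (Bf_to_Wdl K) = F0 K" "P1 (Bf_to_Wdl K) = F1 K" "P2 (Bf_to_Wdl K) = F2 K"
  "Pcomp (Bf_to_Wdl K) g f = Over2 (F1 K (bfs_comp1 K g f)) (F1 K (bfs_comp1 K g f)) (id2 K (b_V g \<otimes> b_V f))"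
  "Punit (Bf_to_Wdl K) X = Over2 (F1 K (bfs_id1 K X)) (F1 K (bfs_id1 K X)) (id2 K (id1 K (mobj K (bR X))))"
  by (simp_all add: Bf_to_Wdl_def)

lemma F2_sel [simp]: "dom2 (F2 K t) = F1 K (dom2 t)" "cod2 (F2 K t) = F1 K (cod2 t)" "cell2 (F2 K t) = cell2 t"
  by (simp_all add: F2_def)

lemma is_bfs1_underlying:
  assumes "is_bfs1 K f"
  shows "b_V f \<in> Mor K" "Src K (b_V f) = mobj K (bR (b_src f))" "Trg K (b_V f) = mobj K (bR (b_trg f))"
    "is_bfs K (b_src f)" "is_bfs K (b_trg f)"
  using monad_morphismD[OF is_bfs1_sel(5)[OF assms]] is_bfs1_sel[OF assms] by simp_all

lemma is_bfs2_underlying: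
  assumes "is_bfs2 K t"
  shows "cell2 t \<in> Cell K" "Dom K (cell2 t) = b_V (dom2 t)" "Cod K (cell2 t) = b_V (cod2 t)"
    "is_bfs1 K (dom2 t)" "is_bfs1 K (cod2 t)" "b_src (cod2 t) = b_src (dom2 t)" "b_trg (cod2 t) = b_trg (dom2 t)"
proof -
  have t: "is_bfs2 K (Over2 (dom2 t) (cod2 t) (cell2 t))" using assms by simp
  note d = is_bfs2D[OF t]
  show "cell2 t \<in> Cell K" "Dom K (cell2 t) = b_V (dom2 t)" "Cod K (cell2 t) = b_V (cod2 t)"
    "is_bfs1 K (dom2 t)" "is_bfs1 K (cod2 t)" "b_src (cod2 t) = b_src (dom2 t)" "b_trg (cod2 t) = b_trg (dom2 t)"
    using d monad_transformationD[OF d(5)] by simp_all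
qed

lemma identity_iso2_Wdl:
  assumes "is_wdl1 K f"
  shows "Over2 f f (id2 K (w_V f)) \<in> iso2 (Wdl K) f f"
proof -
  interpret W: bicategory "Wdl K" by (rule bicategory_Wdl)
  show ?thesis using W.iso_id[of f] W.id2_simps[of f] assms by (simp add: W.iso2_iff)
qed

lemma identity_iso2_Bf:
  assumes "is_bfs1 K f"
  shows "Over2 f f (id2 K (b_V f)) \<in> iso2 (Bf K) f f"
proof -
  interpret B: bicategory "Bf K" by (rule bicategory_Bf)
  show ?thesis using B.iso_id[of f] B.id2_simps[of f] assms by (simp add: B.iso2_iff)
qed

text \<open>The comparison preserves composites and identities strictly, so each coherence condition reduces to unit laws for
  vertical composition.\<close>

lemma pseudofunctor_F: "pseudofunctor (Bf K) (Wdl K) (Bf_to_Wdl K)"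
proof (rule pseudofunctor.intro[OF bicategory_Bf bicategory_Wdl], unfold_locales, goal_cases)
  case (1 X) thus ?case using F0_law[of X] by simp
next
  case (2 M X Y) thus ?case by (simp add: hom1_def F1_closed)
next
  case (3 f M N) thus ?case by (simp add: hom2_def F2_closed)
next
  case (4 M) thus ?case by (simp add: F2_def)
next
  case (5 g N P f M) thus ?case by (simp add: F2_def)
next
  case (6 M N)
  hence "is_wdl1 K (F1 K (bfs_comp1 K M N))" by (simp add: F1_closed bfs_comp1_closed)
  from identity_iso2_Wdl[OF this] show ?case by (simp add: F1_comp)
next
  case (7 f M M' g N N')
  hence f: "is_bfs2 K f" "is_bfs2 K g" "dom2 f = M" "cod2 f = M'" "dom2 g = N" "cod2 g = N'" "b_src M = b_trg N"
    by (simp_all add: hom2_def)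
  note u = is_bfs2_underlying[OF f(1)] is_bfs2_underlying[OF f(2)]
  note [simp] = u f is_bfs1_underlying[OF u(4)] is_bfs1_underlying[OF u(11)]
  have "Src K (b_V M) = Trg K (b_V N)" using is_bfs1_underlying[OF u(4)] is_bfs1_underlying[OF u(11)] f by simp
  thus ?case by (simp add: F2_def F1_comp)
next
  case (8 X)
  hence "is_wdl1 K (F1 K (bfs_id1 K X))" by (simp add: F1_closed bfs_id1_closed)
  from identity_iso2_Wdl[OF this] show ?case using 8 by (simp add: F1_id is_bfs_mobj)
next
  case (9 M N P)
  hence f: "is_bfs1 K M" "is_bfs1 K N" "is_bfs1 K P" "b_src M = b_trg N" "b_src N = b_trg P" by simp_all
  show ?case using is_bfs1_underlying[OF f(1)] is_bfs1_underlying[OF f(2)] is_bfs1_underlying[OF f(3)] f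
    by (simp add: F2_def F1_comp)
next
  case (10 M)
  hence f: "is_bfs1 K M" by simp
  show ?case using is_bfs1_underlying[OF f] is_bfs_mobj by (simp add: F2_def F1_comp F1_id)
next
  case (11 M)
  hence f: "is_bfs1 K M" by simp
  show ?case using is_bfs1_underlying[OF f] is_bfs_mobj by (simp add: F2_def F1_comp F1_id)
qed

lemma F1_bijective:
  assumes X: "is_bfs K X" and X': "is_bfs K X'" and w: "is_wdl1 K w" "w_src w = F0 K X" "w_trg w = F0 K X'"
  shows "\<exists>!f. is_bfs1 K f \<and> b_src f = X \<and> b_trg f = X' \<and> F1 K f = w"
proof -
  obtain A B R \<alpha> \<beta> \<iota> A' B' R' \<alpha>' \<beta>' \<iota>' where n: "X = BFS A B R \<alpha> \<beta> \<iota>" "X' = BFS A' B' R' \<alpha>' \<beta>' \<iota>'"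
    by (metis bfs.exhaust)
  obtain V \<xi> \<zeta> where w': "w = WDL1 (F0 K X) (F0 K X') V \<xi> \<zeta>" using w by (cases w) auto
  obtain \<rho> where \<rho>: "is_bfs1 K (BFS1 X X' V \<xi> \<zeta> \<rho>)"
    using F1_lift[OF X[unfolded n] X'[unfolded n], of V \<xi> \<zeta>] w(1) unfolding w' n by auto
  show ?thesis
  proof (rule ex1I[of _ "BFS1 X X' V \<xi> \<zeta> \<rho>"])
    show "is_bfs1 K (BFS1 X X' V \<xi> \<zeta> \<rho>) \<and> b_src (BFS1 X X' V \<xi> \<zeta> \<rho>) = X \<and>
        b_trg (BFS1 X X' V \<xi> \<zeta> \<rho>) = X' \<and> F1 K (BFS1 X X' V \<xi> \<zeta> \<rho>) = w"
      using \<rho> by (simp add: F1_def w')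
  next
    fix f assume f: "is_bfs1 K f \<and> b_src f = X \<and> b_trg f = X' \<and> F1 K f = w"
    then obtain \<sigma> where f': "f = BFS1 X X' V \<xi> \<zeta> \<sigma>" by (cases f) (auto simp: F1_def w')
    show "f = BFS1 X X' V \<xi> \<zeta> \<rho>"
      using F1_lift_unique[of A B R \<alpha> \<beta> \<iota> A' B' R' \<alpha>' \<beta>' \<iota>' V \<xi> \<zeta> \<sigma> \<rho>] f \<rho> unfolding f' n by simp
  qed
qed

lemma F2_reflects:
  assumes f: "is_bfs1 K f" and g: "is_bfs1 K g" and e: "b_src g = b_src f" "b_trg g = b_trg f"
    and t: "is_wdl2 K (Over2 (F1 K f) (F1 K g) \<omega>)"
  shows "is_bfs2 K (Over2 f g \<omega>)"
proof -
  obtain A B R \<alpha> \<beta> \<iota> A' B' R' \<alpha>' \<beta>' \<iota>' V \<xi> \<zeta> \<rho>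
    where f': "f = BFS1 (BFS A B R \<alpha> \<beta> \<iota>) (BFS A' B' R' \<alpha>' \<beta>' \<iota>') V \<xi> \<zeta> \<rho>"
    by (metis bfs.exhaust bfs1.exhaust)
  then obtain U \<upsilon> \<epsilon> \<sigma> where g': "g = BFS1 (BFS A B R \<alpha> \<beta> \<iota>) (BFS A' B' R' \<alpha>' \<beta>' \<iota>') U \<upsilon> \<epsilon> \<sigma>"
    using e by (cases g) auto
  note d = is_wdl2D[OF t]
  have tA: "monad_transformation K A A' V \<xi> U \<upsilon> \<omega>" and tB: "monad_transformation K B B' V \<zeta> U \<epsilon> \<omega>"
    using d(5,6) by (simp_all add: f' g')
  show ?thesis
    by (rule is_bfs2I[OF f g e]) (use tA tB F2_lift[OF f[unfolded f'] g[unfolded g'] tA tB] in \<open>simp_all add: f' g'\<close>)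
qed

text \<open>The inverse on 1-cells is the unique lift; on 2-cells it keeps the underlying 2-cell.\<close>

lemma hom_equivalence_F:
  assumes X: "is_bfs K X" and X': "is_bfs K X'"
  shows "hom_equivalence (Bf K) X X' (Wdl K) (F0 K X) (F0 K X') (F1 K) (F2 K)"
proof -
  define G1 where "G1 w = (THE f. is_bfs1 K f \<and> b_src f = X \<and> b_trg f = X' \<and> F1 K f = w)" for w
  define G2 where "G2 t = Over2 (G1 (dom2 t)) (G1 (cod2 t)) (cell2 t)" for t :: "(('m, 'c) wdl1, 'c) over2"
  have G1: "is_bfs1 K (G1 w)" "b_src (G1 w) = X" "b_trg (G1 w) = X'" "F1 K (G1 w) = w"
    if "w \<in> hom1 (Wdl K) (F0 K X) (F0 K X')" for w
    using theI'[OF F1_bijective[OF X X', of w]] that unfolding G1_def by (simp_all add: hom1_def)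
  have F1: "F1 K f \<in> hom1 (Wdl K) (F0 K X) (F0 K X')" if "f \<in> hom1 (Bf K) X X'" for f
    using that by (simp add: hom1_def F1_closed)
  have G1_F1: "G1 (F1 K f) = f" if f: "f \<in> hom1 (Bf K) X X'" for f
    using F1_bijective[OF X X', of "F1 K f"] G1[OF F1[OF f]] f F1[OF f] by (auto simp: hom1_def)
  have V: "b_V (G1 w) = w_V w" if "w \<in> hom1 (Wdl K) (F0 K X) (F0 K X')" for w
    using G1(4)[OF that] F1_sel(3)[of "G1 w"] by simp
  have 1: "hom_functor (Bf K) X X' (Wdl K) (F0 K X) (F0 K X') (F1 K) (F2 K)"
    unfolding hom_functor_def using F1 by (auto simp: hom2_def F2_closed) (simp_all add: F2_def)
  have 2: "hom_functor (Wdl K) (F0 K X) (F0 K X') (Bf K) X X' G1 G2"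
    unfolding hom_functor_def
  proof (intro conjI ballI)
    fix M assume M: "M \<in> hom1 (Wdl K) (F0 K X) (F0 K X')"
    show "G1 M \<in> hom1 (Bf K) X X'" using G1[OF M] by (simp add: hom1_def)
    show "G2 (id2 (Wdl K) M) = id2 (Bf K) (G1 M)" using V[OF M] by (simp add: G2_def)
    fix N f assume N: "N \<in> hom1 (Wdl K) (F0 K X) (F0 K X')" and f: "f \<in> hom2 (Wdl K) M N"
    have "is_wdl2 K (Over2 M N (cell2 f))" using f by (cases f) (auto simp: hom2_def)
    thus "G2 f \<in> hom2 (Bf K) (G1 M) (G1 N)"
      using F2_reflects[of "G1 M" "G1 N" "cell2 f"] G1[OF M] G1[OF N] f by (simp add: hom2_def G2_def)
    fix P g assume "g \<in> hom2 (Wdl K) N P"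
    thus "G2 (g \<cdot>\<^bsub>Wdl K\<^esub> f) = G2 g \<cdot>\<^bsub>Bf K\<^esub> G2 f" using f by (simp add: hom2_def G2_def)
  qed
  show ?thesis unfolding hom_equivalence_def
  proof (intro conjI exI[of _ G1] exI[of _ G2] exI[of _ "\<lambda>M. id2 (Bf K) M"] exI[of _ "\<lambda>M. id2 (Wdl K) M"] ballI)
    show "hom_functor (Bf K) X X' (Wdl K) (F0 K X) (F0 K X') (F1 K) (F2 K)" by (rule 1)
    show "hom_functor (Wdl K) (F0 K X) (F0 K X') (Bf K) X X' G1 G2" by (rule 2)
  next
    fix M assume M: "M \<in> hom1 (Bf K) X X'"
    show "id2 (Bf K) M \<in> iso2 (Bf K) M (G1 (F1 K M))"
      using identity_iso2_Bf[of M] M G1_F1[OF M] by (simp add: hom1_def)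
    fix N f assume N: "N \<in> hom1 (Bf K) X X'" and f: "f \<in> hom2 (Bf K) M N"
    have "is_bfs2 K f" using f by (simp add: hom2_def)
    note u = is_bfs2_underlying[OF this]
    show "id2 (Bf K) N \<cdot>\<^bsub>Bf K\<^esub> f = G2 (F2 K f) \<cdot>\<^bsub>Bf K\<^esub> id2 (Bf K) M"
      using u f G1_F1[OF M] G1_F1[OF N] is_bfs1_underlying(1)[OF u(4)] is_bfs1_underlying(1)[OF u(5)]
      by (simp add: hom2_def G2_def)
  next
    fix M assume M: "M \<in> hom1 (Wdl K) (F0 K X) (F0 K X')"
    show "id2 (Wdl K) M \<in> iso2 (Wdl K) (F1 K (G1 M)) M"
      using identity_iso2_Wdl[of M] M G1(4)[OF M] by (simp add: hom1_def)
    fix N f assume N: "N \<in> hom1 (Wdl K) (F0 K X) (F0 K X')" and f: "f \<in> hom2 (Wdl K) M N"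
    have t: "is_wdl2 K (Over2 M N (cell2 f))" using f by (cases f) (auto simp: hom2_def)
    show "id2 (Wdl K) N \<cdot>\<^bsub>Wdl K\<^esub> F2 K (G2 f) = f \<cdot>\<^bsub>Wdl K\<^esub> id2 (Wdl K) M"
      using f G1(4)[OF M] G1(4)[OF N] monad_transformationD[OF is_wdl2D(5)[OF t]]
      by (simp add: hom2_def G2_def F2_def)
  qed
qed

lemma equivalent_objects_refl:
  assumes "k \<in> Ob K"
  shows "equivalent_objects K k k"
proof -
  have "id1 K k \<in> hom1 K k k" by (rule id1_hom[OF assms])
  moreover have "inv2 K (\<l> (id1 K k)) \<in> iso2 K (id1 K k) (id1 K k \<otimes> id1 K k)"
    "\<l> (id1 K k) \<in> iso2 K (id1 K k \<otimes> id1 K k) (id1 K k)"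
    using assms by (simp_all add: iso2_iff)
  ultimately show ?thesis unfolding equivalent_objects_def by blast
qed

end

theorem theorem1p12:
  fixes K :: "('o, 'm, 'c) bicat"
  assumes "bicategory K"
    and "idempotents_split K"
  shows "biequivalence (Bf K) (Wdl K) (Bf_to_Wdl K)"
proof -
  interpret bicategory K by (rule assms(1))
  interpret W: bicategory "Wdl K" by (rule bicategory_Wdl)
  have "\<exists>X\<in>Ob (Bf K). equivalent_objects (Wdl K) (F0 K X) Y" if Y: "Y \<in> Ob (Wdl K)" for Y
  proof -
    obtain X where "is_bfs K X" "F0 K X = Y"
      using splitting_factorization[OF _ assms(2), of "wA Y" "wB Y" "w\<Psi> Y"] Y by auto
    thus ?thesis using W.equivalent_objects_refl[OF Y] by auto
  qed
  thus ?thesis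
    unfolding biequivalence_def using pseudofunctor_F hom_equivalence_F by simp
qed

end
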